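(* Let $U\subset\mathbb{R}^n$ be open and let $\beta=\sum_{I,J\subset\{1,\dots,n\},\,|I|+|J|=2n-1}\beta_{I,J}(x,\xi)\,dx_I\wedge d\xi_J\in\Omega^{2n-1}CS_{\rm com}(U)$ be a symbol valued form, with $\beta_{I,J}\in CS(U)$. Then $$-\!\!\!\!\!\int_{T^*U}d\beta=\sum_{I,J}\int_{S^*(0,1)}\beta_{I,J,\,-n+1}(x,\xi)\,dx_I\wedge d\xi_J,$$ so that Stokes' formula $$-\!\!\!\!\!\int_{T^*U}d\beta=0$$ holds whenever $\beta\in\Omega^{2n-1}CS_{\rm com}^{\notin\mathbb{Z}}(U)$.
   Context: $U\subset\mathbb{R}^n$ is open, $T^*U=U\times\mathbb{R}^n$ with coordinates $(x,\xi)$, $|\xi|$ the Euclidean norm. Fix a smooth function $\chi$ on $T^*U$ with $\chi=0$ for $|\xi|\le 1/2$ and $\chi=1$ for $|\xi|\ge 1$. A symbol $\sigma$ is classical of order $m\in\mathbb{C}$ ($\sigma\in CS^m(U)$) if for every positive integer $N$, $\sigma=\sum_{i=0}^N\chi\,\sigma_{m-i}+\sigma_{(N)}$ with $\sigma_{m-i}$ positively homogeneous of degree $m-i$ in $\xi\ne0$ and $\sigma_{(N)}$ a symbol of order $m-N-1$ (i.e. $\mathrm{Re}(m)-N-1$). $CS(U)$ is the algebra generated by all $CS^m(U)$, $m\in\mathbb{C}$. The subscript "com" means compact support in $x\in U$. $\Omega^kCS^m_{\rm com}(U)$ is the set of $k$-forms $\sum_{|I|+|J|=k}\alpha_{I,J}\,dx_I\wedge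 d\xi_J$ on $T^*U$ with $\alpha_{I,J}\in CS_{\rm com}^{m-|J|}(U)$; $\Omega^kCS_{\rm com}(U)$ is generated by these over all $m\in\mathbb{C}$, and $\Omega^kCS^{\notin\mathbb{Z}}_{\rm com}(U)=\bigcup_{m\notin\mathbb{Z}}\Omega^kCS^m_{\rm com}(U)$. $\beta_{I,J,\,-n+1}$ is the positively homogeneous component of degree $-n+1$ of $\beta_{I,J}$ (zero if there is none). Cut-off integral: for $\sigma\in CS(U)$ and $x\in U$, $\int_{|\xi|\le R}\sigma(x,\xi)\,d\xi$ has an asymptotic expansion as $R\to\infty$ in powers of $R$ with nonzero exponents, a $\log R$ term and a constant term; the cut-off integral $-\!\!\!\!\int_{T_x^*U}\sigma(x,\xi)\,d\xi$ is the constant term (finite part), and for $\sigma\in CS_{\rm com}(U)$, $-\!\!\!\!\int_{T^*U}\sigma=\int_U dx\,-\!\!\!\!\int_{T_x^*U}\sigma(x,\xi)\,d\xi$. For a form $\alpha=\sum\alpha_{I,J}\,dx_I\wedge d\xi_J$ with compact support, $-\!\!\!\!\int_{T^*U}\alpha=-\!\!\!\!\int_{T^*U}\alpha_{I,J}$ with $|I|=|J|=n$, the other terms contributing $0$. $S^*(0,1)=\{(x,\xi):x\in U,|\xi|=1\}$, oriented as the boundary of $\{|\xi|\le1\}$ in $T^*U$ oriented by $dx_1\wedge\cdots\wedge dx_n\wedge d\xi_1\wedge\cdots\wedge d\xi_n$; the forms are restricted to it. *)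

theory Defs
  imports "HOL-Analysis.Analysis"
begin

section \<open>Smooth functions\<close>

definition dir_deriv ::
  "'a::real_normed_vector \<Rightarrow> ('a \<Rightarrow> 'b::real_normed_vector) \<Rightarrow> 'a \<Rightarrow> 'b" where
  "dir_deriv v f = (\<lambda>p. frechet_derivative f (at p) v)"

abbreviation iter_deriv ::
  "'a::real_normed_vector list \<Rightarrow> ('a \<Rightarrow> 'b::real_normed_vector) \<Rightarrow> 'a \<Rightarrow> 'b" where
  "iter_deriv vs f \<equiv> foldr dir_deriv vs f"

text \<open>Smoothness, meant for open \<open>S\<close>: all iterated partial derivatives are differentiable on \<open>S\<close>.\<close>

definition smooth_on ::
  "'a::euclidean_space set \<Rightarrow> ('a \<Rightarrow> 'b::real_normed_vector) \<Rightarrow> bool" where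
  "smooth_on S f \<longleftrightarrow>
     (\<forall>vs. set vs \<subseteq> Basis \<longrightarrow> (\<forall>p\<in>S. iter_deriv vs f differentiable (at p)))"

section \<open>Classical symbols\<close>

text \<open>A point \<open>(x, \<xi>)\<close> of the cotangent bundle. Functions on \<open>U \<times> UNIV\<close> are
  total functions whose values off \<open>U \<times> UNIV\<close> are never used. The linear order on the index
  type only fixes the order of the factors in \<open>dx\<^sub>I \<and> d\<xi>\<^sub>J\<close>.\<close>

type_synonym 'n cot = "(real ^ 'n) \<times> (real ^ 'n)"

definition symbols :: "(real ^ 'n) set \<Rightarrow> real \<Rightarrow> ('n::finite cot \<Rightarrow> complex) set" where
  "symbols U r = {\<sigma>. smooth_on (U \<times> UNIV) \<sigma> \<and>
     (\<forall>K as bs. compact K \<and> K \<subseteq> U \<and> set as \<subseteq> Basis \<and> set bs \<subseteq> Basis \<longrightarrow>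
        (\<exists>C. \<forall>x\<in>K. \<forall>\<xi>.
           norm (iter_deriv (map (\<lambda>a. (a, 0)) as @ map (\<lambda>b. (0, b)) bs) \<sigma> (x, \<xi>))
             \<le> C * (1 + norm \<xi>) powr (r - real (length bs))))}"

definition cutoff_function :: "(real ^ 'n) set \<Rightarrow> ('n::finite cot \<Rightarrow> complex) \<Rightarrow> bool" where
  "cutoff_function U chi \<longleftrightarrow> smooth_on (U \<times> UNIV) chi \<and>
     (\<forall>x\<in>U. \<forall>\<xi>. (norm \<xi> \<le> 1/2 \<longrightarrow> chi (x, \<xi>) = 0) \<and> (norm \<xi> \<ge> 1 \<longrightarrow> chi (x, \<xi>) = 1))"

definition pos_homogeneous ::
  "(real ^ 'n) set \<Rightarrow> complex \<Rightarrow> ('n::finite cot \<Rightarrow> complex) \<Rightarrow> bool" where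
  "pos_homogeneous U d s \<longleftrightarrow> smooth_on (U \<times> (UNIV - {0})) s \<and>
     (\<forall>x\<in>U. \<forall>\<xi>. \<forall>t::real. \<xi> \<noteq> 0 \<and> t > 0 \<longrightarrow>
        s (x, t *\<^sub>R \<xi>) = complex_of_real t powr d * s (x, \<xi>))"

text \<open>\<open>s i\<close> is the homogeneous component \<open>\<sigma>\<^bsub>m-i\<^esub>\<close>.\<close>

definition classical_expansion ::
  "(real ^ 'n) set \<Rightarrow> ('n::finite cot \<Rightarrow> complex) \<Rightarrow> complex \<Rightarrow>
     ('n cot \<Rightarrow> complex) \<Rightarrow> (nat \<Rightarrow> 'n cot \<Rightarrow> complex) \<Rightarrow> bool" where
  "classical_expansion U chi m \<sigma> s \<longleftrightarrow>
     (\<exists>r. \<sigma> \<in> symbols U r) \<and>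
     (\<forall>i. pos_homogeneous U (m - of_nat i) (s i)) \<and>
     (\<forall>N\<ge>1. (\<lambda>p. \<sigma> p - (\<Sum>i\<le>N. chi p * s i p)) \<in> symbols U (Re m - real N - 1))"

definition CS_order ::
  "(real ^ 'n) set \<Rightarrow> ('n::finite cot \<Rightarrow> complex) \<Rightarrow> complex \<Rightarrow> ('n cot \<Rightarrow> complex) set" where
  "CS_order U chi m = {\<sigma>. \<exists>s. classical_expansion U chi m \<sigma> s}"

inductive_set CS ::
  "(real ^ 'n) set \<Rightarrow> ('n::finite cot \<Rightarrow> complex) \<Rightarrow> ('n cot \<Rightarrow> complex) set"
  for U chi where
  generator: "\<sigma> \<in> CS_order U chi m \<Longrightarrow> \<sigma> \<in> CS U chi"
| add: "\<lbrakk>\<sigma> \<in> CS U chi; \<tau> \<in> CS U chi\<rbrakk> \<Longrightarrow> (\<lambda>p. \<sigma> p + \<tau> p) \<in> CS U chi"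
| scale: "\<sigma> \<in> CS U chi \<Longrightarrow> (\<lambda>p. c * \<sigma> p) \<in> CS U chi"
| mult: "\<lbrakk>\<sigma> \<in> CS U chi; \<tau> \<in> CS U chi\<rbrakk> \<Longrightarrow> (\<lambda>p. \<sigma> p * \<tau> p) \<in> CS U chi"

definition compact_x_support :: "(real ^ 'n) set \<Rightarrow> ('n::finite cot \<Rightarrow> complex) \<Rightarrow> bool" where
  "compact_x_support U \<sigma> \<longleftrightarrow>
     (\<exists>K. compact K \<and> K \<subseteq> U \<and> (\<forall>x\<in>U - K. \<forall>\<xi>. \<sigma> (x, \<xi>) = 0))"

definition CS_com_order ::
  "(real ^ 'n) set \<Rightarrow> ('n::finite cot \<Rightarrow> complex) \<Rightarrow> complex \<Rightarrow> ('n cot \<Rightarrow> complex) set" where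
  "CS_com_order U chi m = {\<sigma> \<in> CS_order U chi m. compact_x_support U \<sigma>}"

text \<open>Elements of \<open>CS U chi\<close> are finite sums of classical symbols \<open>f k\<close> of orders \<open>m k\<close>, because
  a product of classical symbols is again classical. The component of degree \<open>d\<close> adds up the
  components of degree \<open>d\<close> of the \<open>f k\<close>; the inner sum has at most one term, and
  none if \<open>m k - d\<close> is not a natural number. Setting the component to \<open>0\<close> where it is
  not defined makes it unique as a total function.\<close>

definition is_hom_component ::
  "(real ^ 'n) set \<Rightarrow> ('n::finite cot \<Rightarrow> complex) \<Rightarrow> ('n cot \<Rightarrow> complex) \<Rightarrow> complex \<Rightarrow>
     ('n cot \<Rightarrow> complex) \<Rightarrow> bool" where
  "is_hom_component U chi \<sigma> d h \<longleftrightarrow>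
     (\<exists>(K::nat) m f s.
        (\<forall>k<K. classical_expansion U chi (m k) (f k) (s k)) \<and>
        (\<forall>p\<in>U \<times> UNIV. \<sigma> p = (\<Sum>k<K. f k p)) \<and>
        h = (\<lambda>p. if p \<in> U \<times> (UNIV - {0})
                 then \<Sum>k<K. \<Sum>i | m k - of_nat i = d. s k i p else 0))"

definition hom_component ::
  "(real ^ 'n) set \<Rightarrow> ('n::finite cot \<Rightarrow> complex) \<Rightarrow> ('n cot \<Rightarrow> complex) \<Rightarrow> complex \<Rightarrow>
     'n cot \<Rightarrow> complex" where
  "hom_component U chi \<sigma> d = (THE h. is_hom_component U chi \<sigma> d h)"

section \<open>Differential forms\<close>

text \<open>A \<open>k\<close>-form is evaluated at a point on lists of \<open>k\<close> tangent vectors; its values on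
  lists of other lengths are irrelevant.\<close>

type_synonym 'n dform = "'n cot \<Rightarrow> 'n cot list \<Rightarrow> complex"

definition wedge_covectors :: "('a \<Rightarrow> real) list \<Rightarrow> 'a list \<Rightarrow> real" where
  "wedge_covectors \<theta>s vs =
     (\<Sum>\<pi> | \<pi> permutes {..<length \<theta>s}.
        of_int (sign \<pi>) * (\<Prod>r<length \<theta>s. (\<theta>s ! r) (vs ! \<pi> r)))"

definition dx_dxi :: "'n set \<Rightarrow> 'n set \<Rightarrow> 'n::{finite,linorder} cot list \<Rightarrow> real" where
  "dx_dxi I J = wedge_covectors
     (map (\<lambda>i v. fst v $ i) (sorted_list_of_set I) @ map (\<lambda>j v. snd v $ j) (sorted_list_of_set J))"

text \<open>A symbol valued form is given by its coefficients \<open>\<alpha> I J\<close>.\<close>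

type_synonym 'n coeffs = "'n set \<Rightarrow> 'n set \<Rightarrow> 'n cot \<Rightarrow> complex"

definition form_of :: "nat \<Rightarrow> 'n::{finite,linorder} coeffs \<Rightarrow> 'n dform" where
  "form_of k \<alpha> = (\<lambda>p vs.
     \<Sum>(I, J) | card I + card J = k. \<alpha> I J p * of_real (dx_dxi I J vs))"

definition Omega_CS_com_order ::
  "(real ^ 'n) set \<Rightarrow> ('n::finite cot \<Rightarrow> complex) \<Rightarrow> nat \<Rightarrow> complex \<Rightarrow> 'n coeffs set" where
  "Omega_CS_com_order U chi k m =
     {\<alpha>. \<forall>I J. card I + card J = k \<longrightarrow> \<alpha> I J \<in> CS_com_order U chi (m - of_nat (card J))}"

inductive_set Omega_CS_com ::
  "(real ^ 'n) set \<Rightarrow> ('n::finite cot \<Rightarrow> complex) \<Rightarrow> nat \<Rightarrow> 'n coeffs set"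
  for U chi k where
  generator: "\<alpha> \<in> Omega_CS_com_order U chi k m \<Longrightarrow> \<alpha> \<in> Omega_CS_com U chi k"
| add: "\<lbrakk>\<alpha> \<in> Omega_CS_com U chi k; \<beta> \<in> Omega_CS_com U chi k\<rbrakk> \<Longrightarrow>
    (\<lambda>I J p. \<alpha> I J p + \<beta> I J p) \<in> Omega_CS_com U chi k"
| scale: "\<alpha> \<in> Omega_CS_com U chi k \<Longrightarrow> (\<lambda>I J p. c * \<alpha> I J p) \<in> Omega_CS_com U chi k"

definition Omega_CS_com_nonint ::
  "(real ^ 'n) set \<Rightarrow> ('n::finite cot \<Rightarrow> complex) \<Rightarrow> nat \<Rightarrow> 'n coeffs set" where
  "Omega_CS_com_nonint U chi k = (\<Union>m\<in>- \<int>. Omega_CS_com_order U chi k m)"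

text \<open>The invariant formula for the exterior derivative, with constant vector fields. Its
  normalisation matches the determinant convention of \<open>wedge_covectors\<close>:
  \<open>d(f \<theta>\<^sub>1 \<and> \<dots> \<and> \<theta>\<^sub>k) = df \<and> \<theta>\<^sub>1 \<and> \<dots> \<and> \<theta>\<^sub>k\<close> for constant \<open>\<theta>\<^sub>i\<close>.\<close>

definition ext_deriv :: "'n::finite dform \<Rightarrow> 'n dform" where
  "ext_deriv \<omega> = (\<lambda>p vs. \<Sum>i<length vs.
     (-1) ^ i * dir_deriv (vs ! i) (\<lambda>q. \<omega> q (take i vs @ drop (Suc i) vs)) p)"

section \<open>Cut-off integrals\<close>

text \<open>Terms of an expansion that tend to \<open>0\<close> as \<open>R \<rightarrow> \<infinity>\<close> do not affect the constant term, so
  it suffices to expand up to \<open>o(1)\<close>. Exponents may be complex.\<close>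

definition finite_part :: "(real \<Rightarrow> complex) \<Rightarrow> complex" where
  "finite_part F = (THE c. \<exists>Z a b. finite Z \<and> 0 \<notin> Z \<and>
     ((\<lambda>R. F R - ((\<Sum>z\<in>Z. a z * complex_of_real R powr z) + b * complex_of_real (ln R) + c))
        \<longlongrightarrow> 0) at_top)"

definition cutoff_integral_fibre :: "('n::finite cot \<Rightarrow> complex) \<Rightarrow> real ^ 'n \<Rightarrow> complex" where
  "cutoff_integral_fibre \<sigma> x = finite_part (\<lambda>R. LINT \<xi>:cball 0 R|lborel. \<sigma> (x, \<xi>))"

definition cutoff_integral :: "(real ^ 'n) set \<Rightarrow> ('n::finite cot \<Rightarrow> complex) \<Rightarrow> complex" where
  "cutoff_integral U \<sigma> = (LINT x:U|lborel. cutoff_integral_fibre \<sigma> x)"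

definition std_frame :: "'n::{finite,linorder} cot list" where
  "std_frame = map (\<lambda>i. (axis i 1, 0)) (sorted_list_of_set UNIV)
             @ map (\<lambda>j. (0, axis j 1)) (sorted_list_of_set UNIV)"

text \<open>For a form of top degree \<open>2n\<close>, the value on the standard frame is the coefficient of
  \<open>dx\<^sub>1 \<and> \<dots> \<and> dx\<^sub>n \<and> d\<xi>\<^sub>1 \<and> \<dots> \<and> d\<xi>\<^sub>n\<close>.\<close>

definition cutoff_integral_form :: "(real ^ 'n::{finite,linorder}) set \<Rightarrow> 'n dform \<Rightarrow> complex" where
  "cutoff_integral_form U \<omega> = cutoff_integral U (\<lambda>p. \<omega> p std_frame)"

section \<open>Integration over the cosphere bundle\<close>

text \<open>Surface measure of the unit sphere: \<open>n\<close> times the Lebesgue measure of the cone over a set.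
  For \<open>n = 1\<close> it is the counting measure on \<open>{-1, 1}\<close>.\<close>

definition sphere_measure :: "(real ^ 'n::finite) measure" where
  "sphere_measure = scale_measure (of_nat CARD('n))
     (distr (restrict_space lborel (ball 0 1 - {0})) borel (\<lambda>\<xi>. \<xi> /\<^sub>R norm \<xi>))"

text \<open>The density \<open>g\<close> of the restriction of a \<open>(2n-1)\<close>-form to the unit cosphere bundle with
  respect to the Riemannian volume form of its boundary orientation. The outward unit normal at
  \<open>p = (x, \<xi>)\<close> is \<open>(0, \<xi>)\<close>, the tangent vectors are those orthogonal to it, and the volume form
  is the contraction of \<open>dx\<^sub>1 \<and> \<dots> \<and> dx\<^sub>n \<and> d\<xi>\<^sub>1 \<and> \<dots> \<and> d\<xi>\<^sub>n\<close> with the normal (outward normal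
  first).\<close>

definition cosphere_density :: "'n::{finite,linorder} dform \<Rightarrow> 'n cot \<Rightarrow> complex" where
  "cosphere_density \<omega> p = (THE g. \<forall>ts.
     length ts = 2 * CARD('n) - 1 \<and> (\<forall>t\<in>set ts. t \<bullet> (0, snd p) = 0) \<longrightarrow>
       \<omega> p ts = g * of_real (dx_dxi UNIV UNIV ((0, snd p) # ts)))"

definition cosphere_integral :: "(real ^ 'n::{finite,linorder}) set \<Rightarrow> 'n dform \<Rightarrow> complex" where
  "cosphere_integral U \<omega> =
     (LINT p:U \<times> sphere 0 1|lborel \<Otimes>\<^sub>M sphere_measure. cosphere_density \<omega> p)"

end

theory Submission
  imports Defs "Jordan_Normal_Form.Determinant"
begin

text \<open>
  In coordinates, \<open>d\<beta>\<close> is a signed sum of partial derivatives of the coefficients of \<open>\<beta>\<close>.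

  For a \<open>\<xi>\<close>-derivative, the divergence theorem turns the integral over \<open>|\<xi>| \<le> R\<close> into
  \<open>R\<^sup>n\<^sup>-\<^sup>1\<close> times the integral of \<open>\<sigma>(x, R\<omega>) \<omega>\<^sub>j\<close> over the unit sphere. The homogeneous component of
  degree \<open>e\<close> of \<open>\<sigma>\<close> contributes a multiple of \<open>R\<close> to the power \<open>e + n - 1\<close>, so the constant term only
  sees the component of degree \<open>1 - n\<close>; the factor \<open>\<omega>\<^sub>j\<close> is, up to the sign, the density of
  \<open>dx\<^sub>I \<and> d\<xi>\<^sub>J\<close> on the cosphere bundle.

  For an \<open>x\<close>-derivative, the integral over \<open>x\<close> and \<open>|\<xi>| \<le> R\<close> vanishes for every \<open>R\<close>. Its expansion in
  \<open>R\<close> is obtained by integrating the expansions of the fibres over \<open>x\<close>, so the uniqueness of the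
  constant term shows that the integral over \<open>x\<close> of the finite parts vanishes as well. The
  corresponding forms \<open>dx\<^sub>I \<and> d\<xi>\<^sub>1 \<and> \<dots> \<and> d\<xi>\<^sub>n\<close> vanish on the cosphere bundle.

  A classical symbol of non-integral order has no component of degree \<open>1 - n\<close>.
\<close>

text \<open>The cut-off integral, the homogeneous component and the cosphere density are all
  \<open>THE\<close>-terms, so each needs existence and uniqueness. Uniqueness of constant terms
  serves three times: for the fibre integrals, for the component of degree \<open>1 - n\<close> (the
  constant term of \<open>t powr (n - 1) * \<sigma> (x, t *\<^sub>R \<xi>)\<close>, hence
  independent of the chosen decomposition), and for the vanishing in the \<open>x\<close> case. The
  obstacle is that finite parts are taken fibre by fibre, which yields neither measurability in
  \<open>x\<close> nor a way to integrate the expansions. Both come from a quantitative estimate: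
  after subtraction of the divergent terms the ball integral differs from its constant by at most
  \<open>C / R\<close>, with one \<open>C\<close> for the whole compact support. This rate is a
  remainder of order \<open>- n - 1\<close> on the sphere of radius \<open>R\<close>, times
  \<open>R ^ (n - 1)\<close>, integrated in \<open>R\<close>. The divergence theorem for balls is
  reached without charts or polar coordinates: ball integrals are differentiated in the radius, and
  a weight that vanishes on the boundary reduces the claim to the vanishing integral of a compactly
  supported derivative.\<close>

no_notation Matrix.vec_index (infixl "$" 100)
no_notation Matrix.scalar_prod (infix "\<bullet>" 70)

section \<open>Forms in the coordinate frame\<close>

text \<open>The Leibniz formula, with covectors as rows and vectors as columns. In this form Laplace
  expansion and the kernel criterion for singular matrices apply to forms.\<close>

lemma wedge_covectors_eq_det:
  assumes "length \<theta>s = m"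
  shows "wedge_covectors \<theta>s vs = Determinant.det (mat m m (\<lambda>(r, s). (\<theta>s ! r) (vs ! s)))"
proof -
  define A where "A = mat m m (\<lambda>(r, s). (\<theta>s ! r) (vs ! s))"
  have "(\<Prod>r<m. (\<theta>s ! r) (vs ! \<pi> r)) = (\<Prod>i = 0..<m. A $$ (i, \<pi> i))"
    if \<pi>: "\<pi> permutes {0..<m}" for \<pi>
  proof (rule prod.cong)
    fix r assume "r \<in> {0..<m}"
    moreover from this have "\<pi> r \<in> {0..<m}" using permutes_in_image[OF \<pi>] by blast
    ultimately show "(\<theta>s ! r) (vs ! \<pi> r) = A $$ (r, \<pi> r)" by (simp add: A_def)
  qed (simp add: lessThan_atLeast0)
  then have "wedge_covectors \<theta>s vs
      = (\<Sum>\<pi> | \<pi> permutes {0..<m}. of_int (sign \<pi>) * (\<Prod>i = 0..<m. A $$ (i, \<pi> i)))"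
    unfolding wedge_covectors_def assms lessThan_atLeast0 by (intro sum.cong) auto
  also have "\<dots> = Determinant.det A"
    by (rule det_def'[symmetric]) (simp add: A_def)
  finally show ?thesis unfolding A_def .
qed

text \<open>Laplace expansion along the first column, that is, the rule for contracting a wedge
  product with \<open>v\<close>.\<close>

lemma wedge_covectors_Cons:
  assumes "length \<theta>s = Suc (length ts)"
  shows "wedge_covectors \<theta>s (v # ts) =
    (\<Sum>i<length \<theta>s. (-1) ^ i * (\<theta>s ! i) v * wedge_covectors (take i \<theta>s @ drop (Suc i) \<theta>s) ts)"
proof -
  define m where "m = length \<theta>s"
  define A where "A = mat m m (\<lambda>(r, s). (\<theta>s ! r) ((v # ts) ! s))"
  have A: "A \<in> carrier_mat m m" by (simp add: A_def)
  have m: "m > 0" using assms by (simp add: m_def)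
  have "cofactor A i 0 = (-1) ^ i * wedge_covectors (take i \<theta>s @ drop (Suc i) \<theta>s) ts" if i: "i < m" for i
  proof -
    have "mat_delete A i 0 = mat (m - 1) (m - 1) (\<lambda>(r, s). ((take i \<theta>s @ drop (Suc i) \<theta>s) ! r) (ts ! s))"
      using i m by (intro eq_matI) (auto simp: mat_delete_def A_def nth_append m_def)
    moreover have "length (take i \<theta>s @ drop (Suc i) \<theta>s) = m - 1"
      using i by (auto simp: m_def)
    ultimately show ?thesis by (simp add: cofactor_def wedge_covectors_eq_det)
  qed
  moreover have "A $$ (i, 0) = (\<theta>s ! i) v" if "i < m" for i using that m by (simp add: A_def)
  moreover have "wedge_covectors \<theta>s (v # ts) = Determinant.det A"
    unfolding A_def by (rule wedge_covectors_eq_det) (simp add: m_def)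
  ultimately show ?thesis
    unfolding m_def[symmetric] using laplace_expansion_column[OF A m]
    by (auto intro!: sum.cong simp: mult.left_commute)
qed

lemma wedge_covectors_dual:
  assumes "\<And>r s. r < length \<theta>s \<Longrightarrow> s < length \<theta>s \<Longrightarrow> (\<theta>s ! r) (vs ! s) = (if r = s then 1 else 0)"
  shows "wedge_covectors \<theta>s vs = 1"
proof -
  have "mat (length \<theta>s) (length \<theta>s) (\<lambda>(r, s). (\<theta>s ! r) (vs ! s)) = 1\<^sub>m (length \<theta>s)"
    using assms by (intro eq_matI) auto
  then show ?thesis by (simp add: wedge_covectors_eq_det)
qed

lemma wedge_covectors_eq_0:
  assumes r: "r < length \<theta>s" and z: "\<And>s. s < length \<theta>s \<Longrightarrow> (\<theta>s ! r) (vs ! s) = 0"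
  shows "wedge_covectors \<theta>s vs = 0"
proof -
  have "(\<Prod>r<length \<theta>s. (\<theta>s ! r) (vs ! \<pi> r)) = 0" if "\<pi> permutes {..<length \<theta>s}" for \<pi>
    using r z[of "\<pi> r"] permutes_in_image[OF that, of r] by (intro prod_zero) auto
  then show ?thesis unfolding wedge_covectors_def by (intro sum.neutral) simp
qed

lemma take_drop_eq_map_upt:
  assumes "k < m"
  shows "take k (map f [0..<m]) @ drop (Suc k) (map f [0..<m])
    = map (\<lambda>r. f (if r < k then r else Suc r)) [0..<m - 1]"
  using assms by (intro nth_equalityI) (auto simp: nth_append)

section \<open>Numbering of the \<open>2n\<close> coordinates, and the forms that omit one of
  them\<close>

abbreviation index_list :: "'n::{finite,linorder} list" where
  "index_list \<equiv> sorted_list_of_set UNIV"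

lemma index_list_nth_eq_iff:
  "a < CARD('n) \<Longrightarrow> b < CARD('n) \<Longrightarrow>
     (index_list ! a = (index_list ! b :: 'n::{finite,linorder})) \<longleftrightarrow> a = b"
  by (subst nth_eq_iff_index_eq) auto

lemma sum_index_list:
  "(\<Sum>i\<in>(UNIV :: 'n::{finite,linorder} set). f i) = (\<Sum>k<CARD('n). f (index_list ! k))"
proof -
  have "bij_betw (\<lambda>k. index_list ! k) {..<CARD('n)} (UNIV :: 'n set)"
    using bij_betw_nth[of "index_list :: 'n list" "{..<CARD('n)}" UNIV] by simp
  then show ?thesis by (rule sum.reindex_bij_betw[symmetric])
qed

definition cot_coord :: "nat \<Rightarrow> 'n::{finite,linorder} cot \<Rightarrow> real" where
  "cot_coord k v = (if k < CARD('n) then fst v $ (index_list ! k) else snd v $ (index_list ! (k - CARD('n))))"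

text \<open>The coordinates are numbered from \<open>0\<close>, those of \<open>x\<close> first; \<open>omit_x k\<close> and \<open>omit_xi k\<close> are the
  sets \<open>I\<close> and \<open>J\<close> of the form \<open>dx\<^sub>I \<and> d\<xi>\<^sub>J\<close> that lacks the \<open>k\<close>-th one.\<close>

definition omit_x :: "nat \<Rightarrow> 'n::{finite,linorder} set" where
  "omit_x k = (if k < CARD('n) then UNIV - {index_list ! k} else UNIV)"

definition omit_xi :: "nat \<Rightarrow> 'n::{finite,linorder} set" where
  "omit_xi k = (if k < CARD('n) then UNIV else UNIV - {index_list ! (k - CARD('n))})"

lemma index_list_remove:
  assumes "k < CARD('n)"
  shows "sorted_list_of_set (UNIV - {index_list ! k :: 'n::{finite,linorder}})
    = take k index_list @ drop (Suc k) index_list"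
proof -
  let ?l = "index_list :: 'n list"
  have l: "?l = take k ?l @ ?l ! k # drop (Suc k) ?l"
    using assms by (intro id_take_nth_drop) simp
  have d: "distinct ?l" by simp
  have "?l ! k \<notin> set (take k ?l)"
    using d by (subst (asm) l) auto
  then have "remove1 (?l ! k) (take k ?l @ ?l ! k # drop (Suc k) ?l) = take k ?l @ drop (Suc k) ?l"
    by (simp add: remove1_append)
  then show ?thesis using l by (simp add: sorted_list_of_set_remove)
qed

lemma covectors_UNIV:
  "map (\<lambda>i v. fst v $ i) index_list @ map (\<lambda>j v. snd v $ j) (index_list :: 'n list)
    = map cot_coord [0..<2 * CARD('n::{finite,linorder})]" (is "?a = ?b")
proof (rule nth_equalityI)
  show "?a ! i = ?b ! i" if "i < length ?a" for i
    using that by (auto simp: nth_append cot_coord_def fun_eq_iff)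
qed simp

lemma dx_dxi_UNIV:
  "(dx_dxi UNIV UNIV :: 'n::{finite,linorder} cot list \<Rightarrow> real)
    = wedge_covectors (map cot_coord [0..<2 * CARD('n)])"
  unfolding dx_dxi_def covectors_UNIV ..

lemma dx_dxi_omit:
  assumes k: "k < 2 * CARD('n)"
  shows "(dx_dxi (omit_x k) (omit_xi k) :: 'n::{finite,linorder} cot list \<Rightarrow> real)
    = wedge_covectors (take k (map cot_coord [0..<2 * CARD('n)])
        @ drop (Suc k) (map cot_coord [0..<2 * CARD('n)]))"
proof (cases "k < CARD('n)")
  case True
  then show ?thesis
    unfolding dx_dxi_def covectors_UNIV[symmetric]
    by (simp add: omit_x_def omit_xi_def index_list_remove take_map drop_map)
next
  case False
  then have "k - CARD('n) < CARD('n)" using k by auto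
  with False show ?thesis
    unfolding dx_dxi_def covectors_UNIV[symmetric]
    by (simp add: omit_x_def omit_xi_def index_list_remove take_map drop_map Suc_diff_le)
qed

lemma length_std_frame: "length (std_frame :: 'n::{finite,linorder} cot list) = 2 * CARD('n)"
  by (simp add: std_frame_def)

lemma std_frame_nth:
  "k < CARD('n) \<Longrightarrow> (std_frame :: 'n::{finite,linorder} cot list) ! k = (axis (index_list ! k) 1, 0)"
  "CARD('n) \<le> k \<Longrightarrow> k < 2 * CARD('n) \<Longrightarrow>
     (std_frame :: 'n::{finite,linorder} cot list) ! k = (0, axis (index_list ! (k - CARD('n))) 1)"
  by (auto simp: std_frame_def nth_append)

lemma cot_coord_std_frame:
  assumes "r < 2 * CARD('n)" "k < 2 * CARD('n)"
  shows "cot_coord r ((std_frame :: 'n::{finite,linorder} cot list) ! k) = (if r = k then 1 else 0)"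
proof -
  consider "r < CARD('n)" "k < CARD('n)" | "r < CARD('n)" "CARD('n) \<le> k"
    | "CARD('n) \<le> r" "k < CARD('n)" | "CARD('n) \<le> r" "CARD('n) \<le> k" by linarith
  then show ?thesis
  proof cases
    case 1
    then show ?thesis by (simp add: std_frame_nth cot_coord_def axis_def index_list_nth_eq_iff)
  next
    case 4
    then have "r - CARD('n) < CARD('n)" "k - CARD('n) < CARD('n)" "r - CARD('n) = k - CARD('n) \<longleftrightarrow> r = k"
      using assms by auto
    with 4 assms show ?thesis
      by (auto simp: std_frame_nth cot_coord_def axis_def index_list_nth_eq_iff)
  qed (use assms in \<open>auto simp: std_frame_nth cot_coord_def\<close>)
qed

lemma inner_cot_coord:
  "(v :: 'n::{finite,linorder} cot) \<bullet> w = (\<Sum>k<2 * CARD('n). cot_coord k v * cot_coord k w)"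
proof -
  have "(\<Sum>k<2 * CARD('n). cot_coord k v * cot_coord k w)
      = (\<Sum>k<CARD('n). cot_coord k v * cot_coord k w)
        + (\<Sum>k<CARD('n). cot_coord (k + CARD('n)) v * cot_coord (k + CARD('n)) w)"
    using sum.atLeastLessThan_concat[of 0 "CARD('n)" "2 * CARD('n)" "\<lambda>k. cot_coord k v * cot_coord k w"]
      sum.shift_bounds_nat_ivl[of "\<lambda>k. cot_coord k v * cot_coord k w" 0 "CARD('n)" "CARD('n)"]
    by (simp add: lessThan_atLeast0 mult_2)
  also have "\<dots> = fst v \<bullet> fst w + snd v \<bullet> snd w"
    unfolding inner_vec_def sum_index_list by (simp add: cot_coord_def)
  finally show ?thesis by (simp add: inner_prod_def)
qed

lemma cot_coord_linear:
  "cot_coord k (v - w) = cot_coord k v - cot_coord k w"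
  "cot_coord k (c *\<^sub>R v) = c * cot_coord k v"
  by (auto simp: cot_coord_def)

lemma inj_on_omit: "inj_on (\<lambda>k. (omit_x k :: 'n::{finite,linorder} set, omit_xi k :: 'n set)) {..<2 * CARD('n)}"
proof (rule inj_onI)
  fix k k' assume *: "k \<in> {..<2 * CARD('n)}" "k' \<in> {..<2 * CARD('n)}"
    "(omit_x k :: 'n set, omit_xi k :: 'n set) = (omit_x k', omit_xi k')"
  have neq: "UNIV - {x} \<noteq> UNIV" "UNIV \<noteq> UNIV - {x}" "UNIV - {x} = UNIV - {y} \<longleftrightarrow> x = y" for x y :: 'n by auto
  show "k = k'"
  proof (cases "k < CARD('n)"; cases "k' < CARD('n)")
    assume "\<not> k < CARD('n)" "\<not> k' < CARD('n)"
    then show ?thesis using * index_list_nth_eq_iff[where 'n = 'n, of "k - CARD('n)" "k' - CARD('n)"]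
      by (auto simp: omit_x_def omit_xi_def neq)
  qed (use * in \<open>auto simp: omit_x_def omit_xi_def neq index_list_nth_eq_iff\<close>)
qed

text \<open>Both cardinalities are at most \<open>n\<close>, so a total of \<open>2n - 1\<close>
  leaves exactly one coordinate missing. A form of degree \<open>2n - 1\<close> therefore has
  \<open>2n\<close> coefficients, indexed by the missing coordinate.\<close>

lemma omit_image:
  "(\<lambda>k. (omit_x k, omit_xi k)) ` {..<2 * CARD('n)}
    = {(I :: 'n::{finite,linorder} set, J :: 'n set). card I + card J = 2 * CARD('n) - 1}"
proof (intro equalityI subsetI)
  fix p :: "'n set \<times> 'n set"
  assume "p \<in> {(I, J). card I + card J = 2 * CARD('n) - 1}"
  then obtain I J where p: "p = (I, J)" and c: "card I + card J = 2 * CARD('n) - 1" by auto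
  have le: "card A \<le> CARD('n)" for A :: "'n set" by (simp add: card_mono)
  have full: "A = UNIV" if "card A = CARD('n)" for A :: "'n set"
    using that by (simp add: card_eq_UNIV_imp_eq_UNIV)
  have hole: "\<exists>k<CARD('n). A = UNIV - {index_list ! k}" if "card A = CARD('n) - 1" for A :: "'n set"
  proof -
    have "card (UNIV - A) = 1"
      using that by (subst card_Diff_subset) auto
    then obtain x where "UNIV - A = {x}" by (auto simp: card_1_singleton_iff)
    then have A: "A = UNIV - {x}" by auto
    have "x \<in> set (index_list :: 'n list)" by simp
    then obtain k where "k < length (index_list :: 'n list)" "index_list ! k = x"
      unfolding in_set_conv_nth by blast
    with A show ?thesis by auto
  qed
  have pos: "0 < CARD('n)" by simp
  consider "card I = CARD('n) - 1" "card J = CARD('n)" | "card I = CARD('n)" "card J = CARD('n) - 1"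
    using le[of I] le[of J] c pos by linarith
  then show "p \<in> (\<lambda>k. (omit_x k, omit_xi k)) ` {..<2 * CARD('n)}"
  proof cases
    case 1
    from hole[OF 1(1)] obtain k where "k < CARD('n)" "I = UNIV - {index_list ! k}" by auto
    with full[OF 1(2)] p show ?thesis by (intro image_eqI[of _ _ k]) (auto simp: omit_x_def omit_xi_def)
  next
    case 2
    from hole[OF 2(2)] obtain k where "k < CARD('n)" "J = UNIV - {index_list ! k}" by auto
    with full[OF 2(1)] p show ?thesis
      by (intro image_eqI[of _ _ "k + CARD('n)"]) (auto simp: omit_x_def omit_xi_def)
  qed
qed (auto simp: omit_x_def omit_xi_def card_Diff_singleton)

lemma sum_omit:
  "(\<Sum>(I :: 'n::{finite,linorder} set, J :: 'n set) | card I + card J = 2 * CARD('n) - 1. f I J)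
    = (\<Sum>k<2 * CARD('n). f (omit_x k) (omit_xi k))"
  unfolding omit_image[symmetric] by (subst sum.reindex[OF inj_on_omit]) simp

lemma dx_dxi_omit_std_frame:
  assumes i: "i < 2 * CARD('n)" and k: "k < 2 * CARD('n)"
  shows "dx_dxi (omit_x i) (omit_xi i :: 'n::{finite,linorder} set)
    (take k std_frame @ drop (Suc k) std_frame) = (if i = k then 1 else 0)"
proof -
  let ?\<theta> = "map (\<lambda>r. cot_coord (if r < i then r else Suc r) :: 'n cot \<Rightarrow> real) [0..<2 * CARD('n) - 1]"
  have "(std_frame :: 'n cot list) = map (\<lambda>r. std_frame ! r) [0..<2 * CARD('n)]"
    using map_nth[of "std_frame :: 'n cot list"] by (simp add: length_std_frame)
  then have fr: "take k (std_frame :: 'n cot list) @ drop (Suc k) std_frame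
     = map (\<lambda>r. std_frame ! (if r < k then r else Suc r)) [0..<2 * CARD('n) - 1]" (is "_ = ?fr")
    using take_drop_eq_map_upt[OF k, of "\<lambda>r. (std_frame :: 'n cot list) ! r"] by simp
  have entry: "(?\<theta> ! r) (?fr ! s) = (if (if r < i then r else Suc r) = (if s < k then s else Suc s) then 1 else 0)"
    if "r < length ?\<theta>" "s < length ?\<theta>" for r s
    using that by (subst nth_map, simp, subst nth_map, simp, subst cot_coord_std_frame) auto
  show ?thesis
  proof (cases "i = k")
    case True
    then have "wedge_covectors ?\<theta> ?fr = 1"
      by (intro wedge_covectors_dual, subst entry) auto
    with True show ?thesis unfolding fr dx_dxi_omit[OF i] take_drop_eq_map_upt[OF i] by simp
  next
    case False
    \<comment> \<open>The position of the \<open>k\<close>-th coordinate in the list that skips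
      \<open>i\<close>. The \<open>k\<close>-th frame vector is deleted, so this covector vanishes
      on all the others.\<close>
    define r where "r = (if k < i then k else k - 1)"
    have r: "r < length ?\<theta>" "(if r < i then r else Suc r) = k"
      using False i k by (auto simp: r_def)
    then have "wedge_covectors ?\<theta> ?fr = 0"
      by (intro wedge_covectors_eq_0[OF r(1)], subst entry) auto
    with False show ?thesis unfolding fr dx_dxi_omit[OF i] take_drop_eq_map_upt[OF i] by simp
  qed
qed

text \<open>The frame without its \<open>k\<close>-th vector is dual to the covectors of the form
  that omits the \<open>k\<close>-th coordinate, so only that coefficient survives; the sign is the
  one in the invariant formula.\<close>

lemma ext_deriv_std_frame:
  fixes \<beta> :: "'n::{finite,linorder} coeffs"
  shows "ext_deriv (form_of (2 * CARD('n) - 1) \<beta>) p std_frame =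
    (\<Sum>k<2 * CARD('n). (-1) ^ k * dir_deriv (std_frame ! k) (\<beta> (omit_x k) (omit_xi k)) p)"
proof -
  have "form_of (2 * CARD('n) - 1) \<beta> q (take k std_frame @ drop (Suc k) std_frame)
      = \<beta> (omit_x k) (omit_xi k) q" if k: "k < 2 * CARD('n)" for k q
  proof -
    have "form_of (2 * CARD('n) - 1) \<beta> q (take k std_frame @ drop (Suc k) std_frame)
      = (\<Sum>i<2 * CARD('n). if i = k then \<beta> (omit_x i) (omit_xi i) q else 0)"
      unfolding form_of_def sum_omit using k
      by (intro sum.cong) (auto simp: dx_dxi_omit_std_frame)
    then show ?thesis using k by simp
  qed
  then show ?thesis
    unfolding ext_deriv_def length_std_frame by (intro sum.cong) simp_all
qed

text \<open>\<open>2n\<close> vectors in the hyperplane orthogonal to \<open>\<nu>\<close> are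
  linearly dependent. Concretely, the coordinates of \<open>\<nu>\<close> are a nonzero kernel
  vector of the transposed matrix.\<close>

lemma dx_dxi_UNIV_eq_0:
  fixes \<nu> :: "'n::{finite,linorder} cot"
  assumes \<nu>: "\<nu> \<noteq> 0" and len: "length vs = 2 * CARD('n)" and orth: "\<And>v. v \<in> set vs \<Longrightarrow> v \<bullet> \<nu> = 0"
  shows "dx_dxi UNIV UNIV vs = 0"
proof -
  define N where "N = 2 * CARD('n)"
  define A where "A = mat N N (\<lambda>(r, s). (map cot_coord [0..<N] ! r) (vs ! s))"
  define x where "x = Matrix.vec N (\<lambda>r. cot_coord r \<nu>)"
  have A: "A \<in> carrier_mat N N" by (simp add: A_def)
  have "x \<noteq> 0\<^sub>v N"
  proof
    assume x: "x = 0\<^sub>v N"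
    have "cot_coord r \<nu> = 0" if "r < N" for r
      using arg_cong[OF x, of "\<lambda>y. vec_index y r"] that by (simp add: x_def)
    then have "\<nu> \<bullet> \<nu> = 0" unfolding inner_cot_coord N_def by simp
    with \<nu> show False by simp
  qed
  moreover have "transpose_mat A *\<^sub>v x = 0\<^sub>v N"
  proof (rule eq_vecI)
    fix s assume "s < dim_vec (0\<^sub>v N)"
    then have s: "s < N" by simp
    have "vec_index (transpose_mat A *\<^sub>v x) s = (\<Sum>r<N. cot_coord r (vs ! s) * cot_coord r \<nu>)"
      using s by (simp add: A_def x_def scalar_prod_def lessThan_atLeast0)
    also have "\<dots> = 0"
      using orth[of "vs ! s"] s len by (simp add: inner_cot_coord N_def)
    finally show "vec_index (transpose_mat A *\<^sub>v x) s = vec_index (0\<^sub>v N) s" using s by simp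
  qed (simp add: A_def)
  moreover have "x \<in> carrier_vec N" by (simp add: x_def)
  ultimately have "Determinant.det (transpose_mat A) = 0"
    using A by (subst det_0_iff_vec_prod_zero[of _ N]) auto
  then have "Determinant.det A = 0" by (simp add: det_transpose[OF A])
  then show ?thesis by (simp add: dx_dxi_UNIV wedge_covectors_eq_det[of _ N] N_def A_def)
qed

lemma dx_dxi_UNIV_Cons:
  assumes "length ts = 2 * CARD('n) - 1"
  shows "dx_dxi UNIV UNIV (v # ts) =
    (\<Sum>i<2 * CARD('n). (-1) ^ i * cot_coord i v * dx_dxi (omit_x i) (omit_xi i :: 'n::{finite,linorder} set) ts)"
proof -
  have pos: "0 < CARD('n)" by simp
  show ?thesis
    unfolding dx_dxi_UNIV using assms pos
    by (subst wedge_covectors_Cons) (auto intro!: sum.cong simp: dx_dxi_omit simp del: map_map)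
qed

text \<open>Let \<open>e\<close> be the \<open>k\<close>-th frame vector. Its tangential part
  \<open>e - cot_coord k \<nu> *\<^sub>R \<nu>\<close> together with \<open>ts\<close> lies in a
  hyperplane, so the volume form sees only the normal part of \<open>e\<close>. Expanding in the
  first slot at \<open>e\<close> itself gives \<open>(-1) ^ k\<close> times the form that omits
  \<open>k\<close>; comparing the two values yields the claim.\<close>

lemma dx_dxi_omit_tangential:
  fixes \<nu> :: "'n::{finite,linorder} cot"
  assumes \<nu>: "\<nu> \<bullet> \<nu> = 1" and len: "length ts = 2 * CARD('n) - 1"
    and orth: "\<And>t. t \<in> set ts \<Longrightarrow> t \<bullet> \<nu> = 0" and k: "k < 2 * CARD('n)"
  shows "dx_dxi (omit_x k) (omit_xi k) ts = (-1) ^ k * cot_coord k \<nu> * dx_dxi UNIV UNIV (\<nu> # ts)"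
proof -
  let ?e = "(std_frame :: 'n cot list) ! k"
  let ?D = "\<lambda>v. dx_dxi UNIV UNIV (v # ts)"
  have e\<nu>: "?e \<bullet> \<nu> = cot_coord k \<nu>"
  proof -
    have "?e \<bullet> \<nu> = (\<Sum>r<2 * CARD('n). if r = k then cot_coord r \<nu> else 0)"
      unfolding inner_cot_coord using k by (intro sum.cong) (auto simp: cot_coord_std_frame)
    then show ?thesis using k by simp
  qed
  have De: "?D ?e = (-1) ^ k * dx_dxi (omit_x k) (omit_xi k) ts"
  proof -
    have "?D ?e = (\<Sum>r<2 * CARD('n). if r = k then (-1) ^ r * dx_dxi (omit_x r) (omit_xi r) ts else 0)"
      unfolding dx_dxi_UNIV_Cons[OF len] using k by (intro sum.cong) (auto simp: cot_coord_std_frame)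
    then show ?thesis using k by simp
  qed
  have pos: "0 < CARD('n)" by simp
  have "?D (?e - cot_coord k \<nu> *\<^sub>R \<nu>) = 0"
  proof (rule dx_dxi_UNIV_eq_0[of \<nu>])
    show "\<nu> \<noteq> 0" using \<nu> by auto
    show "v \<bullet> \<nu> = 0" if "v \<in> set ((?e - cot_coord k \<nu> *\<^sub>R \<nu>) # ts)" for v
      proof -
      have "(?e - cot_coord k \<nu> *\<^sub>R \<nu>) \<bullet> \<nu> = 0"
        by (simp add: inner_diff_left e\<nu> \<nu>)
      with that orth show ?thesis by (metis set_ConsD)
    qed
  qed (use len pos in simp)
  moreover have "?D (?e - cot_coord k \<nu> *\<^sub>R \<nu>) = ?D ?e - cot_coord k \<nu> * ?D \<nu>"
    unfolding dx_dxi_UNIV_Cons[OF len]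
    by (simp add: cot_coord_linear sum_distrib_left sum_subtractf[symmetric] algebra_simps)
  ultimately have "(-1) ^ k * dx_dxi (omit_x k) (omit_xi k) ts = cot_coord k \<nu> * ?D \<nu>"
    using De by simp
  then have "(-1) ^ k * ((-1) ^ k * dx_dxi (omit_x k) (omit_xi k) ts) = (-1) ^ k * (cot_coord k \<nu> * ?D \<nu>)"
    by simp
  then show ?thesis by (simp flip: mult.assoc power_add)
qed

text \<open>Needed for uniqueness of the cosphere density: the defining equation determines
  \<open>g\<close> only through a tangential frame on which the volume form is nonzero.\<close>

lemma exists_tangential_frame:
  fixes \<nu> :: "'n::{finite,linorder} cot"
  assumes \<nu>: "\<nu> \<bullet> \<nu> = 1"
  obtains ts where "length ts = 2 * CARD('n) - 1" "\<And>t. t \<in> set ts \<Longrightarrow> t \<bullet> \<nu> = 0"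
    "dx_dxi UNIV UNIV (\<nu> # ts) \<noteq> 0"
proof -
  have "\<exists>i<2 * CARD('n). cot_coord i \<nu> \<noteq> 0"
  proof (rule ccontr)
    assume "\<not> ?thesis"
    then have "\<nu> \<bullet> \<nu> = 0" unfolding inner_cot_coord by (intro sum.neutral) auto
    with \<nu> show False by simp
  qed
  then obtain i where i: "i < 2 * CARD('n)" "cot_coord i \<nu> \<noteq> 0" by auto
  define skip where "skip r = (if r < i then r else Suc r)" for r
  let ?e = "\<lambda>r. (std_frame :: 'n cot list) ! r"
  \<comment> \<open>Every other frame vector is made orthogonal to \<open>\<nu>\<close> by a
    multiple of the \<open>i\<close>-th one, which is possible because
    \<open>cot_coord i \<nu>\<close> is nonzero. The form that omits \<open>i\<close> does not see
    these corrections, so its value on \<open>ts\<close> is 1.\<close>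
  define ts where "ts = map (\<lambda>r. ?e (skip r) - (cot_coord (skip r) \<nu> / cot_coord i \<nu>) *\<^sub>R ?e i) [0..<2 * CARD('n) - 1]"
  have skip: "skip r < 2 * CARD('n)" "skip r \<noteq> i" "skip r = skip s \<longleftrightarrow> r = s" if "r < 2 * CARD('n) - 1" for r s
    using that by (auto simp: skip_def)
  have e\<nu>: "?e k \<bullet> \<nu> = cot_coord k \<nu>" if k: "k < 2 * CARD('n)" for k
  proof -
    have "?e k \<bullet> \<nu> = (\<Sum>r<2 * CARD('n). if r = k then cot_coord r \<nu> else 0)"
      unfolding inner_cot_coord using k by (intro sum.cong) (auto simp: cot_coord_std_frame)
    then show ?thesis using k by simp
  qed
  have len: "length ts = 2 * CARD('n) - 1" by (simp add: ts_def)
  have orth: "t \<bullet> \<nu> = 0" if "t \<in> set ts" for t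
    using that i skip by (auto simp: ts_def inner_diff_left e\<nu>)
  have "wedge_covectors (map (\<lambda>r. cot_coord (skip r)) [0..<2 * CARD('n) - 1]) ts = 1"
    using i skip by (intro wedge_covectors_dual) (auto simp: ts_def cot_coord_linear cot_coord_std_frame)
  then have "dx_dxi (omit_x i) (omit_xi i) ts = 1"
    by (simp only: dx_dxi_omit[OF i(1)] take_drop_eq_map_upt[OF i(1)] skip_def)
  then have "dx_dxi UNIV UNIV (\<nu> # ts) \<noteq> 0"
    using dx_dxi_omit_tangential[OF \<nu> len orth i(1)] by auto
  with len orth show ?thesis by (rule that)
qed

lemma cosphere_density_omit:
  fixes p :: "'n::{finite,linorder} cot"
  assumes p: "norm (snd p) = 1" and k: "k < 2 * CARD('n)"
  shows "cosphere_density (\<lambda>p vs. h p * of_real (dx_dxi (omit_x k) (omit_xi k) vs)) p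
    = (-1) ^ k * of_real (cot_coord k (0, snd p)) * h p"
proof -
  let ?\<nu> = "(0, snd p) :: 'n cot"
  have \<nu>: "?\<nu> \<bullet> ?\<nu> = 1" using p by (simp add: dot_square_norm)
  show ?thesis unfolding cosphere_density_def
  proof (rule the_equality)
    show "\<forall>ts. length ts = 2 * CARD('n) - 1 \<and> (\<forall>t\<in>set ts. t \<bullet> ?\<nu> = 0) \<longrightarrow>
      h p * of_real (dx_dxi (omit_x k) (omit_xi k) ts)
       = (-1) ^ k * of_real (cot_coord k ?\<nu>) * h p * of_real (dx_dxi UNIV UNIV (?\<nu> # ts))"
      using dx_dxi_omit_tangential[OF \<nu> _ _ k] by simp
  next
    fix g assume g: "\<forall>ts. length ts = 2 * CARD('n) - 1 \<and> (\<forall>t\<in>set ts. t \<bullet> ?\<nu> = 0) \<longrightarrow>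
      h p * of_real (dx_dxi (omit_x k) (omit_xi k) ts) = g * of_real (dx_dxi UNIV UNIV (?\<nu> # ts))"
    obtain ts :: "'n cot list" where ts: "length ts = 2 * CARD('n) - 1" "\<And>t. t \<in> set ts \<Longrightarrow> t \<bullet> ?\<nu> = 0"
      "dx_dxi UNIV UNIV (?\<nu> # ts) \<noteq> 0"
      using exists_tangential_frame[OF \<nu>] by blast
    have "h p * of_real (dx_dxi (omit_x k) (omit_xi k) ts) = g * of_real (dx_dxi UNIV UNIV (?\<nu> # ts))"
      using g ts by blast
    then have "(h p * (-1) ^ k * of_real (cot_coord k ?\<nu>)) * of_real (dx_dxi UNIV UNIV (?\<nu> # ts))
        = g * of_real (dx_dxi UNIV UNIV (?\<nu> # ts))"
      using dx_dxi_omit_tangential[OF \<nu> ts(1,2) k] by (simp add: mult.assoc)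
    then show "g = (-1) ^ k * of_real (cot_coord k ?\<nu>) * h p"
      using ts(3) by (simp add: mult.commute mult.left_commute)
  qed
qed

section \<open>Finite parts\<close>

text \<open>The solutions of \<open>exp z = 1\<close> are the multiples of
  \<open>2 * pi * \<i>\<close>, and none of them lies on the unit circle.\<close>

lemma exp_neq_1_if_norm_1:
  assumes "norm z = 1"
  shows "exp z \<noteq> (1::complex)"
proof
  assume "exp z = 1"
  then obtain n :: int where n: "Re z = 0" "Im z = of_int (2 * n) * pi"
    by (auto simp: exp_eq_1)
  then have "\<bar>Im z\<bar> = 1"
    using assms by (simp add: cmod_eq_Im)
  then have *: "\<bar>of_int (2 * n)\<bar> * pi = 1"
    using n by (simp add: abs_mult)
  have "n \<noteq> 0" using * by auto
  then have "(1::real) \<le> \<bar>of_int (2 * n)\<bar>"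
    by linarith
  then have "1 * pi \<le> \<bar>of_int (2 * n)\<bar> * pi"
    by (intro mult_right_mono) auto
  then show False using * pi_gt3 by linarith
qed

text \<open>The shift operator \<open>F(t + h) - exp (w h) F(t)\<close> kills the exponential \<open>exp (w t)\<close>
  and multiplies the leading coefficient of the linear part by \<open>1 - exp (w h) \<noteq> 0\<close>.\<close>

lemma exponential_sum_tendsto_0:
  fixes w a :: "'q \<Rightarrow> complex" and b c :: complex
  assumes "finite Q" and "\<And>q. q \<in> Q \<Longrightarrow> w q \<noteq> 0"
    and "((\<lambda>t::real. (\<Sum>q\<in>Q. a q * exp (w q * of_real t)) + b * of_real t + c) \<longlongrightarrow> 0) at_top"
  shows "b = 0 \<and> c = 0"
  using assms
proof (induction Q arbitrary: a b c rule: finite_induct)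
  case empty
  then have lim: "((\<lambda>t::real. b * of_real t + c) \<longlongrightarrow> 0) at_top" by simp
  have "((\<lambda>t::real. b * of_real (t + 1) + c) \<longlongrightarrow> 0) at_top"
    using filterlim_compose[OF lim, of "\<lambda>t. t + 1" at_top]
      filterlim_tendsto_add_at_top[OF tendsto_const filterlim_ident, of "1::real"]
    by (simp add: add.commute)
  from tendsto_diff[OF this lim] have "((\<lambda>t::real. b) \<longlongrightarrow> 0) at_top"
    by (simp add: algebra_simps)
  then have "b = 0" by (simp add: tendsto_const_iff)
  with lim show ?case by (simp add: tendsto_const_iff)
next
  case (insert z Q)
  define F where "F t = (\<Sum>q\<in>insert z Q. a q * exp (w q * of_real t)) + b * of_real t + c" for t :: real
  \<comment> \<open>This shift length puts \<open>w z * h\<close> on the unit circle, so that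
    \<open>E \<noteq> 1\<close>.\<close>
  define h where "h = 1 / norm (w z)"
  define E where "E = exp (w z * of_real h)"
  have wz: "w z \<noteq> 0" using insert.prems by auto
  then have "norm (w z * of_real h) = 1"
    by (simp add: h_def norm_mult norm_divide)
  then have E: "E \<noteq> 1" unfolding E_def by (rule exp_neq_1_if_norm_1)
  have lim: "(F \<longlongrightarrow> 0) at_top"
    using insert.prems(2) unfolding F_def .
  have lim_h: "((\<lambda>t. F (t + h)) \<longlongrightarrow> 0) at_top"
    using filterlim_compose[OF lim, of "\<lambda>t. t + h" at_top]
      filterlim_tendsto_add_at_top[OF tendsto_const filterlim_ident, of "h"]
    by (simp add: add.commute)
  have eq: "F (t + h) - E * F t =
     (\<Sum>q\<in>Q. (a q * (exp (w q * of_real h) - E)) * exp (w q * of_real t))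
     + (b * (1 - E)) * of_real t + (c * (1 - E) + b * of_real h)" for t
  proof -
    have s: "(\<Sum>q\<in>Q. (a q * (exp (w q * of_real h) - E)) * exp (w q * of_real t)) =
        (\<Sum>q\<in>Q. a q * exp (w q * of_real (t + h))) - E * (\<Sum>q\<in>Q. a q * exp (w q * of_real t))"
      by (simp add: sum_distrib_left sum_subtractf[symmetric] algebra_simps exp_add)
    have z: "a z * exp (w z * of_real (t + h)) = E * (a z * exp (w z * of_real t))"
      by (simp add: E_def algebra_simps exp_add)
    have "F (t + h) = a z * exp (w z * of_real (t + h)) + (\<Sum>q\<in>Q. a q * exp (w q * of_real (t + h)))
        + b * of_real (t + h) + c"
      using insert.hyps by (simp add: F_def)
    moreover have "F t = a z * exp (w z * of_real t) + (\<Sum>q\<in>Q. a q * exp (w q * of_real t))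
        + b * of_real t + c"
      using insert.hyps by (simp add: F_def)
    ultimately show ?thesis unfolding s z by (simp add: algebra_simps)
  qed
  have "((\<lambda>t. F (t + h) - E * F t) \<longlongrightarrow> 0 - E * 0) at_top"
    by (intro tendsto_intros lim lim_h)
  then have "((\<lambda>t. (\<Sum>q\<in>Q. (a q * (exp (w q * of_real h) - E)) * exp (w q * of_real t))
     + (b * (1 - E)) * of_real t + (c * (1 - E) + b * of_real h)) \<longlongrightarrow> 0) at_top"
    unfolding eq by simp
  \<comment> \<open>The shift adds \<open>b * h\<close> to the constant, so \<open>c = 0\<close> can
    be extracted only together with \<open>b = 0\<close>; hence the claim about both.\<close>
  from insert.IH[OF _ this] insert.prems(1)
  have "b * (1 - E) = 0 \<and> c * (1 - E) + b * of_real h = 0" by auto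
  with E show ?case by auto
qed

text \<open>The substitution \<open>R = exp t\<close> turns powers into exponentials and the
  logarithm into the linear term.\<close>

lemma power_log_sum_tendsto_0:
  fixes w a :: "'q \<Rightarrow> complex" and b c :: complex
  assumes "finite Q" and "\<And>q. q \<in> Q \<Longrightarrow> w q \<noteq> 0"
    and lim: "((\<lambda>R::real. (\<Sum>q\<in>Q. a q * of_real R powr w q) + b * of_real (ln R) + c) \<longlongrightarrow> 0) at_top"
  shows "c = 0"
proof -
  have "((\<lambda>t::real. (\<Sum>q\<in>Q. a q * exp (w q * of_real t)) + b * of_real t + c) \<longlongrightarrow> 0) at_top"
  proof (rule Lim_transform_eventually[OF filterlim_compose[OF lim exp_at_top]])
    show "\<forall>\<^sub>F t in at_top. (\<Sum>q\<in>Q. a q * of_real (exp t) powr w q) + b * of_real (ln (exp t)) + c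
      = (\<Sum>q\<in>Q. a q * exp (w q * of_real t)) + b * of_real t + c"
      by (simp add: powr_def Ln_of_real exp_of_real[symmetric] del: exp_of_real)
  qed
  from exponential_sum_tendsto_0[OF assms(1,2) this] show ?thesis by simp
qed

text \<open>The predicate under \<open>THE\<close> in \<open>finite_part\<close>. As a relation it
  can be shown to be linear first, and uniqueness then follows from linearity.\<close>

definition has_finite_part :: "(real \<Rightarrow> complex) \<Rightarrow> complex \<Rightarrow> bool" where
  "has_finite_part F c \<longleftrightarrow> (\<exists>Z a b. finite Z \<and> 0 \<notin> Z \<and>
     ((\<lambda>R. F R - ((\<Sum>z\<in>Z. a z * complex_of_real R powr z) + b * complex_of_real (ln R) + c))
        \<longlongrightarrow> 0) at_top)"

text \<open>Allows repeated and vanishing exponents, as they occur when several expansions are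
  combined. Equal exponents are collected; for \<open>R > 0\<close> the terms with exponent 0 are
  constants and join \<open>c\<close>.\<close>

lemma has_finite_part_family:
  fixes w a :: "'q \<Rightarrow> complex"
  assumes "finite Q"
    and lim: "((\<lambda>R. F R - ((\<Sum>q\<in>Q. a q * complex_of_real R powr w q) + b * complex_of_real (ln R) + c))
        \<longlongrightarrow> 0) at_top"
  shows "has_finite_part F (c + (\<Sum>q | q \<in> Q \<and> w q = 0. a q))"
proof -
  define Z where "Z = w ` Q - {0}"
  define A where "A z = (\<Sum>q | q \<in> Q \<and> w q = z. a q)" for z
  have "(\<Sum>q\<in>Q. a q * complex_of_real R powr w q) + b * complex_of_real (ln R) + c
     = (\<Sum>z\<in>Z. A z * complex_of_real R powr z) + b * complex_of_real (ln R) + (c + A 0)"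
    if "R > 0" for R
  proof -
    have "(\<Sum>q\<in>Q. a q * complex_of_real R powr w q)
        = (\<Sum>z\<in>w ` Q. \<Sum>q | q \<in> Q \<and> w q = z. a q * complex_of_real R powr w q)"
      using \<open>finite Q\<close> by (rule sum.image_gen)
    also have "\<dots> = (\<Sum>z\<in>w ` Q. A z * complex_of_real R powr z)"
      by (auto simp: A_def sum_distrib_right intro!: sum.cong)
    also have "\<dots> = (\<Sum>z\<in>insert 0 Z. A z * complex_of_real R powr z)"
    proof (rule sum.mono_neutral_left)
      have "A 0 = 0" if "0 \<notin> w ` Q"
      proof -
        have "{q. q \<in> Q \<and> w q = 0} = {}" using that by force
        then show ?thesis unfolding A_def by (simp only: sum.empty)
      qed
      then show "\<forall>i\<in>insert 0 Z - w ` Q. A i * complex_of_real R powr i = 0"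
        by (auto simp: Z_def)
    qed (use \<open>finite Q\<close> in \<open>auto simp: Z_def\<close>)
    also have "\<dots> = (\<Sum>z\<in>Z. A z * complex_of_real R powr z) + A 0"
      using \<open>finite Q\<close> that by (subst sum.insert) (auto simp: Z_def)
    finally show ?thesis by simp
  qed
  then have "\<forall>\<^sub>F R in at_top. F R - ((\<Sum>q\<in>Q. a q * complex_of_real R powr w q) + b * complex_of_real (ln R) + c)
    = F R - ((\<Sum>z\<in>Z. A z * complex_of_real R powr z) + b * complex_of_real (ln R) + (c + A 0))"
    by (intro eventually_mono[OF eventually_gt_at_top[of 0]]) presburger
  from Lim_transform_eventually[OF lim this] show ?thesis
    using \<open>finite Q\<close> unfolding has_finite_part_def A_def
    by (intro exI[of _ Z]) (auto simp: Z_def)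
qed

lemma has_finite_part_add:
  assumes "has_finite_part F c" "has_finite_part G d"
  shows "has_finite_part (\<lambda>R. F R + G R) (c + d)"
proof -
  from assms(1) obtain Z a b where
    1: "finite Z" "0 \<notin> Z" "((\<lambda>R. F R - ((\<Sum>z\<in>Z. a z * complex_of_real R powr z)
      + b * complex_of_real (ln R) + c)) \<longlongrightarrow> 0) at_top"
    unfolding has_finite_part_def by blast
  from assms(2) obtain Z' a' b' where
    2: "finite Z'" "0 \<notin> Z'" "((\<lambda>R. G R - ((\<Sum>z\<in>Z'. a' z * complex_of_real R powr z)
      + b' * complex_of_real (ln R) + d)) \<longlongrightarrow> 0) at_top"
    unfolding has_finite_part_def by blast
  \<comment> \<open>The two exponent sets may overlap, so their disjoint union indexes the terms and
    \<open>has_finite_part_family\<close> merges them.\<close>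
  define A where "A = case_sum a a'"
  define w where "w = case_sum id (id :: complex \<Rightarrow> complex)"
  have s: "(\<Sum>q\<in>Z <+> Z'. A q * complex_of_real R powr w q) =
     (\<Sum>z\<in>Z. a z * complex_of_real R powr z) + (\<Sum>z\<in>Z'. a' z * complex_of_real R powr z)" for R
    using 1(1) 2(1) by (simp add: sum.Plus A_def w_def)
  have lim: "((\<lambda>R. (F R + G R) - ((\<Sum>q\<in>Z <+> Z'. A q * complex_of_real R powr w q)
      + (b + b') * complex_of_real (ln R) + (c + d))) \<longlongrightarrow> 0) at_top"
    using tendsto_add[OF 1(3) 2(3)] unfolding s by (simp add: algebra_simps)
  have "{q. q \<in> Z <+> Z' \<and> w q = 0} = {}"
    using 1(2) 2(2) by (auto simp: w_def)
  then have "(\<Sum>q | q \<in> Z <+> Z' \<and> w q = 0. A q) = 0"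
    by (simp only: sum.empty)
  then show ?thesis
    using has_finite_part_family[OF _ lim] 1(1) 2(1) by simp
qed

lemma has_finite_part_cmult:
  assumes "has_finite_part F c"
  shows "has_finite_part (\<lambda>R. k * F R) (k * c)"
proof -
  from assms obtain Z a b where
    1: "finite Z" "0 \<notin> Z" "((\<lambda>R. F R - ((\<Sum>z\<in>Z. a z * complex_of_real R powr z)
      + b * complex_of_real (ln R) + c)) \<longlongrightarrow> 0) at_top"
    unfolding has_finite_part_def by blast
  have "((\<lambda>R. k * (F R - ((\<Sum>z\<in>Z. a z * complex_of_real R powr z)
      + b * complex_of_real (ln R) + c))) \<longlongrightarrow> k * 0) at_top"
    by (intro tendsto_intros 1)
  then have "((\<lambda>R. k * F R - ((\<Sum>z\<in>Z. (k * a z) * complex_of_real R powr z)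
      + (k * b) * complex_of_real (ln R) + k * c)) \<longlongrightarrow> 0) at_top"
    by (simp add: algebra_simps sum_distrib_left)
  then show ?thesis unfolding has_finite_part_def
    using 1 by (intro exI[of _ Z] exI[of _ "\<lambda>z. k * a z"]) auto
qed

lemma has_finite_part_0: "has_finite_part (\<lambda>R. 0) 0"
  unfolding has_finite_part_def by (intro exI[of _ "{}"] exI[of _ "\<lambda>_. 0"] exI[of _ "0::complex"]) simp

lemma has_finite_part_sum:
  assumes "\<And>i. i \<in> S \<Longrightarrow> has_finite_part (F i) (c i)"
  shows "has_finite_part (\<lambda>R. \<Sum>i\<in>S. F i R) (\<Sum>i\<in>S. c i)"
  using assms
  by (induction S rule: infinite_finite_induct)
     (simp_all add: has_finite_part_0 has_finite_part_add)

text \<open>By linearity the zero function \<open>F - F\<close> has the expansion with constant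
  \<open>c - d\<close>, to which \<open>power_log_sum_tendsto_0\<close> applies.\<close>

lemma has_finite_part_unique:
  assumes "has_finite_part F c" "has_finite_part F d"
  shows "c = d"
proof -
  have "has_finite_part (\<lambda>R. F R + (-1) * F R) (c + (-1) * d)"
    by (intro has_finite_part_add has_finite_part_cmult assms)
  then obtain Z a b where Z: "finite Z" "0 \<notin> Z"
    and lim: "((\<lambda>R. F R + (-1) * F R - ((\<Sum>z\<in>Z. a z * complex_of_real R powr z)
      + b * complex_of_real (ln R) + (c + (-1) * d))) \<longlongrightarrow> 0) at_top"
    unfolding has_finite_part_def by blast
  have "((\<lambda>R. (\<Sum>z\<in>Z. a z * complex_of_real R powr id z)
      + b * complex_of_real (ln R) + (c - d)) \<longlongrightarrow> 0) at_top"
    using tendsto_minus[OF lim] by (simp add: add.commute add.left_commute)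
  from power_log_sum_tendsto_0[OF Z(1) _ this] Z(2) show ?thesis by auto
qed

lemma finite_part_eq:
  assumes "has_finite_part F c"
  shows "finite_part F = c"
  unfolding finite_part_def has_finite_part_def[symmetric]
  by (rule the_equality[where P = "has_finite_part F", OF assms]) (rule has_finite_part_unique[OF _ assms])

section \<open>The divergence theorem for balls\<close>

declare borel_closed[OF closed_cball, measurable] borel_closed[OF closed_sphere, measurable]
  borel_open[OF open_ball, measurable]

lemma continuous_on_compact_bound_norm:
  fixes f :: "'a::topological_space \<Rightarrow> 'b::real_normed_vector"
  assumes "compact S" "continuous_on S f"
  obtains M where "0 \<le> M" "\<And>x. x \<in> S \<Longrightarrow> norm (f x) \<le> M"
proof -
  have "bounded (f ` S)" by (rule compact_imp_bounded[OF compact_continuous_image[OF assms(2,1)]])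
  then obtain M where "\<forall>z\<in>f ` S. norm z \<le> M" unfolding bounded_iff by blast
  then show ?thesis by (intro that[of "max M 0"]) (auto simp: le_max_iff_disj)
qed

lemma has_vector_derivative_along_line:
  fixes w w' :: "'a::real_vector \<Rightarrow> 'b::real_normed_vector"
  assumes "\<And>y. ((\<lambda>t. w (y + t *\<^sub>R e)) has_vector_derivative w' y) (at 0)"
  shows "((\<lambda>t. w (y + t *\<^sub>R e)) has_vector_derivative w' (y + t *\<^sub>R e)) (at t)"
proof -
  have "((\<lambda>s. s - t) has_vector_derivative 1) (at t)"
    by (auto intro!: derivative_eq_intros)
  moreover have "((\<lambda>s. w (y + t *\<^sub>R e + s *\<^sub>R e)) has_vector_derivative w' (y + t *\<^sub>R e)) (at (t - t))"
    using assms[of "y + t *\<^sub>R e"] by simp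
  ultimately have "((\<lambda>s. w (y + t *\<^sub>R e + s *\<^sub>R e)) \<circ> (\<lambda>s. s - t) has_vector_derivative 1 *\<^sub>R w' (y + t *\<^sub>R e)) (at t)"
    by (rule vector_diff_chain_at)
  moreover have "y + t *\<^sub>R e + (s - t) *\<^sub>R e = y + s *\<^sub>R e" for s
    by (simp add: scaleR_left_diff_distrib)
  then have "(\<lambda>s. w (y + t *\<^sub>R e + s *\<^sub>R e)) \<circ> (\<lambda>s. s - t) = (\<lambda>s. w (y + s *\<^sub>R e))"
    unfolding o_def by presburger
  ultimately show ?thesis by simp
qed

lemma norm_diff_le_derivative_bound:
  fixes f :: "real \<Rightarrow> 'b::real_normed_vector"
  assumes "\<And>t. t \<in> {a..b} \<Longrightarrow> (f has_vector_derivative f' t) (at t)"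
    and "\<And>t. t \<in> {a..b} \<Longrightarrow> norm (f' t) \<le> M" and "a \<le> b"
  shows "norm (f b - f a) \<le> M * (b - a)"
proof -
  have "norm (f b - f a) \<le> M * norm (b - a)"
  proof (rule differentiable_bound[of "{a..b}" f "\<lambda>t h. h *\<^sub>R f' t"])
    show "(f has_derivative (\<lambda>h. h *\<^sub>R f' t)) (at t within {a..b})" if "t \<in> {a..b}" for t
      using assms(1)[OF that] unfolding has_vector_derivative_def
      by (rule has_derivative_at_withinI)
    show "onorm (\<lambda>h. h *\<^sub>R f' t) \<le> M" if "t \<in> {a..b}" for t
      using assms(2)[OF that] by (intro onorm_le) (auto simp: mult.commute[of M] intro!: mult_left_mono)
  qed (use \<open>a \<le> b\<close> in auto)
  with \<open>a \<le> b\<close> show ?thesis by simp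
qed

text \<open>By translation invariance every difference quotient \<open>q k\<close> has integral 0,
  and dominated convergence passes this to the derivative.\<close>

lemma integral_directional_derivative_eq_0:
  fixes w w' :: "'a::euclidean_space \<Rightarrow> complex"
  assumes deriv: "\<And>y. ((\<lambda>t. w (y + t *\<^sub>R e)) has_vector_derivative w' y) (at 0)"
    and cont: "continuous_on UNIV w" "continuous_on UNIV w'"
    and supp: "\<And>y. norm y > B \<Longrightarrow> w y = 0"
  shows "integral\<^sup>L lborel w' = 0"
proof -
  \<comment> \<open>Steps \<open>h k \<le> 1\<close> move a point by at most \<open>norm e\<close>:
    the quotients vanish outside radius \<open>C\<close>, and inside it the mean value estimate
    needs the derivative up to radius \<open>C + norm e\<close>.\<close>
  define C where "C = B + norm e"
  define h where "h k = inverse (real (Suc k))" for k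
  have h: "0 < h k" "h k \<le> 1" for k by (auto simp: h_def field_simps)
  have [measurable]: "w \<in> borel_measurable borel" "w' \<in> borel_measurable borel"
    using cont by (auto intro: borel_measurable_continuous_onI)
  obtain M where M0: "\<And>z. z \<in> cball 0 (C + norm e) \<Longrightarrow> norm (w' z) \<le> M"
    using continuous_on_compact_bound_norm[OF compact_cball continuous_on_subset[OF cont(2) subset_UNIV]] by blast
  have M: "norm (w' z) \<le> M" if "norm z \<le> C + norm e" for z
    using M0 that by simp
  define q where "q k y = (w (y + h k *\<^sub>R e) - w y) /\<^sub>R h k" for k y
  have bound: "norm (q k y) \<le> indicator (cball 0 C) y * M" for k y
  proof (cases "norm y \<le> C")
    case True
    have "norm (w (y + h k *\<^sub>R e) - w (y + 0 *\<^sub>R e)) \<le> M * (h k - 0)"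
    proof (rule norm_diff_le_derivative_bound)
      show "((\<lambda>t. w (y + t *\<^sub>R e)) has_vector_derivative w' (y + t *\<^sub>R e)) (at t)" for t
        by (rule has_vector_derivative_along_line[OF deriv])
      show "norm (w' (y + t *\<^sub>R e)) \<le> M" if "t \<in> {0..h k}" for t
      proof (rule M)
        have "norm (t *\<^sub>R e) \<le> norm e" using that h(2)[of k] by (auto intro: mult_left_le_one_le)
        then show "norm (y + t *\<^sub>R e) \<le> C + norm e"
          using True norm_triangle_ineq[of y "t *\<^sub>R e"] by linarith
      qed
    qed (use h(1)[of k] in simp)
    moreover have "norm (q k y) = norm (w (y + h k *\<^sub>R e) - w y) / h k"
      using h(1)[of k] by (simp add: q_def divide_inverse mult.commute)
    ultimately have "norm (q k y) \<le> M" using h(1)[of k] by (simp add: pos_divide_le_eq)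
    with True show ?thesis by simp
  next
    case False
    have "norm (h k *\<^sub>R e) \<le> norm e" using h[of k] by (auto intro: mult_left_le_one_le)
    moreover have "norm y \<le> norm (y + h k *\<^sub>R e) + norm (h k *\<^sub>R e)"
      using norm_triangle_ineq4[of "y + h k *\<^sub>R e" "h k *\<^sub>R e"] by simp
    ultimately have "norm (y + h k *\<^sub>R e) > B" using False by (simp add: C_def)
    moreover have "norm y > B" using False norm_ge_zero[of e] unfolding C_def by linarith
    ultimately show ?thesis by (simp add: q_def supp indicator_def False)
  qed
  have "(\<lambda>k. integral\<^sup>L lborel (q k)) \<longlonglongrightarrow> integral\<^sup>L lborel w'"
  proof (rule integral_dominated_convergence)
    show "integrable lborel (\<lambda>y. indicator (cball 0 C) y * M)"
      using borel_integrable_compact[of "cball 0 C" "\<lambda>_. M"] by simp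
    show "AE y in lborel. (\<lambda>k. q k y) \<longlonglongrightarrow> w' y"
    proof (rule AE_I2)
      fix y
      have "(\<lambda>s. norm (w (y + (0 + s) *\<^sub>R e) - w (y + 0 *\<^sub>R e) - s *\<^sub>R w' y) / norm s) \<midarrow>0\<rightarrow> 0"
        using deriv[of y] unfolding has_vector_derivative_def has_derivative_at by blast
      moreover have "filterlim h (at 0) sequentially"
        unfolding filterlim_at h_def using LIMSEQ_inverse_real_of_nat by auto
      ultimately have "(\<lambda>k. norm (w (y + (0 + h k) *\<^sub>R e) - w (y + 0 *\<^sub>R e) - h k *\<^sub>R w' y) / norm (h k)) \<longlonglongrightarrow> 0"
        by (rule filterlim_compose)
      moreover have "norm (w (y + (0 + h k) *\<^sub>R e) - w (y + 0 *\<^sub>R e) - h k *\<^sub>R w' y) / norm (h k) = norm (q k y - w' y)" for k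
      proof -
        have "q k y - w' y = (w (y + h k *\<^sub>R e) - w y - h k *\<^sub>R w' y) /\<^sub>R h k"
          using h(1)[of k] by (simp add: q_def scaleR_diff_right)
        then show ?thesis using h(1)[of k] by (simp add: divide_inverse mult.commute)
      qed
      ultimately show "(\<lambda>k. q k y) \<longlonglongrightarrow> w' y"
        by (simp add: tendsto_norm_zero_iff Lim_null[symmetric])
    qed
    show "AE y in lborel. norm (q k y) \<le> indicator (cball 0 C) y * M" for k
      using bound by simp
    show "q k \<in> borel_measurable lborel" for k unfolding q_def by measurable
  qed measurable
  moreover have "integral\<^sup>L lborel (q k) = 0" for k
  proof -
    have int: "integrable lborel w"
    proof -
      have "indicator (cball 0 B) y *\<^sub>R w y = w y" for y
        using supp[of y] by (auto simp: indicator_def)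
      with borel_integrable_compact[of "cball 0 B" w] show ?thesis
        using continuous_on_subset[OF cont(1)] by simp
    qed
    have "(\<lambda>y. y + h k *\<^sub>R e) = (+) (h k *\<^sub>R e)"
      by (simp add: fun_eq_iff add.commute)
    then have "distr lborel borel (\<lambda>y. y + h k *\<^sub>R e) = lborel"
      by (simp only: lborel_distr_plus)
    then have "integral\<^sup>L lborel (\<lambda>y. w (y + h k *\<^sub>R e)) = integral\<^sup>L lborel w"
      "integrable lborel (\<lambda>y. w (y + h k *\<^sub>R e))"
      using integral_distr[of "\<lambda>y. y + h k *\<^sub>R e" lborel borel w]
        integrable_distr_eq[of "\<lambda>y. y + h k *\<^sub>R e" lborel borel w] int by simp_all
    then show ?thesis unfolding q_def using int by simp
  qed
  ultimately show ?thesis by (simp add: LIMSEQ_const_iff)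
qed

section \<open>Scaling, null sets and the surface measure\<close>

lemma integral_scaleR_substitution:
  fixes f :: "'a::euclidean_space \<Rightarrow> 'b::{banach, second_countable_topology}"
  assumes "0 < c" and [measurable]: "f \<in> borel_measurable borel"
  shows "integral\<^sup>L lborel f = c ^ DIM('a) *\<^sub>R integral\<^sup>L lborel (\<lambda>x. f (c *\<^sub>R x))"
proof -
  have "integral\<^sup>L lborel f = integral\<^sup>L (density (distr lborel borel (\<lambda>x. 0 + c *\<^sub>R x)) (\<lambda>_. ennreal (\<bar>c\<bar> ^ DIM('a)))) f"
    using lborel_affine[of c "0::'a"] \<open>0 < c\<close> by simp
  also have "\<dots> = c ^ DIM('a) *\<^sub>R integral\<^sup>L lborel (\<lambda>x. f (c *\<^sub>R x))"
    using \<open>0 < c\<close> by (subst integral_density) (auto simp: integral_distr)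
  finally show ?thesis .
qed

lemma null_sets_sphere: "sphere 0 r \<in> null_sets (lborel :: 'a::euclidean_space measure)"
  using negligible_sphere[of "0::'a" r]
  by (simp add: null_sets_completion_iff negligible_iff_null_sets)

lemma sets_sphere_measure [measurable_cong]: "sets sphere_measure = sets borel"
  by (simp add: sphere_measure_def)

lemma space_sphere_measure: "space sphere_measure = UNIV"
  by (simp add: sphere_measure_def space_scale_measure)

text \<open>The punctured open ball of the definition and the closed unit ball differ by the unit
  sphere and the origin, which are Lebesgue null sets.\<close>

lemma integral_sphere_measure:
  fixes f :: "real ^ 'n::finite \<Rightarrow> complex"
  assumes [measurable]: "f \<in> borel_measurable borel"
  shows "integral\<^sup>L sphere_measure f = CARD('n) *\<^sub>R (LINT \<xi>:cball 0 1|lborel. f (sgn \<xi>))"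
proof -
  let ?M = "distr (restrict_space lborel (ball 0 1 - {0})) borel (\<lambda>\<xi>::real^'n. \<xi> /\<^sub>R norm \<xi>)"
  have m: "(\<lambda>\<xi>::real^'n. \<xi> /\<^sub>R norm \<xi>) \<in> restrict_space lborel (ball 0 1 - {0}) \<rightarrow>\<^sub>M borel"
    by (rule measurable_restrict_space1) measurable
  have "sphere_measure = density ?M (\<lambda>_. ennreal (real CARD('n)))"
    unfolding sphere_measure_def
    by (rule measure_eqI) (auto simp: emeasure_density_const ennreal_of_nat_eq_real_of_nat)
  then have "integral\<^sup>L sphere_measure f = integral\<^sup>L (density ?M (\<lambda>_. ennreal (real CARD('n)))) f"
    by (rule arg_cong)
  also have "\<dots> = integral\<^sup>L ?M (\<lambda>\<xi>. real CARD('n) *\<^sub>R f \<xi>)"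
    by (rule integral_density) auto
  also have "\<dots> = CARD('n) *\<^sub>R integral\<^sup>L ?M f" by simp
  also have "integral\<^sup>L ?M f = integral\<^sup>L (restrict_space lborel (ball 0 1 - {0})) (\<lambda>\<xi>. f (sgn \<xi>))"
    using m by (subst integral_distr) (auto simp: sgn_div_norm)
  also have "\<dots> = (LINT \<xi>:ball 0 1 - {0}|lborel. f (sgn \<xi>))"
    by (subst integral_restrict_space) (auto simp: set_lebesgue_integral_def)
  also have "\<dots> = (LINT \<xi>:cball 0 1|lborel. f (sgn \<xi>))"
    unfolding set_lebesgue_integral_def
  proof (rule integral_cong_AE)
    have "AE \<xi> in lborel. \<xi> \<notin> sphere (0::real^'n) 1" "AE \<xi> in lborel. \<xi> \<noteq> (0::real^'n)"
      using AE_not_in[OF null_sets_sphere] AE_lborel_singleton by auto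
    then show "AE \<xi> in lborel. indicator (ball 0 1 - {0}) \<xi> *\<^sub>R f (sgn \<xi>) = indicator (cball 0 1) \<xi> *\<^sub>R f (sgn \<xi>)"
      by eventually_elim (auto simp: indicator_def)
  qed (unfold sgn_div_norm, measurable)
  finally show ?thesis .
qed

lemma set_integrable_continuous_compact:
  fixes f :: "'a::euclidean_space \<Rightarrow> 'b::{banach, second_countable_topology}"
  shows "compact S \<Longrightarrow> continuous_on S f \<Longrightarrow> set_integrable lborel S f"
  unfolding set_integrable_def by (rule borel_integrable_compact)

lemma measure_cball_0:
  assumes "0 \<le> r"
  shows "measure lborel (cball (0::'a::euclidean_space) r) = r ^ DIM('a) * measure lborel (cball (0::'a) 1)"
  using assms by (simp add: content_cball)

lemma power_diff_le:
  fixes a b c :: real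
  assumes "0 \<le> a" "a \<le> b" "b \<le> c"
  shows "b ^ n - a ^ n \<le> real n * c ^ (n - 1) * (b - a)"
proof (cases "a = b")
  case False
  with assms have "a < b" by simp
  obtain z where z: "a < z" "z < b" "b ^ n - a ^ n = (b - a) * (real n * z ^ (n - 1))"
    using MVT2[OF \<open>a < b\<close>, of "\<lambda>x. x ^ n" "\<lambda>x. real n * x ^ (n - 1)"]
    by (auto intro!: derivative_eq_intros)
  have "z ^ (n - 1) \<le> c ^ (n - 1)"
    using z assms by (intro power_mono) auto
  then have "(b - a) * (real n * z ^ (n - 1)) \<le> (b - a) * (real n * c ^ (n - 1))"
    using assms by (intro mult_left_mono) auto
  with z show ?thesis by (simp add: mult_ac)
qed simp

text \<open>\<open>g\<close> is compared with \<open>k\<close>, the extension of its values on the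
  sphere of radius \<open>R\<close> that is constant along rays. For \<open>k\<close> the ball
  integral scales exactly like \<open>r ^ n\<close>, which gives the stated derivative. Near radius
  \<open>R\<close> the two functions are uniformly close and the shell between the radii has volume
  of order \<open>\<bar>r - R\<bar>\<close>, so the difference of the ball integrals has derivative
  0.\<close>

lemma ball_integral_has_vector_derivative:
  fixes g :: "real ^ 'n::finite \<Rightarrow> complex"
  assumes cont: "continuous_on UNIV g" and R: "0 < R"
  shows "((\<lambda>r. LINT \<xi>:cball 0 r|lborel. g \<xi>) has_vector_derivative
    R ^ (CARD('n) - 1) *\<^sub>R (LINT \<omega>:sphere 0 1|sphere_measure. g (R *\<^sub>R \<omega>))) (at R)"
proof -
  let ?n = "CARD('n)"
  define k where "k \<xi> = g (R *\<^sub>R sgn \<xi>)" for \<xi> :: "real^'n"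
  define G where "G r = (LINT \<xi>:cball 0 r|lborel. g \<xi>)" for r
  define V where "V r = (LINT \<xi>:cball 0 r|lborel. k \<xi>)" for r
  define v where "v = measure lborel (cball (0::real^'n) 1)"
  have v: "0 \<le> v" by (simp add: v_def)
  have [measurable]: "g \<in> borel_measurable borel"
    using cont by (rule borel_measurable_continuous_onI)
  have [measurable]: "k \<in> borel_measurable borel" unfolding k_def sgn_div_norm by measurable
  have ig: "set_integrable lborel (cball 0 r) g" for r
    by (intro set_integrable_continuous_compact continuous_on_subset[OF cont]) auto
  obtain M where M: "norm (g \<xi>) \<le> M" if "norm \<xi> \<le> R" for \<xi>
    using continuous_on_compact_bound_norm[OF compact_cball continuous_on_subset[OF cont subset_UNIV], of 0 R]
    by auto
  have kM: "norm (k \<xi>) \<le> M" for \<xi>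
    unfolding k_def using R by (intro M) (auto simp: norm_sgn)
  have ik: "set_integrable lborel (cball 0 r) k" for r
    unfolding set_integrable_def
  proof (rule Bochner_Integration.integrable_bound)
    show "integrable lborel (\<lambda>\<xi>. indicator (cball (0::real^'n) r) \<xi> *\<^sub>R M)"
      using borel_integrable_compact[of "cball 0 r" "\<lambda>_. M"] by simp
    show "AE \<xi> in lborel. norm (indicator (cball 0 r) \<xi> *\<^sub>R k \<xi>) \<le> norm (indicator (cball (0::real^'n) r) \<xi> *\<^sub>R M)"
      using kM by (auto simp: indicator_def intro!: AE_I2 order_trans[OF kM])
  qed simp
  have V: "V r = r ^ ?n *\<^sub>R V 1" if r: "0 < r" for r
  proof -
    have "V r = r ^ DIM(real^'n) *\<^sub>R integral\<^sup>L lborel (\<lambda>\<xi>. indicator (cball 0 r) (r *\<^sub>R \<xi>) *\<^sub>R k (r *\<^sub>R \<xi>))"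
      unfolding V_def set_lebesgue_integral_def using r by (rule integral_scaleR_substitution) measurable
    also have "(\<lambda>\<xi>. indicator (cball 0 r) (r *\<^sub>R \<xi>) *\<^sub>R k (r *\<^sub>R \<xi>)) = (\<lambda>\<xi>. indicator (cball 0 1) \<xi> *\<^sub>R k \<xi>)"
      using r by (auto simp: indicator_def fun_eq_iff k_def sgn_scaleR mult_le_cancel_left1)
    finally show ?thesis by (simp add: V_def set_lebesgue_integral_def)
  qed
  have sphere: "real ?n *\<^sub>R V 1 = (LINT \<omega>:sphere 0 1|sphere_measure. g (R *\<^sub>R \<omega>))"
  proof -
    have "integral\<^sup>L sphere_measure (\<lambda>\<omega>. indicator (sphere 0 1) \<omega> *\<^sub>R g (R *\<^sub>R \<omega>))
      = ?n *\<^sub>R (LINT \<xi>:cball 0 1|lborel. indicator (sphere 0 1) (sgn \<xi>) *\<^sub>R g (R *\<^sub>R sgn \<xi>))"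
      by (rule integral_sphere_measure) measurable
    also have "(LINT \<xi>:cball 0 1|lborel. indicator (sphere 0 1) (sgn \<xi>) *\<^sub>R g (R *\<^sub>R sgn \<xi>)) = V 1"
      unfolding V_def set_lebesgue_integral_def
    proof (rule integral_cong_AE)
      have "AE \<xi> in lborel. \<xi> \<noteq> (0::real^'n)" by (rule AE_lborel_singleton)
      then show "AE \<xi> in lborel. indicator (cball 0 1) \<xi> *\<^sub>R indicator (sphere 0 1) (sgn \<xi>) *\<^sub>R g (R *\<^sub>R sgn \<xi>)
          = indicator (cball 0 1) \<xi> *\<^sub>R k \<xi>"
        by eventually_elim (simp add: k_def norm_sgn indicator_def)
    qed (unfold sgn_div_norm, measurable)
    finally show ?thesis by (simp add: set_lebesgue_integral_def)
  qed
  have dV: "(V has_vector_derivative R ^ (?n - 1) *\<^sub>R (LINT \<omega>:sphere 0 1|sphere_measure. g (R *\<^sub>R \<omega>))) (at R)"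
  proof (rule has_vector_derivative_transform_within_open[where S = "{0<..}"])
    have "((\<lambda>r. r ^ ?n *\<^sub>R V 1) has_vector_derivative (R ^ ?n *\<^sub>R 0 + (real ?n * R ^ (?n - 1)) *\<^sub>R V 1)) (at R)"
      by (intro has_vector_derivative_scaleR derivative_eq_intros) auto
    then show "((\<lambda>r. r ^ ?n *\<^sub>R V 1) has_vector_derivative R ^ (?n - 1) *\<^sub>R (LINT \<omega>:sphere 0 1|sphere_measure. g (R *\<^sub>R \<omega>))) (at R)"
      unfolding sphere[symmetric] by (simp add: mult.commute)
    show "r ^ ?n *\<^sub>R V 1 = V r" if "r \<in> {0<..}" for r
      using that by (intro V[symmetric]) simp
  qed (use R in auto)
  have est: "norm ((G b - V b) - (G a - V a)) \<le> \<epsilon> * (b ^ ?n - a ^ ?n) * v"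
    if ab: "0 < a" "a \<le> b" and \<epsilon>: "\<And>\<xi>. a < norm \<xi> \<Longrightarrow> norm \<xi> \<le> b \<Longrightarrow> norm (g \<xi> - k \<xi>) \<le> \<epsilon>" for a b \<epsilon>
  proof -
    let ?I = "\<lambda>r \<xi>. indicator (cball (0::real^'n) r) \<xi> :: real"
    have GV: "G r - V r = (\<integral>\<xi>. ?I r \<xi> *\<^sub>R (g \<xi> - k \<xi>) \<partial>lborel)"
      "integrable lborel (\<lambda>\<xi>. ?I r \<xi> *\<^sub>R (g \<xi> - k \<xi>))" for r
      using ig[of r] ik[of r] unfolding G_def V_def set_lebesgue_integral_def set_integrable_def
      by (simp_all add: scaleR_diff_right)
    have iI: "integrable lborel (\<lambda>\<xi>. \<epsilon> * ?I r \<xi>)" for r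
      using borel_integrable_compact[of "cball (0::real^'n) r" "\<lambda>_. \<epsilon>"] by (simp add: mult.commute)
    have "norm ((G b - V b) - (G a - V a))
      = norm (\<integral>\<xi>. ?I b \<xi> *\<^sub>R (g \<xi> - k \<xi>) - ?I a \<xi> *\<^sub>R (g \<xi> - k \<xi>) \<partial>lborel)"
      using GV by simp
    also have "\<dots> \<le> (\<integral>\<xi>. \<epsilon> * ?I b \<xi> - \<epsilon> * ?I a \<xi> \<partial>lborel)"
      using GV(2) iI ab \<epsilon> by (intro Bochner_Integration.integral_norm_bound_integral) (auto simp: indicator_def)
    also have "\<dots> = \<epsilon> * measure lborel (cball (0::real^'n) b) - \<epsilon> * measure lborel (cball (0::real^'n) a)"
      using iI by (subst Bochner_Integration.integral_diff) simp_all
    also have "\<dots> = \<epsilon> * (b ^ ?n - a ^ ?n) * v"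
      using ab measure_cball_0[of b, where 'a="real^'n"] measure_cball_0[of a, where 'a="real^'n"]
      by (simp add: v_def algebra_simps)
    finally show ?thesis .
  qed
  have "((\<lambda>r. G r - V r) has_vector_derivative 0) (at R)"
    unfolding has_vector_derivative_def has_derivative_at_alt
  proof (intro conjI allI impI)
    fix \<epsilon> :: real assume "0 < \<epsilon>"
    \<comment> \<open>Bounds the volume of a shell divided by its thickness while the outer radius
      is at most \<open>2 * R\<close>, by \<open>power_diff_le\<close>. The \<open>+ 1\<close> in
      \<open>\<eta>\<close> avoids division by zero.\<close>
    define c where "c = real ?n * (2 * R) ^ (?n - 1) * v"
    have c: "0 \<le> c" using R v by (simp add: c_def)
    define \<eta> where "\<eta> = \<epsilon> / (c + 1)"
    have \<eta>: "0 < \<eta>" "\<eta> * c \<le> \<epsilon>" using \<open>0 < \<epsilon>\<close> c by (auto simp: \<eta>_def field_simps)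
    have "uniformly_continuous_on (cball 0 (2 * R)) g"
      by (intro compact_uniformly_continuous continuous_on_subset[OF cont]) auto
    then obtain d where d: "0 < d" "\<And>\<xi> \<zeta>. \<xi> \<in> cball 0 (2 * R) \<Longrightarrow> \<zeta> \<in> cball 0 (2 * R) \<Longrightarrow> dist \<xi> \<zeta> < d \<Longrightarrow> dist (g \<xi>) (g \<zeta>) < \<eta>"
      unfolding uniformly_continuous_on_def using \<eta>(1) by metis
    have gk: "norm (g \<xi> - k \<xi>) \<le> \<eta>" if \<xi>: "0 < norm \<xi>" "norm \<xi> \<le> 2 * R" "\<bar>norm \<xi> - R\<bar> < d" for \<xi>
    proof -
      have "\<xi> - R *\<^sub>R sgn \<xi> = (norm \<xi> - R) *\<^sub>R sgn \<xi>"
        using \<xi>(1) by (simp add: sgn_div_norm algebra_simps)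
      then have "dist \<xi> (R *\<^sub>R sgn \<xi>) < d" using \<xi> by (simp add: dist_norm norm_sgn)
      then have "dist (g \<xi>) (g (R *\<^sub>R sgn \<xi>)) < \<eta>" using \<xi> R by (intro d(2)) (auto simp: norm_sgn)
      then show ?thesis by (simp add: k_def dist_norm)
    qed
    have key: "norm ((G b - V b) - (G a - V a)) \<le> \<epsilon> * (b - a)"
      if "0 < a" "a \<le> b" "b \<le> 2 * R" "R - d < a" "b < R + d" for a b
    proof -
      have "norm ((G b - V b) - (G a - V a)) \<le> \<eta> * (b ^ ?n - a ^ ?n) * v"
      proof (rule est)
        show "norm (g \<xi> - k \<xi>) \<le> \<eta>" if "a < norm \<xi>" "norm \<xi> \<le> b" for \<xi>
          by (rule gk) (use that \<open>0 < a\<close> \<open>b \<le> 2 * R\<close> \<open>R - d < a\<close> \<open>b < R + d\<close> in linarith)+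
      qed (use that in auto)
      also have "\<dots> \<le> \<eta> * (real ?n * (2 * R) ^ (?n - 1) * (b - a)) * v"
        using that \<eta> v by (intro mult_right_mono mult_left_mono power_diff_le) auto
      also have "\<dots> = (\<eta> * c) * (b - a)" by (simp add: c_def)
      also have "\<dots> \<le> \<epsilon> * (b - a)" using \<eta> that by (intro mult_right_mono) auto
      finally show ?thesis .
    qed
    show "\<exists>\<delta>>0. \<forall>r. norm (r - R) < \<delta> \<longrightarrow> norm (G r - V r - (G R - V R) - (r - R) *\<^sub>R 0) \<le> \<epsilon> * norm (r - R)"
    proof (intro exI[of _ "min d R"] conjI allI impI)
      fix r assume r: "norm (r - R) < min d R"
      show "norm (G r - V r - (G R - V R) - (r - R) *\<^sub>R 0) \<le> \<epsilon> * norm (r - R)"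
      proof (cases "R \<le> r")
        case True
        then show ?thesis using key[of R r] r R d(1) by auto
      next
        case False
        then show ?thesis using key[of r R] r R d(1) by (auto simp: norm_minus_commute)
      qed
    qed (use d R in auto)
  qed (rule bounded_linear_scaleR_left)
  from has_vector_derivative_add[OF this dV] show ?thesis by (simp add: G_def)
qed

text \<open>Squaring removes the corner of \<open>max 0\<close> at 0, so that the boundary weight
  used for balls is continuously differentiable.\<close>

lemma has_real_derivative_max_0_squared:
  "((\<lambda>x::real. (max 0 x)\<^sup>2) has_real_derivative 2 * max 0 x) (at x)"
proof -
  consider "x > 0" | "x < 0" | "x = 0" by linarith
  then show ?thesis
  proof cases
    case 1
    have "((\<lambda>x::real. x\<^sup>2) has_real_derivative 2 * max 0 x) (at x)"
      using 1 by (auto intro!: derivative_eq_intros)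
    then show ?thesis
      by (rule has_field_derivative_transform_within_open[where S = "{0<..}"]) (use 1 in auto)
  next
    case 2
    have "((\<lambda>x::real. 0) has_real_derivative 2 * max 0 x) (at x)"
      using 2 by (auto intro!: derivative_eq_intros)
    then show ?thesis
      by (rule has_field_derivative_transform_within_open[where S = "{..<0}"]) (use 2 in auto)
  next
    case 3
    have "((\<lambda>h::real. (max 0 h)\<^sup>2 / h) \<longlongrightarrow> 0) (at 0)"
    proof (rule Lim_null_comparison)
      show "\<forall>\<^sub>F h::real in at 0. norm ((max 0 h)\<^sup>2 / h) \<le> \<bar>h\<bar>"
        by (intro always_eventually allI) (auto simp: max_def power2_eq_square)
      show "((\<lambda>h::real. \<bar>h\<bar>) \<longlongrightarrow> 0) (at 0)"
        using tendsto_rabs_zero[OF tendsto_ident_at] .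
    qed
    then show ?thesis using 3 by (simp add: DERIV_def)
  qed
qed

text \<open>Comes from the compactly supported, continuously differentiable function
  \<open>(max 0 (\<rho>\<^sup>2 - |\<xi>|\<^sup>2))\<^sup>2 u\<close>. Differentiating the identity twice in \<open>\<rho>\<close> removes the weights.\<close>

lemma integral_ball_by_parts:
  fixes u u' :: "real ^ 'n::finite \<Rightarrow> complex"
  assumes deriv: "\<And>y. ((\<lambda>t. u (y + t *\<^sub>R e)) has_vector_derivative u' y) (at 0)"
    and cont: "continuous_on UNIV u" "continuous_on UNIV u'"
    and \<rho>: "0 < \<rho>"
  shows "\<rho> ^ 4 *\<^sub>R (LINT \<xi>:cball 0 \<rho>|lborel. u' \<xi>)
      - (2 * \<rho>\<^sup>2) *\<^sub>R (LINT \<xi>:cball 0 \<rho>|lborel. (\<xi> \<bullet> \<xi>) *\<^sub>R u' \<xi>)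
      + (LINT \<xi>:cball 0 \<rho>|lborel. (\<xi> \<bullet> \<xi>)\<^sup>2 *\<^sub>R u' \<xi>)
    = (4 * \<rho>\<^sup>2) *\<^sub>R (LINT \<xi>:cball 0 \<rho>|lborel. (\<xi> \<bullet> e) *\<^sub>R u \<xi>)
      - 4 *\<^sub>R (LINT \<xi>:cball 0 \<rho>|lborel. (\<xi> \<bullet> \<xi>) *\<^sub>R (\<xi> \<bullet> e) *\<^sub>R u \<xi>)"
proof -
  define m where "m \<xi> = max 0 (\<rho>\<^sup>2 - \<xi> \<bullet> \<xi>)" for \<xi> :: "real^'n"
  define w where "w \<xi> = (m \<xi>)\<^sup>2 *\<^sub>R u \<xi>" for \<xi>
  define w' where "w' \<xi> = (m \<xi>)\<^sup>2 *\<^sub>R u' \<xi> + (2 * m \<xi> * (- (2 * (\<xi> \<bullet> e)))) *\<^sub>R u \<xi>" for \<xi>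
  have norm_le: "norm \<xi> \<le> \<rho> \<longleftrightarrow> \<xi> \<bullet> \<xi> \<le> \<rho>\<^sup>2" for \<xi> :: "real^'n"
    using \<rho> norm_le_square[of \<xi> \<rho>] by simp
  have "integral\<^sup>L lborel w' = 0"
  proof (rule integral_directional_derivative_eq_0)
    fix y
    have "((\<lambda>t. \<rho>\<^sup>2 - (y + t *\<^sub>R e) \<bullet> (y + t *\<^sub>R e)) has_real_derivative - (2 * (y \<bullet> e))) (at 0)"
    proof -
      have eq: "(\<lambda>t. \<rho>\<^sup>2 - (y + t *\<^sub>R e) \<bullet> (y + t *\<^sub>R e)) = (\<lambda>t. \<rho>\<^sup>2 - (y \<bullet> y + 2 * (y \<bullet> e) * t + (e \<bullet> e) * t ^ 2))"
        by (simp add: fun_eq_iff inner_simps inner_commute power2_eq_square algebra_simps)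
      show ?thesis unfolding eq by (auto intro!: derivative_eq_intros)
    qed
    with has_real_derivative_max_0_squared
    have "((\<lambda>t. (m (y + t *\<^sub>R e))\<^sup>2) has_real_derivative 2 * max 0 (\<rho>\<^sup>2 - (y + 0 *\<^sub>R e) \<bullet> (y + 0 *\<^sub>R e)) * - (2 * (y \<bullet> e))) (at 0)"
      unfolding m_def by (rule DERIV_chain2)
    then have "((\<lambda>t. w (y + t *\<^sub>R e)) has_vector_derivative
       (m (y + 0 *\<^sub>R e))\<^sup>2 *\<^sub>R u' y + (2 * max 0 (\<rho>\<^sup>2 - (y + 0 *\<^sub>R e) \<bullet> (y + 0 *\<^sub>R e)) * - (2 * (y \<bullet> e))) *\<^sub>R u (y + 0 *\<^sub>R e)) (at 0)"
      unfolding w_def by (rule has_vector_derivative_scaleR[OF _ deriv])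
    then show "((\<lambda>t. w (y + t *\<^sub>R e)) has_vector_derivative w' y) (at 0)"
      by (simp add: w'_def m_def)
  next
    have m: "continuous_on UNIV m" unfolding m_def by (intro continuous_intros)
    show "continuous_on UNIV w" unfolding w_def by (intro continuous_intros m cont)
    show "continuous_on UNIV w'" unfolding w'_def by (intro continuous_intros m cont)
    show "w y = 0" if "norm y > \<rho>" for y
    proof -
      have "\<not> y \<bullet> y \<le> \<rho>\<^sup>2" using norm_le[of y] that by linarith
      then show ?thesis by (simp add: w_def m_def)
    qed
  qed
  moreover have int: "integrable lborel (\<lambda>\<xi>. indicator (cball 0 \<rho>) \<xi> *\<^sub>R f \<xi>)"
    if "continuous_on UNIV f" for f :: "real^'n \<Rightarrow> complex"
    by (intro borel_integrable_compact continuous_on_subset[OF that]) auto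
  let ?I = "\<lambda>\<xi>. indicator (cball 0 \<rho>) \<xi> :: real"
  let ?f1 = "\<lambda>\<xi>. ?I \<xi> *\<^sub>R u' \<xi>" and ?f2 = "\<lambda>\<xi>. ?I \<xi> *\<^sub>R ((\<xi> \<bullet> \<xi>) *\<^sub>R u' \<xi>)"
    and ?f3 = "\<lambda>\<xi>. ?I \<xi> *\<^sub>R ((\<xi> \<bullet> \<xi>)\<^sup>2 *\<^sub>R u' \<xi>)" and ?f4 = "\<lambda>\<xi>. ?I \<xi> *\<^sub>R ((\<xi> \<bullet> e) *\<^sub>R u \<xi>)"
    and ?f5 = "\<lambda>\<xi>. ?I \<xi> *\<^sub>R ((\<xi> \<bullet> \<xi>) *\<^sub>R (\<xi> \<bullet> e) *\<^sub>R u \<xi>)"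
  have ints: "integrable lborel ?f1" "integrable lborel ?f2" "integrable lborel ?f3"
    "integrable lborel ?f4" "integrable lborel ?f5"
    by (intro int continuous_intros cont)+
  have "w' \<xi> = \<rho> ^ 4 *\<^sub>R ?f1 \<xi> - (2 * \<rho>\<^sup>2) *\<^sub>R ?f2 \<xi> + ?f3 \<xi> - (4 * \<rho>\<^sup>2) *\<^sub>R ?f4 \<xi> + 4 *\<^sub>R ?f5 \<xi>" for \<xi>
  proof (cases "\<xi> \<bullet> \<xi> \<le> \<rho>\<^sup>2")
    case True
    then have "norm \<xi> \<le> \<rho>" by (simp add: norm_le)
    then show ?thesis using True
      by (simp add: w'_def m_def scaleR_conv_of_real power2_eq_square power4_eq_xxxx algebra_simps)
  next
    case False
    then have "\<not> norm \<xi> \<le> \<rho>" by (simp add: norm_le)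
    then show ?thesis using False by (simp add: w'_def m_def)
  qed
  then have w': "w' = (\<lambda>\<xi>. \<rho> ^ 4 *\<^sub>R ?f1 \<xi> - (2 * \<rho>\<^sup>2) *\<^sub>R ?f2 \<xi> + ?f3 \<xi> - (4 * \<rho>\<^sup>2) *\<^sub>R ?f4 \<xi> + 4 *\<^sub>R ?f5 \<xi>)"
    by (rule ext)
  have "integral\<^sup>L lborel w' = \<rho> ^ 4 *\<^sub>R integral\<^sup>L lborel ?f1 - (2 * \<rho>\<^sup>2) *\<^sub>R integral\<^sup>L lborel ?f2
      + integral\<^sup>L lborel ?f3 - (4 * \<rho>\<^sup>2) *\<^sub>R integral\<^sup>L lborel ?f4 + 4 *\<^sub>R integral\<^sup>L lborel ?f5"
    unfolding w'
    by (simp only: Bochner_Integration.integral_add Bochner_Integration.integral_diff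
        Bochner_Integration.integrable_add Bochner_Integration.integrable_diff integrable_scaleR_right ints
        integral_scaleR_right)
  ultimately show ?thesis unfolding set_lebesgue_integral_def by (simp add: algebra_simps)
qed

text \<open>Each differentiation in the radius produces boundary terms from the ball integrals and
  lower-order terms from the powers of \<open>\<rho>\<close>. Among the boundary terms with weights
  vanishing on the sphere everything cancels. The first differentiation leaves the identity
  \<open>step\<close>; the second leaves the volume integral of \<open>u'\<close> against the
  flux.\<close>

lemma divergence_theorem_cball:
  fixes u u' :: "real ^ 'n::finite \<Rightarrow> complex"
  assumes deriv: "\<And>y. ((\<lambda>t. u (y + t *\<^sub>R e)) has_vector_derivative u' y) (at 0)"
    and cont: "continuous_on UNIV u" "continuous_on UNIV u'"
    and R: "0 < R"
  shows "(LINT \<xi>:cball 0 R|lborel. u' \<xi>)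
    = R ^ (CARD('n) - 1) *\<^sub>R (LINT \<omega>:sphere 0 1|sphere_measure. (\<omega> \<bullet> e) *\<^sub>R u (R *\<^sub>R \<omega>))"
proof -
  define p where "p \<xi> = (\<xi> \<bullet> e) *\<^sub>R u \<xi>" for \<xi>
  let ?I = "\<lambda>f \<rho>. LINT \<xi>:cball 0 \<rho>|lborel. f \<xi>"
  let ?S = "\<lambda>f \<rho>. LINT \<omega>:sphere 0 1|sphere_measure. f (\<rho> *\<^sub>R \<omega>)"
  let ?d = "\<lambda>f \<rho>. \<rho> ^ (CARD('n) - 1) *\<^sub>R ?S f \<rho>"
  have p: "continuous_on UNIV p" unfolding p_def by (intro continuous_intros cont)
  have D: "(?I f has_vector_derivative ?d f \<rho>) (at \<rho>)" if "continuous_on UNIV f" "0 < \<rho>"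
    for f :: "real^'n \<Rightarrow> complex" and \<rho>
    by (rule ball_integral_has_vector_derivative[OF that])
  \<comment> \<open>A radial weight is constant on the sphere of radius \<open>\<rho>\<close>, with
    value \<open>h (\<rho>\<^sup>2)\<close>; this is what makes the boundary terms cancel.\<close>
  have S: "(LINT \<omega>:sphere 0 1|sphere_measure. h (\<rho> *\<^sub>R \<omega> \<bullet> \<rho> *\<^sub>R \<omega>) *\<^sub>R f (\<rho> *\<^sub>R \<omega>)) = h (\<rho>\<^sup>2) *\<^sub>R ?S f \<rho>"
    for h :: "real \<Rightarrow> real" and f :: "real^'n \<Rightarrow> complex" and \<rho>
  proof -
    have "indicator (sphere 0 1) \<omega> *\<^sub>R h (\<rho> *\<^sub>R \<omega> \<bullet> \<rho> *\<^sub>R \<omega>) *\<^sub>R f (\<rho> *\<^sub>R \<omega>)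
        = h (\<rho>\<^sup>2) *\<^sub>R indicator (sphere 0 1) \<omega> *\<^sub>R f (\<rho> *\<^sub>R \<omega>)" for \<omega> :: "real^'n"
      by (simp add: indicator_def dot_square_norm power2_eq_square)
    then show ?thesis unfolding set_lebesgue_integral_def by (simp only: integral_scaleR_right)
  qed
  have s_cont: "continuous_on UNIV (\<lambda>\<xi>. (\<xi> \<bullet> \<xi>) *\<^sub>R u' \<xi>)" "continuous_on UNIV (\<lambda>\<xi>. (\<xi> \<bullet> \<xi>)\<^sup>2 *\<^sub>R u' \<xi>)"
    "continuous_on UNIV (\<lambda>\<xi>. (\<xi> \<bullet> \<xi>) *\<^sub>R p \<xi>)"
    by (intro continuous_intros cont p)+
  have step: "\<rho>\<^sup>2 *\<^sub>R ?I u' \<rho> - ?I (\<lambda>\<xi>. (\<xi> \<bullet> \<xi>) *\<^sub>R u' \<xi>) \<rho> = 2 *\<^sub>R ?I p \<rho>" if \<rho>: "0 < \<rho>" for \<rho>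
  proof -
    let ?L = "\<lambda>\<rho>. \<rho> ^ 4 *\<^sub>R ?I u' \<rho> - (2 * \<rho>\<^sup>2) *\<^sub>R ?I (\<lambda>\<xi>. (\<xi> \<bullet> \<xi>) *\<^sub>R u' \<xi>) \<rho> + ?I (\<lambda>\<xi>. (\<xi> \<bullet> \<xi>)\<^sup>2 *\<^sub>R u' \<xi>) \<rho>"
    let ?R = "\<lambda>\<rho>. (4 * \<rho>\<^sup>2) *\<^sub>R ?I p \<rho> - 4 *\<^sub>R ?I (\<lambda>\<xi>. (\<xi> \<bullet> \<xi>) *\<^sub>R p \<xi>) \<rho>"
    have L: "(?L has_vector_derivative (\<rho> ^ 4 *\<^sub>R ?d u' \<rho> + (4 * \<rho> ^ 3) *\<^sub>R ?I u' \<rho>)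
        - ((2 * \<rho>\<^sup>2) *\<^sub>R ?d (\<lambda>\<xi>. (\<xi> \<bullet> \<xi>) *\<^sub>R u' \<xi>) \<rho> + (4 * \<rho>) *\<^sub>R ?I (\<lambda>\<xi>. (\<xi> \<bullet> \<xi>) *\<^sub>R u' \<xi>) \<rho>)
        + ?d (\<lambda>\<xi>. (\<xi> \<bullet> \<xi>)\<^sup>2 *\<^sub>R u' \<xi>) \<rho>) (at \<rho>)"
      using \<rho> by (intro has_vector_derivative_add has_vector_derivative_diff has_vector_derivative_scaleR D cont s_cont)
        (auto intro!: derivative_eq_intros)
    have R: "(?R has_vector_derivative ((4 * \<rho>\<^sup>2) *\<^sub>R ?d p \<rho> + (8 * \<rho>) *\<^sub>R ?I p \<rho>)
        - (4 *\<^sub>R ?d (\<lambda>\<xi>. (\<xi> \<bullet> \<xi>) *\<^sub>R p \<xi>) \<rho> + 0 *\<^sub>R ?I (\<lambda>\<xi>. (\<xi> \<bullet> \<xi>) *\<^sub>R p \<xi>) \<rho>)) (at \<rho>)"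
      using \<rho> by (intro has_vector_derivative_diff has_vector_derivative_scaleR D p s_cont)
        (auto intro!: derivative_eq_intros)
    have LR: "?L r = ?R r" if "r \<in> {0<..}" for r
      using integral_ball_by_parts[OF deriv cont, of r] that unfolding p_def by simp
    have "(?R has_vector_derivative (\<rho> ^ 4 *\<^sub>R ?d u' \<rho> + (4 * \<rho> ^ 3) *\<^sub>R ?I u' \<rho>)
        - ((2 * \<rho>\<^sup>2) *\<^sub>R ?d (\<lambda>\<xi>. (\<xi> \<bullet> \<xi>) *\<^sub>R u' \<xi>) \<rho> + (4 * \<rho>) *\<^sub>R ?I (\<lambda>\<xi>. (\<xi> \<bullet> \<xi>) *\<^sub>R u' \<xi>) \<rho>)
        + ?d (\<lambda>\<xi>. (\<xi> \<bullet> \<xi>)\<^sup>2 *\<^sub>R u' \<xi>) \<rho>) (at \<rho>)"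
      by (rule has_vector_derivative_transform_within_open[OF L open_greaterThan[of 0] _ LR]) (use \<rho> in simp)
    from vector_derivative_unique_at[OF this R]
    have "(4 * \<rho>) *\<^sub>R (\<rho>\<^sup>2 *\<^sub>R ?I u' \<rho> - ?I (\<lambda>\<xi>. (\<xi> \<bullet> \<xi>) *\<^sub>R u' \<xi>) \<rho>) = (4 * \<rho>) *\<^sub>R (2 *\<^sub>R ?I p \<rho>)"
      unfolding S[of "\<lambda>x. x"] S[of "\<lambda>x. x\<^sup>2"]
      by (simp add: scaleR_conv_of_real power2_eq_square power3_eq_cube power4_eq_xxxx algebra_simps)
    then show ?thesis by (rule scaleR_left_imp_eq[rotated]) (use \<rho> in simp)
  qed
  let ?L = "\<lambda>\<rho>. \<rho>\<^sup>2 *\<^sub>R ?I u' \<rho> - ?I (\<lambda>\<xi>. (\<xi> \<bullet> \<xi>) *\<^sub>R u' \<xi>) \<rho>"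
  have "(?L has_vector_derivative (R\<^sup>2 *\<^sub>R ?d u' R + (2 * R) *\<^sub>R ?I u' R)
      - ?d (\<lambda>\<xi>. (\<xi> \<bullet> \<xi>) *\<^sub>R u' \<xi>) R) (at R)"
    using R by (intro has_vector_derivative_diff has_vector_derivative_scaleR D cont s_cont)
      (auto intro!: derivative_eq_intros)
  then have "((\<lambda>\<rho>. 2 *\<^sub>R ?I p \<rho>) has_vector_derivative (R\<^sup>2 *\<^sub>R ?d u' R + (2 * R) *\<^sub>R ?I u' R)
      - ?d (\<lambda>\<xi>. (\<xi> \<bullet> \<xi>) *\<^sub>R u' \<xi>) R) (at R)"
    by (rule has_vector_derivative_transform_within_open[OF _ open_greaterThan[of 0]]) (use R in \<open>simp_all add: step\<close>)
  moreover have "((\<lambda>\<rho>. 2 *\<^sub>R ?I p \<rho>) has_vector_derivative (2 *\<^sub>R ?d p R + 0 *\<^sub>R ?I p R)) (at R)"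
    using R by (intro has_vector_derivative_scaleR D p) (auto intro!: derivative_eq_intros)
  ultimately have "(R\<^sup>2 *\<^sub>R ?d u' R + (2 * R) *\<^sub>R ?I u' R) - ?d (\<lambda>\<xi>. (\<xi> \<bullet> \<xi>) *\<^sub>R u' \<xi>) R
      = 2 *\<^sub>R ?d p R + 0 *\<^sub>R ?I p R"
    by (rule vector_derivative_unique_at)
  then have "(2 * R) *\<^sub>R ?I u' R = 2 *\<^sub>R ?d p R"
    unfolding S[of "\<lambda>x. x"] by (simp add: scaleR_conv_of_real algebra_simps)
  \<comment> \<open>The factor \<open>R\<close> from
    \<open>(R *\<^sub>R \<omega>) \<bullet> e\<close> is the one that cancels against
    \<open>2 * R\<close> on the left.\<close>
  also have "?S p R = R *\<^sub>R (LINT \<omega>:sphere 0 1|sphere_measure. (\<omega> \<bullet> e) *\<^sub>R u (R *\<^sub>R \<omega>))"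
  proof -
    have "indicator (sphere 0 1) \<omega> *\<^sub>R p (R *\<^sub>R \<omega>) = R *\<^sub>R indicator (sphere 0 1) \<omega> *\<^sub>R (\<omega> \<bullet> e) *\<^sub>R u (R *\<^sub>R \<omega>)"
      for \<omega> :: "real^'n" by (simp add: p_def)
    then show ?thesis unfolding set_lebesgue_integral_def by (simp only: integral_scaleR_right)
  qed
  finally have "(2 * R) *\<^sub>R ?I u' R = (2 * R) *\<^sub>R (R ^ (CARD('n) - 1) *\<^sub>R (LINT \<omega>:sphere 0 1|sphere_measure. (\<omega> \<bullet> e) *\<^sub>R u (R *\<^sub>R \<omega>)))"
    by (simp add: mult_ac)
  then show ?thesis by (rule scaleR_left_imp_eq[rotated]) (use R in simp)
qed

section \<open>Integrals over spheres and expansions of integrals over balls\<close>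

lemma finite_measure_sphere_measure: "finite_measure (sphere_measure :: (real ^ 'n::finite) measure)"
proof
  let ?B = "ball 0 1 - {0} :: (real^'n) set"
  have m: "(\<lambda>\<xi>::real^'n. \<xi> /\<^sub>R norm \<xi>) \<in> restrict_space lborel ?B \<rightarrow>\<^sub>M borel"
    by (rule measurable_restrict_space1) measurable
  have "emeasure (sphere_measure :: (real^'n) measure) UNIV = of_nat CARD('n) * emeasure lborel ?B"
    unfolding sphere_measure_def using m
    by (simp add: emeasure_distr emeasure_restrict_space space_restrict_space)
  also have "\<dots> \<le> of_nat CARD('n) * emeasure lborel (ball (0::real^'n) 1)"
    by (intro mult_left_mono emeasure_mono) auto
  also have "\<dots> < \<infinity>"
    using emeasure_lborel_ball_finite[of "0::real^'n" 1]
    by (simp add: ennreal_mult_less_top of_nat_less_top)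
  finally show "emeasure (sphere_measure :: (real^'n) measure) (space sphere_measure) \<noteq> \<infinity>"
    by (simp add: space_sphere_measure)
qed

interpretation sphere_measure: finite_measure "sphere_measure :: (real ^ 'n::finite) measure"
  by (rule finite_measure_sphere_measure)

interpretation lborel_sphere: pair_sigma_finite lborel "sphere_measure :: (real ^ 'n::finite) measure" ..

lemma set_integrable_sphere:
  fixes f :: "real ^ 'n::finite \<Rightarrow> complex"
  assumes "continuous_on (sphere 0 1) f"
  shows "set_integrable sphere_measure (sphere 0 1) f"
proof -
  obtain B where B: "\<And>\<omega>. \<omega> \<in> sphere 0 1 \<Longrightarrow> norm (f \<omega>) \<le> B"
    using continuous_on_compact_bound_norm[OF compact_sphere assms] by blast
  show ?thesis unfolding set_integrable_def
  proof (rule integrableI_bounded_set[where A = "sphere 0 1" and B = B])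
    show "(\<lambda>\<omega>. indicator (sphere 0 1) \<omega> *\<^sub>R f \<omega>) \<in> borel_measurable sphere_measure"
      using borel_measurable_continuous_on_indicator[OF borel_closed[OF closed_sphere] assms]
      by (simp cong: measurable_cong_sets add: sets_sphere_measure)
  qed (auto simp: B indicator_def sets_sphere_measure sphere_measure.emeasure_eq_measure)
qed

lemma sphere_integral_norm_le:
  fixes f :: "real ^ 'n::finite \<Rightarrow> complex"
  assumes "set_integrable sphere_measure (sphere 0 1) f"
    and "\<And>\<omega>. \<omega> \<in> sphere 0 1 \<Longrightarrow> norm (f \<omega>) \<le> B" and "0 \<le> B"
  shows "norm (LINT \<omega>:sphere 0 1|sphere_measure. f \<omega>) \<le> B * measure (sphere_measure :: (real^'n) measure) UNIV"
proof -
  have "norm (LINT \<omega>:sphere 0 1|sphere_measure. f \<omega>) \<le> (\<integral>\<omega>. B \<partial>(sphere_measure :: (real^'n) measure))"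
    unfolding set_lebesgue_integral_def
    using assms by (intro Bochner_Integration.integral_norm_bound_integral) (auto simp: indicator_def set_integrable_def)
  then show ?thesis by (simp add: space_sphere_measure mult.commute)
qed

lemma pair_integrable_continuous_compact:
  fixes f :: "'a::euclidean_space \<times> 'b::euclidean_space \<Rightarrow> complex"
  assumes "pair_sigma_finite (lborel :: 'a measure) M" and M: "sets M = sets borel" "emeasure M S < \<infinity>"
    and K: "compact K" and S: "compact S" and cont: "continuous_on (K \<times> S) f"
  shows "integrable (lborel \<Otimes>\<^sub>M M) (\<lambda>p. indicator (K \<times> S) p *\<^sub>R f p)"
proof -
  interpret pair_sigma_finite "lborel :: 'a measure" M by fact
  have c: "compact (K \<times> S)" using K S by (rule compact_Times)
  obtain B where B: "\<And>p. p \<in> K \<times> S \<Longrightarrow> norm (f p) \<le> B"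
    using continuous_on_compact_bound_norm[OF c cont] by blast
  have sets: "sets (lborel \<Otimes>\<^sub>M M) = sets (borel :: ('a \<times> 'b) measure)"
    unfolding borel_prod[symmetric] by (rule sets_pair_measure_cong[OF sets_lborel M(1)])
  show ?thesis
  proof (rule integrableI_bounded_set[where A = "K \<times> S" and B = B])
    have Kb: "K \<times> S \<in> sets borel" by (rule borel_compact[OF c])
    then show "K \<times> S \<in> sets (lborel \<Otimes>\<^sub>M M)" by (simp only: sets)
    show "(\<lambda>p. indicator (K \<times> S) p *\<^sub>R f p) \<in> borel_measurable (lborel \<Otimes>\<^sub>M M)"
      using borel_measurable_continuous_on_indicator[OF Kb cont] measurable_cong_sets[OF sets refl] by blast
    have "emeasure (lborel \<Otimes>\<^sub>M M) (K \<times> S) = emeasure lborel K * emeasure M S"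
      using borel_compact[OF K] borel_compact[OF S] M by (intro M2.emeasure_pair_measure_Times) auto
    then show "emeasure (lborel \<Otimes>\<^sub>M M) (K \<times> S) < \<infinity>"
      using emeasure_compact_finite[OF K] M(2) by (simp add: ennreal_mult_less_top)
  qed (auto simp: B)
qed

text \<open>The second factor \<open>M\<close> is kept general because two measures occur: Lebesgue
  measure on balls in the fibre and the surface measure on the unit sphere.\<close>

lemma pair_integral_continuous_compact:
  fixes f :: "'a::euclidean_space \<times> 'b::euclidean_space \<Rightarrow> complex"
  assumes pair: "pair_sigma_finite (lborel :: 'a measure) M" and M: "sets M = sets borel" "emeasure M S < \<infinity>"
    and K: "compact K" and S: "compact S" and cont: "continuous_on (K \<times> S) f"
  shows "set_integrable lborel K (\<lambda>x. LINT y:S|M. f (x, y))"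
    and "(LINT p:K \<times> S|lborel \<Otimes>\<^sub>M M. f p) = (LINT x:K|lborel. LINT y:S|M. f (x, y))"
    and "(LINT x:K|lborel. LINT y:S|M. f (x, y)) = (LINT y:S|M. LINT x:K|lborel. f (x, y))"
proof -
  interpret pair_sigma_finite "lborel :: 'a measure" M by fact
  note int = pair_integrable_continuous_compact[OF assms]
  have fst: "(\<integral>y. indicator (K \<times> S) (x, y) *\<^sub>R f (x, y) \<partial>M) = indicator K x *\<^sub>R (LINT y:S|M. f (x, y))" for x
    unfolding set_lebesgue_integral_def by (simp add: indicator_times flip: scaleR_scaleR)
  have snd: "(\<integral>x. indicator (K \<times> S) (x, y) *\<^sub>R f (x, y) \<partial>lborel) = indicator S y *\<^sub>R (LINT x:K|lborel. f (x, y))" for y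
    unfolding set_lebesgue_integral_def
    by (simp add: indicator_times mult.commute[of "indicator K _"] flip: scaleR_scaleR)
  show "set_integrable lborel K (\<lambda>x. LINT y:S|M. f (x, y))"
    using integrable_fst'[OF int] unfolding fst set_integrable_def .
  show "(LINT p:K \<times> S|lborel \<Otimes>\<^sub>M M. f p) = (LINT x:K|lborel. LINT y:S|M. f (x, y))"
    using integral_fst'[OF int] unfolding fst set_lebesgue_integral_def by simp
  have "integrable (lborel \<Otimes>\<^sub>M M) (\<lambda>(x, y). indicator (K \<times> S) (x, y) *\<^sub>R f (x, y))"
    using int by (simp add: case_prod_beta')
  from Fubini_integral[OF this]
  have "(\<integral>y. (\<integral>x. indicator (K \<times> S) (x, y) *\<^sub>R f (x, y) \<partial>lborel) \<partial>M)
      = (\<integral>x. (\<integral>y. indicator (K \<times> S) (x, y) *\<^sub>R f (x, y) \<partial>M) \<partial>lborel)" .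
  then show "(LINT x:K|lborel. LINT y:S|M. f (x, y)) = (LINT y:S|M. LINT x:K|lborel. f (x, y))"
    unfolding fst snd set_lebesgue_integral_def by simp
qed

section \<open>Primitives of powers and the expansion of ball integrals\<close>

lemma has_vector_derivative_powr:
  assumes "0 < R"
  shows "((\<lambda>r::real. complex_of_real r powr w) has_vector_derivative w * complex_of_real R powr (w - 1)) (at R)"
proof -
  have "complex_of_real R \<notin> \<real>\<^sub>\<le>\<^sub>0" using assms by (simp add: complex_nonpos_Reals_iff)
  then have "((\<lambda>z. z powr w) has_field_derivative w * complex_of_real R powr (w - 1)) (at (complex_of_real R))"
    by (rule has_field_derivative_powr)
  moreover have "(complex_of_real has_vector_derivative 1) (at R)"
    using has_vector_derivative_of_real[OF DERIV_ident] by simp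
  ultimately have "((\<lambda>z. z powr w) \<circ> complex_of_real has_vector_derivative 1 * (w * complex_of_real R powr (w - 1))) (at R)"
    by (intro field_vector_diff_chain_at)
  then show ?thesis by (simp add: o_def)
qed

text \<open>The antiderivative of \<open>R powr (w - 1)\<close> without constant term. The case
  \<open>w = 0\<close> is the source of the logarithm in the expansion of ball integrals.\<close>

definition powr_primitive :: "complex \<Rightarrow> real \<Rightarrow> complex" where
  "powr_primitive w R = (if w = 0 then of_real (ln R) else of_real R powr w / w)"

lemma powr_primitive_has_vector_derivative:
  assumes "0 < R"
  shows "(powr_primitive w has_vector_derivative complex_of_real R powr (w - 1)) (at R)"
proof (cases "w = 0")
  case True
  have "((\<lambda>r. complex_of_real (ln r)) has_vector_derivative complex_of_real (inverse R)) (at R)"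
    using assms by (intro has_vector_derivative_of_real DERIV_ln)
  moreover have "complex_of_real (inverse R) = complex_of_real R powr (0 - 1)"
    using assms by (simp add: powr_minus)
  moreover have "powr_primitive w = (\<lambda>r. complex_of_real (ln r))"
    using True by (simp add: powr_primitive_def fun_eq_iff)
  ultimately show ?thesis using True by simp
next
  case False
  have "((\<lambda>r. (1 / w) * complex_of_real r powr w) has_vector_derivative (1 / w) * (w * complex_of_real R powr (w - 1))) (at R)"
    by (intro has_vector_derivative_mult_right has_vector_derivative_powr assms)
  moreover have "powr_primitive w = (\<lambda>r. (1 / w) * complex_of_real r powr w)"
    using False by (simp add: powr_primitive_def fun_eq_iff)
  ultimately show ?thesis using False by simp
qed

text \<open>The primitives consist of nonzero powers and logarithms only, so they leave the constant
  \<open>c\<close> untouched.\<close>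

lemma has_finite_part_powr_primitive:
  fixes w L :: "'q \<Rightarrow> complex"
  assumes Q: "finite Q"
    and lim: "((\<lambda>R. F R - ((\<Sum>q\<in>Q. L q * powr_primitive (w q) R) + c)) \<longlongrightarrow> 0) at_top"
  shows "has_finite_part F c"
proof -
  let ?Q0 = "{q \<in> Q. w q = 0}" and ?Q1 = "{q \<in> Q. w q \<noteq> 0}"
  have "(\<Sum>q\<in>Q. L q * powr_primitive (w q) R)
      = (\<Sum>q\<in>?Q1. L q / w q * of_real R powr w q) + (\<Sum>q\<in>?Q0. L q) * of_real (ln R)" for R
  proof -
    have "(\<Sum>q\<in>Q. L q * powr_primitive (w q) R)
       = (\<Sum>q\<in>?Q1. L q * powr_primitive (w q) R) + (\<Sum>q\<in>?Q0. L q * powr_primitive (w q) R)"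
      using Q by (subst sum.union_disjoint[symmetric]) (auto intro!: sum.cong)
    also have "(\<Sum>q\<in>?Q1. L q * powr_primitive (w q) R) = (\<Sum>q\<in>?Q1. L q / w q * of_real R powr w q)"
      by (intro sum.cong) (auto simp: powr_primitive_def)
    also have "(\<Sum>q\<in>?Q0. L q * powr_primitive (w q) R) = (\<Sum>q\<in>?Q0. L q) * of_real (ln R)"
      unfolding sum_distrib_right by (intro sum.cong) (auto simp: powr_primitive_def)
    finally show ?thesis .
  qed
  then have "has_finite_part F (c + (\<Sum>q | q \<in> ?Q1 \<and> w q = 0. L q / w q))"
    using Q lim by (intro has_finite_part_family[where b = "\<Sum>q\<in>?Q0. L q"]) simp_all
  moreover have "{q. q \<in> ?Q1 \<and> w q = 0} = {}" by auto
  ultimately show ?thesis by (simp only: sum.empty add_0_right)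
qed

text \<open>The derivative of \<open>T\<close> is \<open>R ^ (n - 1)\<close> times the error of the
  sphere integral, hence at most \<open>C / R\<^sup>2\<close>. So \<open>T\<close> converges with a
  rate that depends on \<open>C\<close> alone, which later gives uniformity in \<open>x\<close>. The
  limit is taken along a fixed sequence of radii above 1 so that, as a function of \<open>x\<close>,
  it is a pointwise limit of measurable functions.\<close>

lemma ball_integral_expansion:
  fixes g :: "real ^ 'n::finite \<Rightarrow> complex" and d L :: "'q \<Rightarrow> complex"
  assumes cont: "continuous_on UNIV g"
    and bound: "\<And>R. 1 < R \<Longrightarrow> norm ((LINT \<omega>:sphere 0 1|sphere_measure. g (R *\<^sub>R \<omega>))
      - (\<Sum>q\<in>Q. complex_of_real R powr d q * L q)) \<le> C * R powr - (real CARD('n) + 1)"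
    and C: "0 \<le> C"
  defines "T \<equiv> \<lambda>R. (LINT \<xi>:cball 0 R|lborel. g \<xi>) - (\<Sum>q\<in>Q. L q * powr_primitive (d q + of_nat CARD('n)) R)"
  shows "\<exists>c. (\<lambda>k. T (real k + 2)) \<longlonglongrightarrow> c \<and> (\<forall>R>1. norm (T R - c) \<le> C / R)"
proof -
  let ?n = "CARD('n)"
  have n: "0 < ?n" by simp
  define T' where "T' R = R ^ (?n - 1) *\<^sub>R (LINT \<omega>:sphere 0 1|sphere_measure. g (R *\<^sub>R \<omega>))
    - (\<Sum>q\<in>Q. L q * complex_of_real R powr (d q + of_nat ?n - 1))" for R
  have T': "(T has_vector_derivative T' R) (at R)" if "0 < R" for R
    unfolding T_def T'_def using that
    by (intro has_vector_derivative_diff has_vector_derivative_sum has_vector_derivative_mult_right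
        ball_integral_has_vector_derivative cont powr_primitive_has_vector_derivative)
  have T'_bound: "norm (T' R) \<le> C / R\<^sup>2" if R: "1 < R" for R
  proof -
    have pw: "complex_of_real R powr (d q + of_nat ?n - 1) = of_real (R ^ (?n - 1)) * complex_of_real R powr d q" for q
    proof -
      have "complex_of_real R powr (d q + of_nat ?n - 1) = complex_of_real R powr (d q + of_nat (?n - 1))"
        using n by (simp add: of_nat_diff algebra_simps)
      also have "\<dots> = complex_of_real R powr d q * complex_of_real R powr of_nat (?n - 1)"
        by (rule powr_add)
      also have "complex_of_real R powr of_nat (?n - 1) = of_real (R ^ (?n - 1))"
        using R by (subst powr_nat') auto
      finally show ?thesis by (simp add: mult.commute)
    qed
    have "T' R = R ^ (?n - 1) *\<^sub>R ((LINT \<omega>:sphere 0 1|sphere_measure. g (R *\<^sub>R \<omega>))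
      - (\<Sum>q\<in>Q. complex_of_real R powr d q * L q))"
      unfolding T'_def pw by (simp add: scaleR_conv_of_real right_diff_distrib sum_distrib_left mult_ac)
    then have "norm (T' R) \<le> R ^ (?n - 1) * (C * R powr - (real ?n + 1))"
      using R bound[OF R] by (simp add: mult_left_mono)
    also have "R ^ (?n - 1) = R powr (real ?n - 1)"
      using R n by (subst powr_realpow[symmetric]) (auto simp: of_nat_diff)
    also have "R powr (real ?n - 1) * (C * R powr - (real ?n + 1)) = C * R powr (- 2)"
      using R by (simp add: mult.left_commute powr_add[symmetric])
    also have "\<dots> = C / R\<^sup>2"
      using R by (simp add: powr_minus divide_inverse)
    finally show ?thesis .
  qed
  have T_diff: "norm (T b - T a) \<le> C / a - C / b" if ab: "1 < a" "a \<le> b" for a b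
  proof (cases "a = b")
    case False
    with ab have "a < b" by simp
    \<comment> \<open>Comparison with \<open>- C / r\<close>, whose derivative
      \<open>C / r\<^sup>2\<close> dominates that of \<open>T\<close>.\<close>
    have "norm (T b - T a) \<le> (- C / b) - (- C / a)"
    proof (rule differentiable_bound_general[OF \<open>a < b\<close>, where f' = T' and \<phi>' = "\<lambda>r. C / r\<^sup>2"])
      show "continuous_on {a..b} T"
        using ab by (intro continuous_at_imp_continuous_on ballI
            has_vector_derivative_continuous[OF T']) auto
      show "continuous_on {a..b} (\<lambda>r. - C / r)"
        using ab by (intro continuous_intros) auto
      show "((\<lambda>r. - C / r) has_vector_derivative C / r\<^sup>2) (at r)" if "a < r" "r < b" for r
        using that ab unfolding has_real_derivative_iff_has_vector_derivative[symmetric]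
        by (auto intro!: derivative_eq_intros simp: power2_eq_square)
    qed (use ab in \<open>auto intro: T' T'_bound\<close>)
    then show ?thesis by simp
  qed simp
  have T_diff': "norm (T b - T a) \<le> C / a" if "1 < a" "a \<le> b" for a b
  proof -
    have "0 \<le> C / b" using that C by simp
    with T_diff[OF that] show ?thesis by linarith
  qed
  have "Cauchy (\<lambda>k. T (real k + 2))"
  proof (rule CauchyI')
    fix e :: real assume "0 < e"
    obtain M :: nat where M: "C / e < real M" using reals_Archimedean2 by blast
    show "\<exists>M. \<forall>m\<ge>M. \<forall>n>m. dist (T (real m + 2)) (T (real n + 2)) < e"
    proof (intro exI[of _ M] allI impI)
      fix m n assume mn: "M \<le> m" "m < n"
      have "norm (T (real n + 2) - T (real m + 2)) \<le> C / (real m + 2)"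
        using mn by (intro T_diff') auto
      also have "\<dots> < e"
      proof -
        have "C / e < real m + 2" using M mn by linarith
        then show ?thesis using \<open>0 < e\<close> by (simp add: field_simps)
      qed
      finally show "dist (T (real m + 2)) (T (real n + 2)) < e" by (simp add: dist_norm norm_minus_commute)
    qed
  qed
  then obtain c where c: "(\<lambda>k. T (real k + 2)) \<longlonglongrightarrow> c"
    using Cauchy_convergent convergent_def by blast
  have "norm (T R - c) \<le> C / R" if R: "1 < R" for R
  proof -
    have "(\<lambda>k. norm (T (real k + 2) - T R)) \<longlonglongrightarrow> norm (c - T R)"
      by (intro tendsto_intros c)
    moreover have "\<forall>\<^sub>F k in sequentially. norm (T (real k + 2) - T R) \<le> C / R"
    proof -
      obtain k0 :: nat where k0: "R < real k0" using reals_Archimedean2 by blast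
      show ?thesis
        using eventually_ge_at_top[of k0]
        by eventually_elim (use k0 R in \<open>auto intro!: T_diff'\<close>)
    qed
    ultimately have "norm (c - T R) \<le> C / R"
      by (rule tendsto_upperbound) simp
    then show ?thesis by (simp add: norm_minus_commute)
  qed
  with c show ?thesis by blast
qed

section \<open>Asymptotic expansions of symbols\<close>

lemma dir_deriv_eq:
  assumes "(f has_derivative F) (at p)"
  shows "dir_deriv v f p = F v"
  using frechet_derivative_at[OF assms] by (simp add: dir_deriv_def)

lemma dir_deriv_has_derivative:
  assumes "f differentiable (at p)"
  shows "(f has_derivative (\<lambda>v. dir_deriv v f p)) (at p)"
  using assms by (simp add: dir_deriv_def frechet_derivative_works[symmetric])

lemma dir_deriv_cong:
  assumes "f differentiable (at p)" "open S" "p \<in> S" "\<And>q. q \<in> S \<Longrightarrow> f q = g q"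
  shows "dir_deriv v g p = dir_deriv v f p" "g differentiable (at p)"
proof -
  have "(g has_derivative (\<lambda>v. dir_deriv v f p)) (at p)"
    by (rule has_derivative_transform_within_open[OF dir_deriv_has_derivative assms(2-)]) (use assms in auto)
  then show "dir_deriv v g p = dir_deriv v f p" "g differentiable (at p)"
    by (auto simp: dir_deriv_eq differentiable_def)
qed

lemma dir_deriv_cmult:
  fixes f :: "_ \<Rightarrow> complex"
  assumes "f differentiable (at p)"
  shows "dir_deriv v (\<lambda>q. c * f q) p = c * dir_deriv v f p"
  by (rule dir_deriv_eq[OF has_derivative_mult_right[OF dir_deriv_has_derivative[OF assms]]])

lemma dir_deriv_add:
  assumes "f differentiable (at p)" "g differentiable (at p)"
  shows "dir_deriv v (\<lambda>q. f q + g q) p = dir_deriv v f p + dir_deriv v g p"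
  by (rule dir_deriv_eq[OF has_derivative_add[OF dir_deriv_has_derivative[OF assms(1)] dir_deriv_has_derivative[OF assms(2)]]])

lemma dir_deriv_sum:
  assumes "\<And>i. i \<in> A \<Longrightarrow> f i differentiable (at p)"
  shows "dir_deriv v (\<lambda>q. \<Sum>i\<in>A. f i q) p = (\<Sum>i\<in>A. dir_deriv v (f i) p)"
  by (rule dir_deriv_eq[OF has_derivative_sum]) (rule dir_deriv_has_derivative[OF assms])

lemma differentiable_sum_family:
  assumes "\<And>i. i \<in> A \<Longrightarrow> f i differentiable (at p)"
  shows "(\<lambda>q. \<Sum>i\<in>A. f i q) differentiable (at p)"
  unfolding differentiable_def
  by (rule exI, rule has_derivative_sum, rule dir_deriv_has_derivative[OF assms])

lemma dir_deriv_line: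
  assumes "f differentiable (at p)"
  shows "((\<lambda>t. f (p + t *\<^sub>R v)) has_vector_derivative dir_deriv v f p) (at 0)"
proof -
  have "((\<lambda>t. p + t *\<^sub>R v) has_derivative (\<lambda>t. t *\<^sub>R v)) (at 0)"
    by (auto intro!: derivative_eq_intros)
  moreover have "(f has_derivative (\<lambda>v. dir_deriv v f p)) (at (p + 0 *\<^sub>R v))"
    using dir_deriv_has_derivative[OF assms] by simp
  ultimately have "((\<lambda>t. f (p + t *\<^sub>R v)) has_derivative (\<lambda>t. dir_deriv (t *\<^sub>R v) f p)) (at 0)"
    by (rule has_derivative_compose)
  moreover have "dir_deriv (t *\<^sub>R v) f p = t *\<^sub>R dir_deriv v f p" for t
    using linear_frechet_derivative[OF assms] by (simp add: dir_deriv_def linear_cmul)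
  ultimately show ?thesis by (simp add: has_vector_derivative_def)
qed

lemma smooth_on_differentiable:
  assumes "smooth_on S f" "p \<in> S"
  shows "f differentiable (at p)"
  using assms by (auto simp: smooth_on_def dest: spec[of _ "[]"])

lemma smooth_on_dir_deriv_continuous:
  assumes "smooth_on S f" "b \<in> Basis"
  shows "continuous_on S (dir_deriv b f)"
proof (intro continuous_at_imp_continuous_on ballI)
  fix p assume "p \<in> S"
  then have "iter_deriv [b] f differentiable (at p)"
    using assms unfolding smooth_on_def by (metis empty_set insert_subset empty_subsetI list.simps(15))
  then show "isCont (dir_deriv b f) p"
    by (simp add: differentiable_imp_continuous_within)
qed

lemma smooth_on_continuous:
  "smooth_on S f \<Longrightarrow> continuous_on S f"
  by (intro continuous_at_imp_continuous_on ballI differentiable_imp_continuous_within smooth_on_differentiable)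

text \<open>The equality of iterated derivatives is available only on \<open>S\<close>; it survives
  a further derivative because \<open>S\<close> is open and derivatives are local.\<close>

lemma iter_deriv_cmult:
  fixes f :: "'a::euclidean_space \<Rightarrow> complex"
  assumes f: "smooth_on S f" and S: "open S" and "set vs \<subseteq> Basis" "p \<in> S"
  shows "iter_deriv vs (\<lambda>q. c * f q) p = c * iter_deriv vs f p"
    and "iter_deriv vs (\<lambda>q. c * f q) differentiable (at p)"
proof -
  have diff: "(\<lambda>q. c * iter_deriv vs f q) differentiable (at q)" if "set vs \<subseteq> Basis" "q \<in> S" for vs q
    using f that by (intro differentiable_mult) (auto simp: smooth_on_def)
  have *: "\<forall>q\<in>S. iter_deriv vs (\<lambda>q. c * f q) q = c * iter_deriv vs f q" if "set vs \<subseteq> Basis" for vs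
    using that
  proof (induction vs)
    case (Cons b vs)
    show ?case
    proof
      fix q assume q: "q \<in> S"
      have "dir_deriv b (iter_deriv vs (\<lambda>q. c * f q)) q = dir_deriv b (\<lambda>q. c * iter_deriv vs f q) q"
        using Cons q by (intro dir_deriv_cong(1)[OF diff S]) auto
      also have "\<dots> = c * dir_deriv b (iter_deriv vs f) q"
        using f Cons.prems q by (intro dir_deriv_cmult) (auto simp: smooth_on_def)
      finally show "iter_deriv (b # vs) (\<lambda>q. c * f q) q = c * iter_deriv (b # vs) f q" by simp
    qed
  qed simp
  from * assms show "iter_deriv vs (\<lambda>q. c * f q) p = c * iter_deriv vs f p" by blast
  show "iter_deriv vs (\<lambda>q. c * f q) differentiable (at p)"
    using assms * by (intro dir_deriv_cong(2)[OF diff[of vs] S]) auto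
qed

lemma smooth_on_cmult:
  fixes f :: "'a::euclidean_space \<Rightarrow> complex"
  shows "smooth_on S f \<Longrightarrow> open S \<Longrightarrow> smooth_on S (\<lambda>q. c * f q)"
  using iter_deriv_cmult(2) unfolding smooth_on_def[of S "\<lambda>q. c * f q"] by blast

lemma x_dir_Basis: "a \<in> Basis \<Longrightarrow> (a, 0) \<in> Basis" and xi_dir_Basis: "b \<in> Basis \<Longrightarrow> (0, b) \<in> Basis"
  by (auto simp: Basis_prod_def)

section \<open>Symbols, expansions and components under sums and scalar multiples\<close>

lemma symbols_bound:
  assumes "\<sigma> \<in> symbols U r" "compact K" "K \<subseteq> U" "set as \<subseteq> Basis" "set bs \<subseteq> Basis"
  obtains C where "\<And>x \<xi>. x \<in> K \<Longrightarrow>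
    norm (iter_deriv (map (\<lambda>a. (a, 0)) as @ map (\<lambda>b. (0, b)) bs) \<sigma> (x, \<xi>))
      \<le> C * (1 + norm \<xi>) powr (r - real (length bs))"
proof -
  have "\<exists>C. \<forall>x\<in>K. \<forall>\<xi>. norm (iter_deriv (map (\<lambda>a. (a, 0)) as @ map (\<lambda>b. (0, b)) bs) \<sigma> (x, \<xi>))
      \<le> C * (1 + norm \<xi>) powr (r - real (length bs))"
    using assms unfolding symbols_def mem_Collect_eq by (elim conjE allE impE) auto
  then obtain C where "\<forall>x\<in>K. \<forall>\<xi>. norm (iter_deriv (map (\<lambda>a. (a, 0)) as @ map (\<lambda>b. (0, b)) bs) \<sigma> (x, \<xi>))
      \<le> C * (1 + norm \<xi>) powr (r - real (length bs))" ..
  then show ?thesis by (intro that) blast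
qed

lemma symbols_cmult:
  assumes U: "open U" and \<sigma>: "\<sigma> \<in> symbols U r"
  shows "(\<lambda>p. c * \<sigma> p) \<in> symbols U r"
proof -
  have smooth: "smooth_on (U \<times> UNIV) \<sigma>" and op: "open (U \<times> (UNIV :: (real^'a) set))"
    using \<sigma> U by (auto simp: symbols_def open_Times)
  have "\<exists>C. \<forall>x\<in>K. \<forall>\<xi>. norm (iter_deriv (map (\<lambda>a. (a, 0)) as @ map (\<lambda>b. (0, b)) bs) (\<lambda>p. c * \<sigma> p) (x, \<xi>))
             \<le> C * (1 + norm \<xi>) powr (r - real (length bs))"
    if K: "compact K \<and> K \<subseteq> U \<and> set as \<subseteq> Basis \<and> set bs \<subseteq> Basis" for K as bs
  proof -
    let ?vs = "map (\<lambda>a. (a, 0)) as @ map (\<lambda>b. (0, b)) bs :: 'a cot list"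
    have vs: "set ?vs \<subseteq> Basis" using K by (auto intro: x_dir_Basis xi_dir_Basis)
    obtain C where C: "\<And>x \<xi>. x \<in> K \<Longrightarrow> norm (iter_deriv ?vs \<sigma> (x, \<xi>)) \<le> C * (1 + norm \<xi>) powr (r - real (length bs))"
      by (rule symbols_bound[OF \<sigma>, of K as bs]) (use K in auto)
    have "norm (iter_deriv ?vs (\<lambda>p. c * \<sigma> p) (x, \<xi>)) \<le> (norm c * C) * (1 + norm \<xi>) powr (r - real (length bs))"
      if x: "x \<in> K" for x \<xi>
    proof -
      have "(x, \<xi>) \<in> U \<times> UNIV" using x K by auto
      from iter_deriv_cmult(1)[OF smooth op vs this, of c] C[OF x, of \<xi>] show ?thesis
        by (simp add: norm_mult mult.assoc mult_left_mono)
    qed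
    then show ?thesis by blast
  qed
  then show ?thesis unfolding symbols_def mem_Collect_eq
    by (intro conjI allI impI smooth_on_cmult[OF smooth op])
qed

lemma pos_homogeneous_cmult:
  assumes "open U" "pos_homogeneous U d s"
  shows "pos_homogeneous U d (\<lambda>p. c * s p)"
  unfolding pos_homogeneous_def
proof (intro conjI)
  have "open (U \<times> (UNIV - {0 :: real ^ 'a}))" using assms(1) by (intro open_Times open_delete) auto
  with assms(2) show "smooth_on (U \<times> (UNIV - {0})) (\<lambda>p. c * s p)"
    by (intro smooth_on_cmult) (auto simp: pos_homogeneous_def)
qed (use assms(2) in \<open>auto simp: pos_homogeneous_def\<close>)

lemma classical_expansion_cmult:
  assumes U: "open U" and e: "classical_expansion U chi m \<sigma> s"
  shows "classical_expansion U chi m (\<lambda>p. c * \<sigma> p) (\<lambda>i p. c * s i p)"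
proof -
  have eq: "(\<lambda>p. c * \<sigma> p - (\<Sum>i\<le>N. chi p * (c * s i p))) = (\<lambda>p. c * (\<sigma> p - (\<Sum>i\<le>N. chi p * s i p)))" for N
    by (simp add: fun_eq_iff right_diff_distrib sum_distrib_left mult.left_commute)
  from e obtain r where "\<sigma> \<in> symbols U r" unfolding classical_expansion_def by blast
  then have "\<exists>r. (\<lambda>p. c * \<sigma> p) \<in> symbols U r" using symbols_cmult[OF U] by blast
  with e show ?thesis unfolding classical_expansion_def eq
    by (auto intro: symbols_cmult[OF U] pos_homogeneous_cmult[OF U])
qed

lemma is_hom_component_cmult:
  assumes U: "open U" and h: "is_hom_component U chi \<sigma> d h"
  shows "is_hom_component U chi (\<lambda>p. c * \<sigma> p) d (\<lambda>p. c * h p)"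
proof -
  from h obtain K :: nat and m f s where
    1: "\<And>k. k < K \<Longrightarrow> classical_expansion U chi (m k) (f k) (s k)" and
    2: "\<And>p. p \<in> U \<times> UNIV \<Longrightarrow> \<sigma> p = (\<Sum>k<K. f k p)" and
    3: "h = (\<lambda>p. if p \<in> U \<times> (UNIV - {0}) then \<Sum>k<K. \<Sum>i | m k - of_nat i = d. s k i p else 0)"
    unfolding is_hom_component_def by blast
  show ?thesis unfolding is_hom_component_def
  proof (rule exI[of _ K], rule exI[of _ m], rule exI[of _ "\<lambda>k p. c * f k p"],
      rule exI[of _ "\<lambda>k i p. c * s k i p"], intro conjI ballI allI impI)
    show "classical_expansion U chi (m k) (\<lambda>p. c * f k p) (\<lambda>i p. c * s k i p)" if "k < K" for k
      by (rule classical_expansion_cmult[OF U 1[OF that]])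
  qed (auto simp: 2 3 fun_eq_iff sum_distrib_left)
qed

lemma sum_lessThan_add:
  "sum f {..<a + b :: nat} = sum f {..<a} + (\<Sum>k<b. f (a + k))"
  by (induction b) (simp_all add: add.assoc)

text \<open>The two decompositions are concatenated; their orders may be unrelated, since a
  component is defined for sums of classical symbols of arbitrary orders.\<close>

lemma is_hom_component_add:
  assumes "is_hom_component U chi \<sigma> d h" "is_hom_component U chi \<tau> d g"
  shows "is_hom_component U chi (\<lambda>p. \<sigma> p + \<tau> p) d (\<lambda>p. h p + g p)"
proof -
  from assms(1) obtain K :: nat and m f s where
    1: "\<And>k. k < K \<Longrightarrow> classical_expansion U chi (m k) (f k) (s k)" and
    2: "\<And>p. p \<in> U \<times> UNIV \<Longrightarrow> \<sigma> p = (\<Sum>k<K. f k p)" and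
    3: "h = (\<lambda>p. if p \<in> U \<times> (UNIV - {0}) then \<Sum>k<K. \<Sum>i | m k - of_nat i = d. s k i p else 0)"
    unfolding is_hom_component_def by blast
  from assms(2) obtain K' :: nat and m' f' s' where
    b1: "\<And>k. k < K' \<Longrightarrow> classical_expansion U chi (m' k) (f' k) (s' k)" and
    b2: "\<And>p. p \<in> U \<times> UNIV \<Longrightarrow> \<tau> p = (\<Sum>k<K'. f' k p)" and
    b3: "g = (\<lambda>p. if p \<in> U \<times> (UNIV - {0}) then \<Sum>k<K'. \<Sum>i | m' k - of_nat i = d. s' k i p else 0)"
    unfolding is_hom_component_def by blast
  show ?thesis unfolding is_hom_component_def
  proof (rule exI[of _ "K + K'"], rule exI[of _ "\<lambda>k. if k < K then m k else m' (k - K)"],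
      rule exI[of _ "\<lambda>k. if k < K then f k else f' (k - K)"],
      rule exI[of _ "\<lambda>k. if k < K then s k else s' (k - K)"], intro conjI ballI allI impI)
    fix k assume "k < K + K'"
    then show "classical_expansion U chi (if k < K then m k else m' (k - K))
        (if k < K then f k else f' (k - K)) (if k < K then s k else s' (k - K))"
      using 1[of k] b1[of "k - K"] by auto
  qed (auto simp: 2 b2 3 b3 fun_eq_iff sum_lessThan_add)
qed

lemma compact_x_support_add:
  assumes "compact_x_support U \<sigma>" "compact_x_support U \<tau>"
  shows "compact_x_support U (\<lambda>p. \<sigma> p + \<tau> p)"
proof -
  from assms obtain K K' where "compact K" "K \<subseteq> U" "\<forall>x\<in>U - K. \<forall>\<xi>. \<sigma> (x, \<xi>) = 0"
    "compact K'" "K' \<subseteq> U" "\<forall>x\<in>U - K'. \<forall>\<xi>. \<tau> (x, \<xi>) = 0"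
    unfolding compact_x_support_def by blast
  then show ?thesis unfolding compact_x_support_def
    by (intro exI[of _ "K \<union> K'"]) auto
qed

lemma CS_com_order_is_hom_component:
  assumes "\<sigma> \<in> CS_com_order U chi m"
  obtains s where "is_hom_component U chi \<sigma> d
      (\<lambda>p. if p \<in> U \<times> (UNIV - {0}) then \<Sum>i | m - of_nat i = d. s i p else 0)"
    and "compact_x_support U \<sigma>"
proof -
  from assms obtain s where s: "classical_expansion U chi m \<sigma> s" and c: "compact_x_support U \<sigma>"
    unfolding CS_com_order_def CS_order_def by blast
  have "is_hom_component U chi \<sigma> d
      (\<lambda>p. if p \<in> U \<times> (UNIV - {0}) then \<Sum>i | m - of_nat i = d. s i p else 0)"
    unfolding is_hom_component_def
    by (rule exI[of _ 1], rule exI[of _ "\<lambda>_. m"], rule exI[of _ "\<lambda>_. \<sigma>"], rule exI[of _ "\<lambda>_. s"])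
       (simp add: s fun_eq_iff)
  then show ?thesis using c by (rule that)
qed

text \<open>The existence half for the description \<open>hom_component\<close>, by induction on the
  generation of forms.\<close>

lemma Omega_CS_com_is_hom_component:
  assumes U: "open U" and "\<alpha> \<in> Omega_CS_com U chi k" and "card I + card J = k"
  shows "compact_x_support U (\<alpha> I J) \<and> (\<exists>h. is_hom_component U chi (\<alpha> I J) d h)"
  using assms(2)
proof induction
  case (generator \<alpha> m)
  then have "\<alpha> I J \<in> CS_com_order U chi (m - of_nat (card J))"
    using assms(3) by (simp add: Omega_CS_com_order_def)
  from CS_com_order_is_hom_component[OF this, of d] show ?case by blast
next
  case (add \<alpha> \<beta>)
  then show ?case using is_hom_component_add compact_x_support_add by blast
next
  case (scale \<alpha> c)
  then have "compact_x_support U (\<lambda>p. c * \<alpha> I J p)"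
    unfolding compact_x_support_def by fastforce
  with scale show ?case using is_hom_component_cmult[OF U] by blast
qed

text \<open>Homogeneity is a relation in \<open>\<xi>\<close> with a factor independent of
  \<open>x\<close>, so it may be differentiated in \<open>x\<close> and the degree stays the
  same.\<close>

lemma pos_homogeneous_x_deriv:
  assumes U: "open U" and s: "pos_homogeneous U d s" and x: "x \<in> U" and \<xi>: "\<xi> \<noteq> 0" and t: "0 < t"
  shows "dir_deriv (v, 0) s (x, t *\<^sub>R \<xi>) = complex_of_real t powr d * dir_deriv (v, 0) s (x, \<xi>)"
proof -
  have diff: "s differentiable (at (x, \<zeta>))" if "\<zeta> \<noteq> 0" for \<zeta>
    using s x that by (intro smooth_on_differentiable[of "U \<times> (UNIV - {0})"]) (auto simp: pos_homogeneous_def)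
  have line: "((\<lambda>r. s (x + r *\<^sub>R v, \<zeta>)) has_vector_derivative dir_deriv (v, 0) s (x, \<zeta>)) (at 0)" if "\<zeta> \<noteq> 0" for \<zeta>
    using dir_deriv_line[OF diff[OF that], of "(v, 0)"] by simp
  have op: "open ((\<lambda>r::real. x + r *\<^sub>R v) -` U)"
    by (intro open_vimage U continuous_intros)
  have "((\<lambda>r. complex_of_real t powr d * s (x + r *\<^sub>R v, \<xi>)) has_vector_derivative complex_of_real t powr d * dir_deriv (v, 0) s (x, \<xi>)) (at 0)"
    by (intro has_vector_derivative_mult_right line \<xi>)
  then have "((\<lambda>r. s (x + r *\<^sub>R v, t *\<^sub>R \<xi>)) has_vector_derivative complex_of_real t powr d * dir_deriv (v, 0) s (x, \<xi>)) (at 0)"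
    by (rule has_vector_derivative_transform_within_open[OF _ op])
       (use s x \<xi> t in \<open>auto simp: pos_homogeneous_def\<close>)
  from vector_derivative_unique_at[OF line this] \<xi> t show ?thesis by simp
qed

lemma symbols_decay:
  fixes \<tau> :: "'n::finite cot \<Rightarrow> complex"
  assumes \<tau>: "\<tau> \<in> symbols U r" and r: "r \<le> - M" "0 \<le> M" and K: "compact K" "K \<subseteq> U" and "set as \<subseteq> Basis"
  shows "\<exists>C\<ge>0. \<forall>x\<in>K. \<forall>\<xi>. 1 \<le> norm \<xi> \<longrightarrow>
    norm (iter_deriv (map (\<lambda>a. (a, 0)) as) \<tau> (x, \<xi>)) \<le> C * norm \<xi> powr - M"
proof -
  obtain C where "\<And>x \<xi>. x \<in> K \<Longrightarrow> norm (iter_deriv (map (\<lambda>a. (a, 0)) as @ map (\<lambda>b. (0, b)) []) \<tau> (x, \<xi>))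
      \<le> C * (1 + norm \<xi>) powr (r - real (length ([] :: (real^'n) list)))"
    by (rule symbols_bound[OF \<tau> K, of as "[]"]) (use \<open>set as \<subseteq> Basis\<close> in auto)
  then have C: "\<And>x \<xi>. x \<in> K \<Longrightarrow> norm (iter_deriv (map (\<lambda>a. (a, 0)) as) \<tau> (x, \<xi>)) \<le> C * (1 + norm \<xi>) powr r"
    by auto
  have "norm (iter_deriv (map (\<lambda>a. (a, 0)) as) \<tau> (x, \<xi>)) \<le> \<bar>C\<bar> * norm \<xi> powr - M" if x: "x \<in> K" and \<xi>: "1 \<le> norm \<xi>" for x \<xi>
  proof -
    have "(1 + norm \<xi>) powr r \<le> (1 + norm \<xi>) powr - M" using r by (intro powr_mono) auto
    also have "\<dots> \<le> norm \<xi> powr - M" using r \<xi> by (intro powr_mono2') auto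
    finally have "\<bar>C\<bar> * (1 + norm \<xi>) powr r \<le> \<bar>C\<bar> * norm \<xi> powr - M" by (intro mult_left_mono) auto
    moreover have "C * (1 + norm \<xi>) powr r \<le> \<bar>C\<bar> * (1 + norm \<xi>) powr r" by (intro mult_right_mono) auto
    ultimately show ?thesis using C[OF x, of \<xi>] by linarith
  qed
  then show ?thesis by (intro exI[of _ "\<bar>C\<bar>"]) auto
qed

text \<open>A decay of order \<open>- n - 1\<close> suffices: it makes the remainder and its \<open>x\<close>-derivative integrable
  in \<open>\<xi>\<close>, and lies below the degree \<open>1 - n\<close> that matters on the cosphere bundle.\<close>

definition symbol_expansion ::
  "(real ^ 'n) set \<Rightarrow> ('n::finite cot \<Rightarrow> complex) \<Rightarrow> 'q set \<Rightarrow> ('q \<Rightarrow> complex) \<Rightarrow>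
     ('q \<Rightarrow> 'n cot \<Rightarrow> complex) \<Rightarrow> bool" where
  "symbol_expansion U \<sigma> Q d s \<longleftrightarrow> finite Q \<and>
     (\<forall>q\<in>Q. pos_homogeneous U (d q) (s q)) \<and>
     (\<forall>p\<in>U \<times> UNIV. \<sigma> differentiable (at p)) \<and>
     (\<forall>b\<in>Basis. continuous_on (U \<times> UNIV) (dir_deriv b \<sigma>)) \<and>
     (\<forall>K. compact K \<and> K \<subseteq> U \<longrightarrow> (\<exists>C\<ge>0. \<forall>x\<in>K. \<forall>\<xi>. 1 \<le> norm \<xi> \<longrightarrow>
        norm (\<sigma> (x, \<xi>) - (\<Sum>q\<in>Q. s q (x, \<xi>))) \<le> C * norm \<xi> powr - (real CARD('n) + 1))) \<and>
     (\<forall>K a. compact K \<and> K \<subseteq> U \<and> a \<in> Basis \<longrightarrow> (\<exists>C\<ge>0. \<forall>x\<in>K. \<forall>\<xi>. 1 < norm \<xi> \<longrightarrow>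
        norm (dir_deriv (a, 0) \<sigma> (x, \<xi>) - (\<Sum>q\<in>Q. dir_deriv (a, 0) (s q) (x, \<xi>)))
          \<le> C * norm \<xi> powr - (real CARD('n) + 1)))"

text \<open>All classical pieces are truncated at one common \<open>N\<close>, and their terms are
  indexed by pairs of a piece and a position. \<open>N\<close> is large enough both for the required
  decay of the remainders and to keep every term of degree \<open>1 - n\<close>.\<close>

lemma is_hom_component_expansion:
  fixes \<sigma> :: "'n::finite cot \<Rightarrow> complex"
  assumes U: "open U" and chi: "cutoff_function U chi"
    and h: "is_hom_component U chi \<sigma> (1 - of_nat CARD('n)) h"
  obtains Q :: "(nat \<times> nat) set" and d s where "symbol_expansion U \<sigma> Q d s"
    and "h = (\<lambda>p. if p \<in> U \<times> (UNIV - {0}) then \<Sum>q | q \<in> Q \<and> d q = 1 - of_nat CARD('n). s q p else 0)"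
proof -
  let ?n = "CARD('n)"
  let ?M = "real ?n + 1"
  from h obtain K :: nat and m f s where
    ce: "\<And>k. k < K \<Longrightarrow> classical_expansion U chi (m k) (f k) (s k)" and
    \<sigma>: "\<And>p. p \<in> U \<times> UNIV \<Longrightarrow> \<sigma> p = (\<Sum>k<K. f k p)" and
    h: "h = (\<lambda>p. if p \<in> U \<times> (UNIV - {0}) then \<Sum>k<K. \<Sum>i | m k - of_nat i = 1 - of_nat ?n. s k i p else 0)"
    unfolding is_hom_component_def by blast
  \<comment> \<open>Makes every remainder order \<open>Re (m k) - N - 1\<close> at most
    \<open>- n - 1\<close>. The sum of absolute values is just a bound common to all
    \<open>k\<close>, and \<open>Suc\<close> ensures \<open>1 \<le> N\<close>, which the definition
    of an expansion asks for.\<close>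
  obtain N0 :: nat where N0: "(\<Sum>k<K. \<bar>Re (m k) + real ?n\<bar>) \<le> real N0" using real_arch_simple by blast
  define N where "N = Suc N0"
  have N: "Re (m k) + real ?n \<le> real N" if "k < K" for k
  proof -
    have "\<bar>Re (m k) + real ?n\<bar> \<le> (\<Sum>k<K. \<bar>Re (m k) + real ?n\<bar>)"
      by (rule member_le_sum) (use that in auto)
    with N0 show ?thesis by (simp add: N_def)
  qed
  define \<rho> where "\<rho> k p = f k p - (\<Sum>i\<le>N. chi p * s k i p)" for k p
  define Q where "Q = {..<K} \<times> {..N}"
  define d where "d q = m (fst q) - of_nat (snd q)" for q :: "nat \<times> nat"
  define t where "t q = s (fst q) (snd q)" for q :: "nat \<times> nat"
  have Q: "finite Q" by (simp add: Q_def)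
  have f: "\<exists>r. f k \<in> symbols U r" if "k < K" for k
    using ce[OF that] by (simp add: classical_expansion_def)
  have \<rho>: "\<rho> k \<in> symbols U (Re (m k) - real N - 1)" if "k < K" for k
  proof -
    have "1 \<le> N" by (simp add: N_def)
    then show ?thesis using ce[OF that] unfolding classical_expansion_def \<rho>_def by blast
  qed
  have hom: "pos_homogeneous U (d q) (t q)" if "q \<in> Q" for q
    using ce[of "fst q"] that by (auto simp: classical_expansion_def d_def t_def Q_def)
  have opU: "open (U \<times> (UNIV :: (real^'n) set))" using U by (simp add: open_Times)
  have f_diff: "f k differentiable (at p)" if "k < K" "p \<in> U \<times> UNIV" for k p
    using f[OF that(1)] that(2) smooth_on_differentiable by (auto simp: symbols_def)
  have \<rho>_diff: "\<rho> k differentiable (at p)" if "k < K" "p \<in> U \<times> UNIV" for k p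
    using \<rho>[OF that(1)] that(2) smooth_on_differentiable by (auto simp: symbols_def)
  have t_diff: "t q differentiable (at p)" if "q \<in> Q" "p \<in> U \<times> (UNIV - {0})" for q p
    using hom[OF that(1)] that(2) smooth_on_differentiable by (auto simp: pos_homogeneous_def)
  have split: "\<sigma> (x, \<xi>) = (\<Sum>k<K. \<rho> k (x, \<xi>)) + (\<Sum>q\<in>Q. t q (x, \<xi>))" if "x \<in> U" "1 \<le> norm \<xi>" for x \<xi>
  proof -
    have "chi (x, \<xi>) = 1" using chi that by (auto simp: cutoff_function_def)
    then have "f k (x, \<xi>) = \<rho> k (x, \<xi>) + (\<Sum>i\<le>N. s k i (x, \<xi>))" for k by (simp add: \<rho>_def)
    then have "\<sigma> (x, \<xi>) = (\<Sum>k<K. \<rho> k (x, \<xi>)) + (\<Sum>k<K. \<Sum>i\<le>N. s k i (x, \<xi>))"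
      using that by (simp add: \<sigma> sum.distrib)
    also have "(\<Sum>k<K. \<Sum>i\<le>N. s k i (x, \<xi>)) = (\<Sum>q\<in>Q. t q (x, \<xi>))"
      by (simp add: Q_def t_def sum.cartesian_product case_prod_beta')
    finally show ?thesis .
  qed
  have decay: "\<exists>C\<ge>0. \<forall>x\<in>V. \<forall>\<xi>. 1 \<le> norm \<xi> \<longrightarrow>
      norm (\<Sum>k<K. iter_deriv (map (\<lambda>a. (a, 0)) as) (\<rho> k) (x, \<xi>)) \<le> C * norm \<xi> powr - ?M"
    if V: "compact V" "V \<subseteq> U" "set as \<subseteq> Basis" for V and as :: "(real^'n) list"
  proof -
    have "\<exists>C. C \<ge> 0 \<and> (\<forall>x\<in>V. \<forall>\<xi>. 1 \<le> norm \<xi> \<longrightarrow>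
      norm (iter_deriv (map (\<lambda>a. (a, 0)) as) (\<rho> k) (x, \<xi>)) \<le> C * norm \<xi> powr - ?M)" if "k < K" for k
      using symbols_decay[OF \<rho>[OF that], of ?M V as] N[OF that] V by auto
    then obtain C where C: "\<And>k. k < K \<Longrightarrow> C k \<ge> 0" "\<And>k x \<xi>. k < K \<Longrightarrow> x \<in> V \<Longrightarrow> 1 \<le> norm \<xi> \<Longrightarrow>
      norm (iter_deriv (map (\<lambda>a. (a, 0)) as) (\<rho> k) (x, \<xi>)) \<le> C k * norm \<xi> powr - ?M"
      by metis
    have "norm (\<Sum>k<K. iter_deriv (map (\<lambda>a. (a, 0)) as) (\<rho> k) (x, \<xi>)) \<le> (\<Sum>k<K. C k) * norm \<xi> powr - ?M"
      if "x \<in> V" "1 \<le> norm \<xi>" for x \<xi>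
      unfolding sum_distrib_right using C(2)[OF _ that] by (intro sum_norm_le) auto
    moreover have "0 \<le> (\<Sum>k<K. C k)" using C(1) by (intro sum_nonneg) auto
    ultimately show ?thesis by blast
  qed
  have sumf_diff: "(\<lambda>p. \<Sum>k<K. f k p) differentiable (at p)" if "p \<in> U \<times> UNIV" for p
    using f_diff that by (intro differentiable_sum_family) auto
  have \<sigma>_diff: "\<sigma> differentiable (at p)" "dir_deriv v \<sigma> p = (\<Sum>k<K. dir_deriv v (f k) p)"
    if p: "p \<in> U \<times> UNIV" for p v
  proof -
    note c = dir_deriv_cong[OF sumf_diff[OF p] opU p \<sigma>[symmetric]]
    show "\<sigma> differentiable (at p)" by (rule c(2))
    have "dir_deriv v (\<lambda>p. \<Sum>k<K. f k p) p = (\<Sum>k<K. dir_deriv v (f k) p)"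
      using f_diff p by (intro dir_deriv_sum) auto
    with c(1)[of v] show "dir_deriv v \<sigma> p = (\<Sum>k<K. dir_deriv v (f k) p)" by simp
  qed
  have expansion: "symbol_expansion U \<sigma> Q d t"
    unfolding symbol_expansion_def
  proof (intro conjI ballI allI impI)
    show "finite Q" by (rule Q)
    show "pos_homogeneous U (d q) (t q)" if "q \<in> Q" for q by (rule hom[OF that])
    show "\<sigma> differentiable (at p)" if "p \<in> U \<times> UNIV" for p by (rule \<sigma>_diff[OF that])
    show "continuous_on (U \<times> UNIV) (dir_deriv b \<sigma>)" if "b \<in> Basis" for b
    proof -
      have "continuous_on (U \<times> UNIV) (dir_deriv b (f k))" if "k < K" for k
        using f[OF that] smooth_on_dir_deriv_continuous[OF _ \<open>b \<in> Basis\<close>] by (auto simp: symbols_def)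
      then have "continuous_on (U \<times> UNIV) (\<lambda>p. \<Sum>k<K. dir_deriv b (f k) p)"
        by (intro continuous_on_sum) auto
      then show ?thesis by (simp add: \<sigma>_diff(2) cong: continuous_on_cong)
    qed
    fix V assume V: "compact V \<and> V \<subseteq> U"
    then obtain C where C: "0 \<le> C" "\<And>x \<xi>. x \<in> V \<Longrightarrow> 1 \<le> norm \<xi> \<Longrightarrow> norm (\<Sum>k<K. \<rho> k (x, \<xi>)) \<le> C * norm \<xi> powr - ?M"
      using decay[of V "[]"] by auto
    then show "\<exists>C\<ge>0. \<forall>x\<in>V. \<forall>\<xi>. 1 \<le> norm \<xi> \<longrightarrow>
        norm (\<sigma> (x, \<xi>) - (\<Sum>q\<in>Q. t q (x, \<xi>))) \<le> C * norm \<xi> powr - ?M"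
      using V split by (intro exI[of _ C]) (auto simp: subset_eq)
  next
    fix V :: "(real^'n) set" and a :: "real^'n" assume V: "compact V \<and> V \<subseteq> U \<and> a \<in> Basis"
    then obtain C where C: "0 \<le> C" "\<And>x \<xi>. x \<in> V \<Longrightarrow> 1 \<le> norm \<xi> \<Longrightarrow>
        norm (\<Sum>k<K. dir_deriv (a, 0) (\<rho> k) (x, \<xi>)) \<le> C * norm \<xi> powr - ?M"
      using decay[of V "[a]"] by auto
    have "dir_deriv (a, 0) \<sigma> (x, \<xi>) - (\<Sum>q\<in>Q. dir_deriv (a, 0) (t q) (x, \<xi>))
        = (\<Sum>k<K. dir_deriv (a, 0) (\<rho> k) (x, \<xi>))" if x: "x \<in> V" and \<xi>: "1 < norm \<xi>" for x \<xi>
    proof -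
      \<comment> \<open>The identity \<open>split\<close> holds where \<open>chi\<close> is 1, on
        \<open>1 \<le> norm \<xi>\<close>. To differentiate it an open set is needed, hence the
        strict inequality in the bound on derivatives.\<close>
      let ?W = "U \<times> {\<xi> :: real^'n. 1 < norm \<xi>}"
      have "open {\<xi> :: real^'n. 1 < norm \<xi>}" by (intro open_Collect_less continuous_intros)
      then have W: "open ?W" using U by (intro open_Times)
      have p: "(x, \<xi>) \<in> ?W" using x \<xi> V by auto
      have \<xi>0: "\<xi> \<noteq> 0" using \<xi> by auto
      have d1: "(\<lambda>p. \<Sum>k<K. \<rho> k p) differentiable (at (x, \<xi>))"
        using \<rho>_diff p by (intro differentiable_sum_family) auto
      have d2: "(\<lambda>p. \<Sum>q\<in>Q. t q p) differentiable (at (x, \<xi>))"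
        using t_diff p \<xi>0 by (intro differentiable_sum_family) auto
      have "dir_deriv (a, 0) \<sigma> (x, \<xi>) = dir_deriv (a, 0) (\<lambda>p. (\<Sum>k<K. \<rho> k p) + (\<Sum>q\<in>Q. t q p)) (x, \<xi>)"
        by (rule dir_deriv_cong(1)[OF differentiable_add[OF d1 d2] W p]) (use split in auto)
      also have "\<dots> = (\<Sum>k<K. dir_deriv (a, 0) (\<rho> k) (x, \<xi>)) + (\<Sum>q\<in>Q. dir_deriv (a, 0) (t q) (x, \<xi>))"
        unfolding dir_deriv_add[OF d1 d2] using \<rho>_diff t_diff p \<xi>0
        by (intro arg_cong2[where f = "(+)"] dir_deriv_sum) auto
      finally show ?thesis by simp
    qed
    with C show "\<exists>C\<ge>0. \<forall>x\<in>V. \<forall>\<xi>. 1 < norm \<xi> \<longrightarrow>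
        norm (dir_deriv (a, 0) \<sigma> (x, \<xi>) - (\<Sum>q\<in>Q. dir_deriv (a, 0) (t q) (x, \<xi>))) \<le> C * norm \<xi> powr - ?M"
      by (intro exI[of _ C]) auto
  qed
  have hs: "(\<Sum>k<K. \<Sum>i | m k - of_nat i = 1 - of_nat ?n. s k i p)
      = (\<Sum>q | q \<in> Q \<and> d q = 1 - of_nat ?n. t q p)" for p
  proof -
    \<comment> \<open>Degree \<open>1 - n\<close> forces \<open>i = Re (m k) + n - 1\<close>, so the
      truncation at \<open>N\<close> loses no such term.\<close>
    have le: "i \<le> N" if "k < K" "m k - of_nat i = 1 - of_nat ?n" for k i
    proof -
      have "Re (m k - of_nat i) = Re (1 - of_nat ?n)" using that(2) by simp
      then have "real i = Re (m k) + real ?n - 1" by simp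
      with N[OF that(1)] have "real i \<le> real N" by linarith
      then show ?thesis by simp
    qed
    have "{q. q \<in> Q \<and> d q = 1 - of_nat ?n} = Sigma {..<K} (\<lambda>k. {i. m k - of_nat i = 1 - of_nat ?n})"
      using le by (auto simp: Q_def d_def)
    moreover have "finite {i. m k - of_nat i = 1 - of_nat ?n}" if "k < K" for k
      by (rule finite_subset[of _ "{..N}"]) (use le[OF that] in auto)
    ultimately show ?thesis by (subst sum.Sigma) (auto simp: t_def case_prod_beta')
  qed
  have "h = (\<lambda>p. if p \<in> U \<times> (UNIV - {0}) then \<Sum>q | q \<in> Q \<and> d q = 1 - of_nat ?n. t q p else 0)"
    unfolding h hs ..
  with expansion show ?thesis by (rule that)
qed

section \<open>Finite parts of integrated derivatives\<close>

lemma symbol_expansionD: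
  fixes \<sigma> :: "'n::finite cot \<Rightarrow> complex"
  assumes "symbol_expansion U \<sigma> Q d s"
  shows "finite Q" and "\<And>q. q \<in> Q \<Longrightarrow> pos_homogeneous U (d q) (s q)"
    and "\<And>p. p \<in> U \<times> UNIV \<Longrightarrow> \<sigma> differentiable (at p)"
    and "\<And>b. b \<in> Basis \<Longrightarrow> continuous_on (U \<times> UNIV) (dir_deriv b \<sigma>)"
    and "continuous_on (U \<times> UNIV) \<sigma>"
  using assms unfolding symbol_expansion_def
  by (auto intro!: continuous_at_imp_continuous_on differentiable_imp_continuous_within)

lemma symbol_expansion_bound:
  fixes \<sigma> :: "'n::finite cot \<Rightarrow> complex"
  assumes "symbol_expansion U \<sigma> Q d s" "compact K" "K \<subseteq> U"
  obtains C where "0 \<le> C" "\<And>x \<xi>. x \<in> K \<Longrightarrow> 1 \<le> norm \<xi> \<Longrightarrow>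
    norm (\<sigma> (x, \<xi>) - (\<Sum>q\<in>Q. s q (x, \<xi>))) \<le> C * norm \<xi> powr - (real CARD('n) + 1)"
proof -
  have "\<exists>C\<ge>0. \<forall>x\<in>K. \<forall>\<xi>. 1 \<le> norm \<xi> \<longrightarrow>
      norm (\<sigma> (x, \<xi>) - (\<Sum>q\<in>Q. s q (x, \<xi>))) \<le> C * norm \<xi> powr - (real CARD('n) + 1)"
    using assms unfolding symbol_expansion_def by simp
  then show ?thesis using that by blast
qed

lemma symbol_expansion_x_deriv_bound:
  fixes \<sigma> :: "'n::finite cot \<Rightarrow> complex"
  assumes "symbol_expansion U \<sigma> Q d s" "compact K" "K \<subseteq> U" "a \<in> Basis"
  obtains C where "0 \<le> C" "\<And>x \<xi>. x \<in> K \<Longrightarrow> 1 < norm \<xi> \<Longrightarrow>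
    norm (dir_deriv (a, 0) \<sigma> (x, \<xi>) - (\<Sum>q\<in>Q. dir_deriv (a, 0) (s q) (x, \<xi>)))
      \<le> C * norm \<xi> powr - (real CARD('n) + 1)"
proof -
  have "\<exists>C\<ge>0. \<forall>x\<in>K. \<forall>\<xi>. 1 < norm \<xi> \<longrightarrow>
      norm (dir_deriv (a, 0) \<sigma> (x, \<xi>) - (\<Sum>q\<in>Q. dir_deriv (a, 0) (s q) (x, \<xi>)))
        \<le> C * norm \<xi> powr - (real CARD('n) + 1)"
    using assms unfolding symbol_expansion_def by simp
  then show ?thesis using that by blast
qed

section \<open>The component of degree \<open>1 - n\<close> as a finite part\<close>

lemma pos_homogeneous_continuous:
  "pos_homogeneous U d s \<Longrightarrow> continuous_on (U \<times> (UNIV - {0})) s"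
  by (simp add: pos_homogeneous_def smooth_on_continuous)

lemma pos_homogeneousD:
  "pos_homogeneous U d s \<Longrightarrow> x \<in> U \<Longrightarrow> \<xi> \<noteq> 0 \<Longrightarrow> 0 < t \<Longrightarrow>
    s (x, t *\<^sub>R \<xi>) = complex_of_real t powr d * s (x, \<xi>)"
  by (simp add: pos_homogeneous_def)

lemma continuous_on_slice:
  assumes "continuous_on (U \<times> S) f" "x \<in> U"
  shows "continuous_on S (\<lambda>\<xi>. f (x, \<xi>))"
  by (rule continuous_on_compose2[OF assms(1)]) (use assms(2) in \<open>auto intro!: continuous_intros\<close>)

lemma tendsto_0_inverse_square:
  fixes F :: "real \<Rightarrow> 'a::real_normed_vector"
  assumes "\<forall>\<^sub>F R in at_top. norm (F R) \<le> C * R powr - 2"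
  shows "(F \<longlongrightarrow> 0) at_top"
proof (rule Lim_null_comparison[OF assms])
  have "((\<lambda>R::real. R powr - 2) \<longlongrightarrow> 0) at_top"
    by (rule tendsto_neg_powr) (auto simp: filterlim_ident)
  then show "((\<lambda>R. C * R powr - 2) \<longlongrightarrow> 0) at_top"
    by (rule tendsto_mult_right_zero)
qed

text \<open>Along the ray through \<open>\<xi>\<close>, the factor \<open>t powr (n - 1)\<close>
  shifts degree \<open>1 - n\<close> to exponent 0. The component is thus expressed through
  \<open>\<sigma>\<close> alone.\<close>

lemma homogeneous_part_finite_part:
  fixes \<sigma> :: "'n::finite cot \<Rightarrow> complex"
  assumes e: "symbol_expansion U \<sigma> Q d s" and x: "x \<in> U" and \<xi>: "\<xi> \<noteq> 0"
  shows "has_finite_part (\<lambda>t. complex_of_real t powr (of_nat CARD('n) - 1) * \<sigma> (x, t *\<^sub>R \<xi>))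
    (\<Sum>q | q \<in> Q \<and> d q = 1 - of_nat CARD('n). s q (x, \<xi>))"
proof -
  let ?n = "CARD('n)"
  define w where "w q = d q + of_nat ?n - 1" for q
  let ?F = "\<lambda>t. complex_of_real t powr (of_nat ?n - 1) * \<sigma> (x, t *\<^sub>R \<xi>)"
  let ?G = "\<lambda>t. ?F t - ((\<Sum>q\<in>Q. s q (x, \<xi>) * complex_of_real t powr w q) + 0 * complex_of_real (ln t) + 0)"
  obtain C where C: "0 \<le> C" "\<And>y \<xi>. y \<in> {x} \<Longrightarrow> 1 \<le> norm \<xi> \<Longrightarrow>
    norm (\<sigma> (y, \<xi>) - (\<Sum>q\<in>Q. s q (y, \<xi>))) \<le> C * norm \<xi> powr - (real ?n + 1)"
    by (rule symbol_expansion_bound[OF e, of "{x}"]) (use x in auto)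
  have "norm (?G t) \<le> (C * norm \<xi> powr - (real ?n + 1)) * t powr - 2" if t: "1 < t" "1 / norm \<xi> < t" for t
  proof -
    have "1 \<le> norm (t *\<^sub>R \<xi>)" using t \<xi> by (simp add: divide_less_eq)
    then have b: "norm (\<sigma> (x, t *\<^sub>R \<xi>) - (\<Sum>q\<in>Q. s q (x, t *\<^sub>R \<xi>))) \<le> C * norm (t *\<^sub>R \<xi>) powr - (real ?n + 1)"
      using C(2)[of x "t *\<^sub>R \<xi>"] by simp
    have "(\<Sum>q\<in>Q. s q (x, \<xi>) * complex_of_real t powr w q)
       = complex_of_real t powr (of_nat ?n - 1) * (\<Sum>q\<in>Q. s q (x, t *\<^sub>R \<xi>))"
      unfolding sum_distrib_left
    proof (rule sum.cong[OF refl])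
      fix q assume q: "q \<in> Q"
      have "complex_of_real t powr w q = complex_of_real t powr (of_nat ?n - 1) * complex_of_real t powr d q"
        by (simp add: w_def powr_add[symmetric] algebra_simps)
      then show "s q (x, \<xi>) * complex_of_real t powr w q = complex_of_real t powr (of_nat ?n - 1) * s q (x, t *\<^sub>R \<xi>)"
        using pos_homogeneousD[OF symbol_expansionD(2)[OF e q] x \<xi>, of t] t by simp
    qed
    then have "?G t = complex_of_real t powr (of_nat ?n - 1) * (\<sigma> (x, t *\<^sub>R \<xi>) - (\<Sum>q\<in>Q. s q (x, t *\<^sub>R \<xi>)))"
      by (simp add: right_diff_distrib)
    then have "norm (?G t) = t powr (real ?n - 1) * norm (\<sigma> (x, t *\<^sub>R \<xi>) - (\<Sum>q\<in>Q. s q (x, t *\<^sub>R \<xi>)))"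
      using t by (simp add: norm_mult norm_powr_real_powr)
    also have "\<dots> \<le> t powr (real ?n - 1) * (C * norm (t *\<^sub>R \<xi>) powr - (real ?n + 1))"
      using b by (intro mult_left_mono) auto
    also have "\<dots> = (C * norm \<xi> powr - (real ?n + 1)) * (t powr (real ?n - 1) * t powr - (real ?n + 1))"
      using t by (simp add: powr_mult)
    also have "t powr (real ?n - 1) * t powr - (real ?n + 1) = t powr - 2"
      by (simp add: powr_add[symmetric])
    finally show ?thesis .
  qed
  then have "(?G \<longlongrightarrow> 0) at_top"
    by (intro tendsto_0_inverse_square eventually_mono[OF eventually_gt_at_top[of "max 1 (1 / norm \<xi>)"]]) auto
  from has_finite_part_family[OF symbol_expansionD(1)[OF e] this]
  have "has_finite_part ?F (0 + (\<Sum>q | q \<in> Q \<and> w q = 0. s q (x, \<xi>)))" .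
  moreover have "w q = 0 \<longleftrightarrow> d q = 1 - of_nat ?n" for q
    unfolding w_def by (auto simp: algebra_simps)
  ultimately show ?thesis by simp
qed

text \<open>Two decompositions give finite parts of the same function of \<open>t\<close>, so the
  components agree where they are meaningful; elsewhere both are 0 by definition.\<close>

lemma hom_component_eq:
  fixes \<sigma> :: "'n::finite cot \<Rightarrow> complex"
  assumes U: "open U" and chi: "cutoff_function U chi"
    and h: "is_hom_component U chi \<sigma> (1 - of_nat CARD('n)) h"
  shows "hom_component U chi \<sigma> (1 - of_nat CARD('n)) = h"
  unfolding hom_component_def
proof (rule the_equality[where P = "is_hom_component U chi \<sigma> (1 - of_nat CARD('n))", OF h])
  fix g assume g: "is_hom_component U chi \<sigma> (1 - of_nat CARD('n)) g"
  obtain Q :: "(nat \<times> nat) set" and d s where 1: "symbol_expansion U \<sigma> Q d s"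
    "h = (\<lambda>p. if p \<in> U \<times> (UNIV - {0}) then \<Sum>q | q \<in> Q \<and> d q = 1 - of_nat CARD('n). s q p else 0)"
    by (rule is_hom_component_expansion[OF U chi h])
  obtain Q' :: "(nat \<times> nat) set" and d' s' where 2: "symbol_expansion U \<sigma> Q' d' s'"
    "g = (\<lambda>p. if p \<in> U \<times> (UNIV - {0}) then \<Sum>q | q \<in> Q' \<and> d' q = 1 - of_nat CARD('n). s' q p else 0)"
    by (rule is_hom_component_expansion[OF U chi g])
  show "g = h"
  proof
    fix p :: "'n cot"
    show "g p = h p"
    proof (cases "p \<in> U \<times> (UNIV - {0})")
      case True
      then obtain x \<xi> where p: "p = (x, \<xi>)" "x \<in> U" "\<xi> \<noteq> 0" by auto
      from has_finite_part_unique[OF homogeneous_part_finite_part[OF 2(1) p(2,3)]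
          homogeneous_part_finite_part[OF 1(1) p(2,3)]]
      show ?thesis using True p(1) by (simp add: 1(2) 2(2))
    next
      case False
      then show ?thesis by (auto simp: 1(2) 2(2))
    qed
  qed
qed

text \<open>Where \<open>\<sigma>\<close> vanishes on a fibre, the single terms \<open>s q\<close>
  of several pieces may still cancel each other; their total in degree \<open>1 - n\<close> is 0, as
  a finite part of the zero function.\<close>

lemma homogeneous_part_eq_0:
  fixes \<sigma> :: "'n::finite cot \<Rightarrow> complex"
  assumes e: "symbol_expansion U \<sigma> Q d s" and x: "x \<in> U" and \<xi>: "\<xi> \<noteq> 0" and 0: "\<And>\<xi>. \<sigma> (x, \<xi>) = 0"
  shows "(\<Sum>q | q \<in> Q \<and> d q = 1 - of_nat CARD('n). s q (x, \<xi>)) = 0"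
  using homogeneous_part_finite_part[OF e x \<xi>] has_finite_part_unique[OF _ has_finite_part_0]
  by (simp add: 0)

section \<open>Sphere integrals of expansions and the finite parts of
  \<open>\<xi>\<close>-derivatives\<close>

lemma sphere_integral_sum_le:
  fixes G :: "real ^ 'n::finite \<Rightarrow> complex"
  assumes Q: "finite Q" and G: "continuous_on (sphere 0 1) G"
    and t: "\<And>q. q \<in> Q \<Longrightarrow> continuous_on (sphere 0 1) (t q)"
    and B: "\<And>\<omega>. norm \<omega> = 1 \<Longrightarrow> norm (G \<omega> - (\<Sum>q\<in>Q. \<kappa> q * t q \<omega>)) \<le> B" "0 \<le> B"
  shows "norm ((LINT \<omega>:sphere 0 1|sphere_measure. G \<omega>) - (\<Sum>q\<in>Q. \<kappa> q * (LINT \<omega>:sphere 0 1|sphere_measure. t q \<omega>)))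
    \<le> B * measure (sphere_measure :: (real ^ 'n) measure) UNIV"
proof -
  let ?S = "sphere 0 1 :: (real^'n) set"
  note int = set_integrable_sphere[unfolded set_integrable_def]
  have it: "integrable sphere_measure (\<lambda>\<omega>. \<kappa> q * (indicator ?S \<omega> *\<^sub>R t q \<omega>))" if "q \<in> Q" for q
    by (intro integrable_mult_right int t that)
  have "(LINT \<omega>:?S|sphere_measure. G \<omega> - (\<Sum>q\<in>Q. \<kappa> q * t q \<omega>))
      = (\<integral>\<omega>. indicator ?S \<omega> *\<^sub>R G \<omega> - (\<Sum>q\<in>Q. \<kappa> q * (indicator ?S \<omega> *\<^sub>R t q \<omega>)) \<partial>sphere_measure)"
    unfolding set_lebesgue_integral_def
    by (intro Bochner_Integration.integral_cong) (simp_all add: scaleR_diff_right scaleR_sum_right)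
  also have "\<dots> = (LINT \<omega>:?S|sphere_measure. G \<omega>) - (\<Sum>q\<in>Q. \<kappa> q * (LINT \<omega>:?S|sphere_measure. t q \<omega>))"
    unfolding set_lebesgue_integral_def
    by (simp only: Bochner_Integration.integral_diff[OF int[OF G] Bochner_Integration.integrable_sum[OF it]]
        Bochner_Integration.integral_sum[OF it] integral_mult_right_zero)
  finally have eq: "(LINT \<omega>:?S|sphere_measure. G \<omega> - (\<Sum>q\<in>Q. \<kappa> q * t q \<omega>))
    = (LINT \<omega>:?S|sphere_measure. G \<omega>) - (\<Sum>q\<in>Q. \<kappa> q * (LINT \<omega>:?S|sphere_measure. t q \<omega>))" .
  have "continuous_on ?S (\<lambda>\<omega>. G \<omega> - (\<Sum>q\<in>Q. \<kappa> q * t q \<omega>))"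
    by (intro continuous_intros G t)
  then have "norm (LINT \<omega>:?S|sphere_measure. G \<omega> - (\<Sum>q\<in>Q. \<kappa> q * t q \<omega>)) \<le> B * measure (sphere_measure :: (real^'n) measure) UNIV"
    by (intro sphere_integral_norm_le set_integrable_sphere) (use B in auto)
  then show ?thesis unfolding eq .
qed

lemma xi_deriv_finite_part:
  fixes \<sigma> :: "'n::finite cot \<Rightarrow> complex"
  assumes ex: "symbol_expansion U \<sigma> Q d s" and x: "x \<in> U" and e: "e \<in> Basis"
  shows "has_finite_part (\<lambda>R. LINT \<xi>:cball 0 R|lborel. dir_deriv (0, e) \<sigma> (x, \<xi>))
    (LINT \<omega>:sphere 0 1|sphere_measure. (\<omega> \<bullet> e) *\<^sub>R (\<Sum>q | q \<in> Q \<and> d q = 1 - of_nat CARD('n). s q (x, \<omega>)))"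
proof -
  let ?n = "CARD('n)"
  let ?A = "measure (sphere_measure :: (real^'n) measure) UNIV"
  define w where "w q = d q + of_nat ?n - 1" for q
  define a where "a q = (LINT \<omega>:sphere 0 1|sphere_measure. (\<omega> \<bullet> e) *\<^sub>R s q (x, \<omega>))" for q
  let ?F = "\<lambda>R. LINT \<xi>:cball 0 R|lborel. dir_deriv (0, e) \<sigma> (x, \<xi>)"
  \<comment> \<open>The coefficient of the logarithm is 0: by the divergence theorem the ball
    integral is a boundary integral, hence a sum of pure powers up to an error of order
    \<open>R powr - 2\<close>.\<close>
  let ?G = "\<lambda>R. ?F R - ((\<Sum>q\<in>Q. a q * complex_of_real R powr w q) + 0 * complex_of_real (ln R) + 0)"
  have Q: "finite Q" by (rule symbol_expansionD[OF ex])
  have norm_e: "norm e = 1" using e by simp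
  have cont: "continuous_on UNIV (\<lambda>\<xi>. \<sigma> (x, \<xi>))" "continuous_on UNIV (\<lambda>\<xi>. dir_deriv (0, e) \<sigma> (x, \<xi>))"
    using continuous_on_slice[OF symbol_expansionD(5)[OF ex] x]
      continuous_on_slice[OF symbol_expansionD(4)[OF ex xi_dir_Basis[OF e]] x] .
  have scont: "continuous_on (sphere 0 1) (\<lambda>\<omega>. s q (x, \<omega>))" if "q \<in> Q" for q
    by (rule continuous_on_subset[OF continuous_on_slice[OF pos_homogeneous_continuous[OF symbol_expansionD(2)[OF ex that]] x]]) auto
  have F: "?F R = R ^ (?n - 1) *\<^sub>R (LINT \<omega>:sphere 0 1|sphere_measure. (\<omega> \<bullet> e) *\<^sub>R \<sigma> (x, R *\<^sub>R \<omega>))" if "0 < R" for R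
  proof (rule divergence_theorem_cball[OF _ cont that])
    fix y
    have "\<sigma> differentiable (at (x, y))" using symbol_expansionD(3)[OF ex] x by auto
    from dir_deriv_line[OF this, of "(0, e)"]
    show "((\<lambda>t. \<sigma> (x, y + t *\<^sub>R e)) has_vector_derivative dir_deriv (0, e) \<sigma> (x, y)) (at 0)" by simp
  qed
  obtain C where C: "0 \<le> C" "\<And>y \<xi>. y \<in> {x} \<Longrightarrow> 1 \<le> norm \<xi> \<Longrightarrow>
    norm (\<sigma> (y, \<xi>) - (\<Sum>q\<in>Q. s q (y, \<xi>))) \<le> C * norm \<xi> powr - (real ?n + 1)"
    by (rule symbol_expansion_bound[OF ex, of "{x}"]) (use x in auto)
  have "norm (?G R) \<le> (C * ?A) * R powr - 2" if R: "1 < R" for R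
  proof -
    let ?I = "LINT \<omega>:sphere 0 1|sphere_measure. (\<omega> \<bullet> e) *\<^sub>R \<sigma> (x, R *\<^sub>R \<omega>)"
    have pw: "complex_of_real R powr w q = of_real (R ^ (?n - 1)) * complex_of_real R powr d q" for q
    proof -
      have "complex_of_real R powr w q = complex_of_real R powr (d q + of_nat (?n - 1))"
        by (simp add: w_def of_nat_diff algebra_simps)
      also have "\<dots> = complex_of_real R powr d q * complex_of_real R powr of_nat (?n - 1)"
        by (rule powr_add)
      also have "complex_of_real R powr of_nat (?n - 1) = of_real (R ^ (?n - 1))"
        using R by (subst powr_nat') auto
      finally show ?thesis by (simp add: mult.commute)
    qed
    have "?G R = R ^ (?n - 1) *\<^sub>R (?I - (\<Sum>q\<in>Q. complex_of_real R powr d q * a q))"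
      using R by (simp add: F pw scaleR_conv_of_real right_diff_distrib sum_distrib_left mult_ac)
    then have "norm (?G R) = R ^ (?n - 1) * norm (?I - (\<Sum>q\<in>Q. complex_of_real R powr d q * a q))"
      using R by simp
    also have "\<dots> \<le> R ^ (?n - 1) * ((C * R powr - (real ?n + 1)) * ?A)"
    proof (rule mult_left_mono)
      show "norm (?I - (\<Sum>q\<in>Q. complex_of_real R powr d q * a q)) \<le> (C * R powr - (real ?n + 1)) * ?A"
        unfolding a_def
      proof (rule sphere_integral_sum_le[OF Q])
        have "continuous_on UNIV (\<lambda>\<omega>. \<sigma> (x, R *\<^sub>R \<omega>))"
          by (rule continuous_on_compose2[OF cont(1)]) (auto intro!: continuous_intros)
        then have "continuous_on (sphere 0 1) (\<lambda>\<omega>. \<sigma> (x, R *\<^sub>R \<omega>))"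
          by (rule continuous_on_subset) simp
        then show "continuous_on (sphere 0 1) (\<lambda>\<omega>. (\<omega> \<bullet> e) *\<^sub>R \<sigma> (x, R *\<^sub>R \<omega>))"
          by (intro continuous_intros)
        show "continuous_on (sphere 0 1) (\<lambda>\<omega>. (\<omega> \<bullet> e) *\<^sub>R s q (x, \<omega>))" if "q \<in> Q" for q
          by (intro continuous_intros scont that)
        fix \<omega> :: "real^'n" assume \<omega>: "norm \<omega> = 1"
        then have \<omega>0: "\<omega> \<noteq> 0" by auto
        have "(\<Sum>q\<in>Q. complex_of_real R powr d q * (\<omega> \<bullet> e) *\<^sub>R s q (x, \<omega>)) = (\<omega> \<bullet> e) *\<^sub>R (\<Sum>q\<in>Q. s q (x, R *\<^sub>R \<omega>))"
          unfolding scaleR_sum_right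
          using pos_homogeneousD[OF symbol_expansionD(2)[OF ex] x \<omega>0] R by (intro sum.cong) auto
        then have "norm ((\<omega> \<bullet> e) *\<^sub>R \<sigma> (x, R *\<^sub>R \<omega>) - (\<Sum>q\<in>Q. complex_of_real R powr d q * (\<omega> \<bullet> e) *\<^sub>R s q (x, \<omega>)))
           = \<bar>\<omega> \<bullet> e\<bar> * norm (\<sigma> (x, R *\<^sub>R \<omega>) - (\<Sum>q\<in>Q. s q (x, R *\<^sub>R \<omega>)))"
          by (simp flip: scaleR_diff_right)
        also have "\<dots> \<le> 1 * norm (\<sigma> (x, R *\<^sub>R \<omega>) - (\<Sum>q\<in>Q. s q (x, R *\<^sub>R \<omega>)))"
          using Cauchy_Schwarz_ineq2[of \<omega> e] \<omega> norm_e by (intro mult_right_mono) auto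
        also have "\<dots> \<le> C * norm (R *\<^sub>R \<omega>) powr - (real ?n + 1)"
          using C(2)[of x "R *\<^sub>R \<omega>"] R \<omega> by simp
        finally show "norm ((\<omega> \<bullet> e) *\<^sub>R \<sigma> (x, R *\<^sub>R \<omega>) - (\<Sum>q\<in>Q. complex_of_real R powr d q * (\<omega> \<bullet> e) *\<^sub>R s q (x, \<omega>)))
          \<le> C * R powr - (real ?n + 1)" using R \<omega> by simp
      qed (use C(1) in simp)
    qed (use R in simp)
    also have "R ^ (?n - 1) = R powr (real ?n - 1)"
      using R by (subst powr_realpow[symmetric]) (auto simp: of_nat_diff)
    also have "R powr (real ?n - 1) * ((C * R powr - (real ?n + 1)) * ?A) = (C * ?A) * (R powr (real ?n - 1) * R powr - (real ?n + 1))"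
      by simp
    also have "R powr (real ?n - 1) * R powr - (real ?n + 1) = R powr - 2"
      by (simp add: powr_add[symmetric])
    finally show ?thesis .
  qed
  then have "(?G \<longlongrightarrow> 0) at_top"
    by (intro tendsto_0_inverse_square eventually_mono[OF eventually_gt_at_top[of 1]]) auto
  from has_finite_part_family[OF Q this]
  have "has_finite_part ?F (0 + (\<Sum>q | q \<in> Q \<and> w q = 0. a q))" .
  moreover have "w q = 0 \<longleftrightarrow> d q = 1 - of_nat ?n" for q
    unfolding w_def by (auto simp: algebra_simps)
  moreover have "(\<Sum>q | q \<in> Q \<and> d q = 1 - of_nat ?n. a q)
    = (LINT \<omega>:sphere 0 1|sphere_measure. (\<omega> \<bullet> e) *\<^sub>R (\<Sum>q | q \<in> Q \<and> d q = 1 - of_nat ?n. s q (x, \<omega>)))"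
  proof -
    have int: "integrable sphere_measure (\<lambda>\<omega>. indicator (sphere 0 1) \<omega> *\<^sub>R (\<omega> \<bullet> e) *\<^sub>R s q (x, \<omega>))" if "q \<in> Q" for q
      unfolding set_integrable_def[symmetric]
      by (intro set_integrable_sphere continuous_intros scont that)
    show ?thesis
      unfolding a_def set_lebesgue_integral_def scaleR_sum_right
      by (rule Bochner_Integration.integral_sum[symmetric]) (rule int, simp)
  qed
  ultimately show ?thesis by simp
qed

section \<open>Finite parts of \<open>x\<close>-derivatives\<close>

lemma integral_compact_x_deriv_eq_0:
  fixes \<sigma> :: "'n::finite cot \<Rightarrow> complex"
  assumes U: "open U" and K: "compact K" "K \<subseteq> U" and supp: "\<And>x \<xi>. x \<in> U - K \<Longrightarrow> \<sigma> (x, \<xi>) = 0"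
    and diff: "\<And>p. p \<in> U \<times> UNIV \<Longrightarrow> \<sigma> differentiable (at p)"
    and cont: "continuous_on (U \<times> UNIV) \<sigma>" "continuous_on (U \<times> UNIV) (dir_deriv (a, 0) \<sigma>)"
  shows "\<And>x \<xi>. x \<in> U - K \<Longrightarrow> dir_deriv (a, 0) \<sigma> (x, \<xi>) = 0"
    and "(LINT x:K|lborel. dir_deriv (a, 0) \<sigma> (x, \<xi>)) = 0"
proof -
  show D0: "dir_deriv (a, 0) \<sigma> (x, \<xi>) = 0" if "x \<in> U - K" for x \<xi>
  proof -
    have "open ((U - K) \<times> (UNIV :: (real^'n) set))"
      using U compact_imp_closed[OF K(1)] by (intro open_Times open_Diff) auto
    then have "dir_deriv (a, 0) \<sigma> (x, \<xi>) = dir_deriv (a, 0) (\<lambda>_. 0 :: complex) (x, \<xi>)"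
      by (intro dir_deriv_cong(1)) (use that supp in auto)
    then show ?thesis by (simp add: dir_deriv_def)
  qed
  \<comment> \<open>Off \<open>U\<close> the values of \<open>\<sigma>\<close> are arbitrary, so it
    is extended by 0. The extension is regular on \<open>U\<close> and is 0 on the complement of
    \<open>K\<close>; these two open sets cover the space.\<close>
  define w where "w x = (if x \<in> U then \<sigma> (x, \<xi>) else 0)" for x
  define w' where "w' x = (if x \<in> U then dir_deriv (a, 0) \<sigma> (x, \<xi>) else 0)" for x
  have cover: "U \<union> - K = UNIV" using K(2) by auto
  have opK: "open (- K)" using compact_imp_closed[OF K(1)] by (simp add: open_Compl)
  have glue: "continuous_on UNIV f" if "continuous_on U f" "continuous_on (- K) f" for f :: "real^'n \<Rightarrow> complex"
    using continuous_on_open_Un[OF U opK that] by (simp add: cover)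
  have slice: "continuous_on U (\<lambda>x. f (x, \<xi>))" if "continuous_on (U \<times> UNIV) f" for f :: "'n cot \<Rightarrow> complex"
    by (rule continuous_on_compose2[OF that]) (auto intro!: continuous_intros)
  obtain B where B: "\<And>x. x \<in> K \<Longrightarrow> norm x \<le> B"
    using compact_imp_bounded[OF K(1)] unfolding bounded_iff by blast
  have zero: "w x = 0" "w' x = 0" if "x \<in> - K" for x
    using that supp D0 by (auto simp: w_def w'_def)
  have "integral\<^sup>L lborel w' = 0"
  proof (rule integral_directional_derivative_eq_0)
    have "continuous_on U w" "continuous_on U w'"
      using slice[OF cont(1)] slice[OF cont(2)] by (simp_all add: w_def w'_def cong: continuous_on_cong)
    moreover have "continuous_on (- K) w" "continuous_on (- K) w'"
      by (rule continuous_on_eq[of _ "\<lambda>_. 0"]; simp add: zero)+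
    ultimately show "continuous_on UNIV w" "continuous_on UNIV w'" by (auto intro: glue)
    show "w y = 0" if "norm y > B" for y
      using that B[of y] zero(1)[of y] by force
    fix y
    show "((\<lambda>t. w (y + t *\<^sub>R a)) has_vector_derivative w' y) (at 0)"
    proof (cases "y \<in> U")
      case True
      have "\<sigma> differentiable (at (y, \<xi>))" using diff True by auto
      from dir_deriv_line[OF this, of "(a, 0)"]
      have "((\<lambda>t. \<sigma> (y + t *\<^sub>R a, \<xi>)) has_vector_derivative w' y) (at 0)"
        using True by (simp add: w'_def)
      moreover have "open ((\<lambda>t::real. y + t *\<^sub>R a) -` U)"
        by (intro open_vimage U continuous_intros)
      ultimately show ?thesis
        by (rule has_vector_derivative_transform_within_open) (use True in \<open>auto simp: w_def\<close>)
    next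
      case False
      then have y: "y \<in> - K" using K(2) by auto
      have "((\<lambda>t::real. 0 :: complex) has_vector_derivative w' y) (at 0)"
        using zero(2)[OF y] by simp
      moreover have "open ((\<lambda>t::real. y + t *\<^sub>R a) -` (- K))"
        by (intro open_vimage opK continuous_intros)
      ultimately show ?thesis
        by (rule has_vector_derivative_transform_within_open) (use y zero(1) in auto)
    qed
  qed
  moreover have "w' x = indicator K x *\<^sub>R dir_deriv (a, 0) \<sigma> (x, \<xi>)" for x
    using zero(2)[of x] K(2) by (auto simp: indicator_def w'_def)
  ultimately show "(LINT x:K|lborel. dir_deriv (a, 0) \<sigma> (x, \<xi>)) = 0"
    unfolding set_lebesgue_integral_def by (simp cong: Bochner_Integration.integral_cong)
qed

text \<open>The terms \<open>Ds q\<close> keep the degrees of \<open>s q\<close>, so each fibre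
  integral expands with coefficients \<open>L q x\<close> that are integrable in \<open>x\<close>.
  An error bound uniform on \<open>K\<close> lets this expansion be integrated; the result is an
  expansion of the zero function, whose constant term must be 0.\<close>

lemma x_deriv_finite_part:
  fixes \<sigma> :: "'n::finite cot \<Rightarrow> complex"
  assumes U: "open U" and ex: "symbol_expansion U \<sigma> Q d s" and a: "a \<in> Basis"
    and K: "compact K" "K \<subseteq> U" and supp: "\<And>x \<xi>. x \<in> U - K \<Longrightarrow> \<sigma> (x, \<xi>) = 0"
  shows "\<exists>c. (\<forall>x\<in>U. has_finite_part (\<lambda>R. LINT \<xi>:cball 0 R|lborel. dir_deriv (a, 0) \<sigma> (x, \<xi>)) (c x)) \<and>
    set_integrable lborel U c \<and> (LINT x:U|lborel. c x) = 0"
proof -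
  let ?n = "CARD('n)"
  let ?A = "measure (sphere_measure :: (real^'n) measure) UNIV"
  let ?S = "sphere 0 1 :: (real^'n) set"
  \<comment> \<open>\<open>T R x\<close> is the integral \<open>G R x\<close> over the ball minus its divergent terms; it tends to the
    finite part uniformly in \<open>x \<in> K\<close>.\<close>
  define D where "D = dir_deriv (a, 0) \<sigma>"
  define Ds where "Ds q = dir_deriv (a, 0) (s q)" for q
  define L where "L q x = (LINT \<omega>:?S|sphere_measure. Ds q (x, \<omega>))" for q x
  define G where "G R x = (LINT \<xi>:cball 0 R|lborel. D (x, \<xi>))" for R x
  define P where "P q = powr_primitive (d q + of_nat ?n)" for q
  define T where "T R x = G R x - (\<Sum>q\<in>Q. L q x * P q R)" for R x
  have Q: "finite Q" by (rule symbol_expansionD[OF ex])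
  have contD: "continuous_on (U \<times> UNIV) D"
    unfolding D_def by (rule symbol_expansionD(4)[OF ex x_dir_Basis[OF a]])
  have contDs: "continuous_on (U \<times> (UNIV - {0})) (Ds q)" if "q \<in> Q" for q
    unfolding Ds_def using symbol_expansionD(2)[OF ex that] x_dir_Basis[OF a]
    by (intro smooth_on_dir_deriv_continuous) (auto simp: pos_homogeneous_def)
  note supp_D = integral_compact_x_deriv_eq_0[OF U K supp symbol_expansionD(3)[OF ex]
      symbol_expansionD(5)[OF ex] contD[unfolded D_def]]
  have D0: "D (x, \<xi>) = 0" if "x \<in> U - K" for x \<xi>
    unfolding D_def by (rule supp_D(1)[OF _ _ that])
  have intD: "(LINT x:K|lborel. D (x, \<xi>)) = 0" for \<xi>
    unfolding D_def by (rule supp_D(2))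
  obtain C0 where C0: "0 \<le> C0" "\<And>x \<xi>. x \<in> K \<Longrightarrow> 1 < norm \<xi> \<Longrightarrow>
    norm (D (x, \<xi>) - (\<Sum>q\<in>Q. Ds q (x, \<xi>))) \<le> C0 * norm \<xi> powr - (real ?n + 1)"
    unfolding D_def Ds_def using symbol_expansion_x_deriv_bound[OF ex K a] by blast
  define C where "C = C0 * ?A"
  have C: "0 \<le> C" using C0(1) by (simp add: C_def)
  have sphere_bound: "norm ((LINT \<omega>:?S|sphere_measure. D (x, R *\<^sub>R \<omega>)) - (\<Sum>q\<in>Q. complex_of_real R powr d q * L q x))
      \<le> C * R powr - (real ?n + 1)" if x: "x \<in> K" and R: "1 < R" for x R
  proof -
    have xU: "x \<in> U" using x K by auto
    have "norm ((LINT \<omega>:?S|sphere_measure. D (x, R *\<^sub>R \<omega>)) - (\<Sum>q\<in>Q. complex_of_real R powr d q * L q x))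
      \<le> (C0 * R powr - (real ?n + 1)) * ?A"
      unfolding L_def
    proof (rule sphere_integral_sum_le[OF Q])
      show "continuous_on ?S (\<lambda>\<omega>. D (x, R *\<^sub>R \<omega>))"
        by (rule continuous_on_compose2[OF contD]) (use xU in \<open>auto intro!: continuous_intros\<close>)
      show "continuous_on ?S (\<lambda>\<omega>. Ds q (x, \<omega>))" if "q \<in> Q" for q
        by (rule continuous_on_compose2[OF contDs[OF that]]) (use xU in \<open>auto intro!: continuous_intros\<close>)
      fix \<omega> :: "real^'n" assume \<omega>: "norm \<omega> = 1"
      then have \<omega>0: "\<omega> \<noteq> 0" by auto
      have "(\<Sum>q\<in>Q. complex_of_real R powr d q * Ds q (x, \<omega>)) = (\<Sum>q\<in>Q. Ds q (x, R *\<^sub>R \<omega>))"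
        unfolding Ds_def using pos_homogeneous_x_deriv[OF U symbol_expansionD(2)[OF ex] xU \<omega>0] R
        by (intro sum.cong) auto
      then show "norm (D (x, R *\<^sub>R \<omega>) - (\<Sum>q\<in>Q. complex_of_real R powr d q * Ds q (x, \<omega>))) \<le> C0 * R powr - (real ?n + 1)"
        using C0(2)[OF x, of "R *\<^sub>R \<omega>"] R \<omega> by simp
    qed (use C0(1) in simp)
    then show ?thesis by (simp add: C_def mult_ac)
  qed
  \<comment> \<open>\<open>C\<close> was chosen for the whole of \<open>K\<close>, so the rate
    \<open>C / R\<close> holds uniformly there.\<close>
  have "\<exists>c. (\<lambda>k. T (real k + 2) x) \<longlonglongrightarrow> c \<and> (\<forall>R>1. norm (T R x - c) \<le> C / R)" if "x \<in> K" for x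
    unfolding T_def G_def P_def
    by (rule ball_integral_expansion[OF continuous_on_slice[OF contD] sphere_bound[OF that] C])
       (use that K in auto)
  then obtain c0 where c0: "\<And>x. x \<in> K \<Longrightarrow> (\<lambda>k. T (real k + 2) x) \<longlonglongrightarrow> c0 x"
    "\<And>x R. x \<in> K \<Longrightarrow> 1 < R \<Longrightarrow> norm (T R x - c0 x) \<le> C / R"
    by metis
  define c where "c x = (if x \<in> K then c0 x else 0)" for x
  have CR: "((\<lambda>R::real. M / R) \<longlongrightarrow> 0) at_top" for M :: real
    by (rule tendsto_divide_0[OF tendsto_const filterlim_at_top_imp_at_infinity[OF filterlim_ident]])
  have fp: "has_finite_part (\<lambda>R. G R x) (c x)" if x: "x \<in> U" for x
  proof (cases "x \<in> K")
    case True
    have "((\<lambda>R. G R x - ((\<Sum>q\<in>Q. L q x * powr_primitive (d q + of_nat ?n) R) + c x)) \<longlongrightarrow> 0) at_top"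
    proof (rule Lim_null_comparison[OF _ CR])
      show "\<forall>\<^sub>F R in at_top. norm (G R x - ((\<Sum>q\<in>Q. L q x * powr_primitive (d q + of_nat ?n) R) + c x)) \<le> C / R"
        using eventually_gt_at_top[of 1]
      proof eventually_elim
        case (elim R)
        then show ?case using c0(2)[OF True elim] True by (simp add: T_def P_def c_def diff_diff_add)
      qed
    qed
    then show ?thesis by (rule has_finite_part_powr_primitive[OF Q])
  next
    case False
    then have "G R x = 0" for R
      unfolding G_def using D0 x by (simp add: set_lebesgue_integral_def)
    then show ?thesis using False by (simp add: c_def has_finite_part_0)
  qed
  have pair: "pair_sigma_finite (lborel :: (real^'n) measure) (lborel :: (real^'n) measure)" ..
  have contD_K: "continuous_on (K \<times> cball 0 R) D" for R
    by (rule continuous_on_subset[OF contD]) (use K in auto)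
  have cball_finite: "emeasure lborel (cball (0::real^'n) R) < \<infinity>" for R
    by (rule emeasure_compact_finite) simp
  note pairD = pair_integral_continuous_compact[OF pair sets_lborel cball_finite K(1) compact_cball contD_K]
  have iG: "set_integrable lborel K (G R)" for R
    unfolding G_def by (rule pairD(1))
  \<comment> \<open>After Fubini the inner integral runs over \<open>x\<close> and vanishes for
    every \<open>\<xi>\<close>.\<close>
  have G0: "(LINT x:K|lborel. G R x) = 0" for R
    unfolding G_def pairD(3) intD by (simp add: set_lebesgue_integral_def)
  have iL: "set_integrable lborel K (L q)" if "q \<in> Q" for q
    unfolding L_def
  proof (rule pair_integral_continuous_compact(1)[OF lborel_sphere.pair_sigma_finite_axioms sets_sphere_measure _ K(1) compact_sphere])
    show "continuous_on (K \<times> ?S) (Ds q)"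
      by (rule continuous_on_subset[OF contDs[OF that]]) (use K in auto)
  qed (simp add: sphere_measure.emeasure_eq_measure)
  have iLP: "integrable lborel (\<lambda>x. (indicator K x *\<^sub>R L q x) * P q R)" if "q \<in> Q" for q R
    by (rule integrable_mult_left[OF iL[OF that, unfolded set_integrable_def]])
  have T_eq: "indicator K x *\<^sub>R T R x = indicator K x *\<^sub>R G R x - (\<Sum>q\<in>Q. (indicator K x *\<^sub>R L q x) * P q R)" for x R
    by (simp add: T_def scaleR_diff_right scaleR_sum_right)
  have iT: "integrable lborel (\<lambda>x. indicator K x *\<^sub>R T R x)" for R
    unfolding T_eq using iG[of R] unfolding set_integrable_def
    by (intro Bochner_Integration.integrable_diff Bochner_Integration.integrable_sum iLP)
  have intT: "(\<integral>x. indicator K x *\<^sub>R T R x \<partial>lborel) = - (\<Sum>q\<in>Q. (LINT x:K|lborel. L q x) * P q R)" for R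
  proof -
    have "(\<integral>x. indicator K x *\<^sub>R T R x \<partial>lborel)
        = (LINT x:K|lborel. G R x) - (\<Sum>q\<in>Q. \<integral>x. (indicator K x *\<^sub>R L q x) * P q R \<partial>lborel)"
      unfolding T_eq set_lebesgue_integral_def
      by (simp only: Bochner_Integration.integral_diff[OF iG[unfolded set_integrable_def] Bochner_Integration.integrable_sum[OF iLP]]
          Bochner_Integration.integral_sum[OF iLP])
    then show ?thesis
      unfolding G0 by (simp only: set_lebesgue_integral_def integral_mult_left_zero diff_0)
  qed
  have Kb: "K \<in> sets lborel" using borel_compact[OF K(1)] by simp
  have iK: "integrable lborel (\<lambda>x. indicator K x * M)" for M :: real
    using borel_integrable_compact[OF K(1), of "\<lambda>_. M"] by simp
  \<comment> \<open>The single radius 2 bounds \<open>c\<close> by an integrable function, through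
    the rate \<open>C / 2\<close>. Measurability comes from the limit along the radii
    \<open>k + 2\<close>, where each \<open>T\<close> is integrable over \<open>K\<close>.\<close>
  have ic: "integrable lborel (\<lambda>x. indicator K x *\<^sub>R c x)"
  proof (rule Bochner_Integration.integrable_bound)
    show "integrable lborel (\<lambda>x. norm (indicator K x *\<^sub>R T 2 x) + indicator K x * (C / 2))"
      by (intro Bochner_Integration.integrable_add integrable_norm iT iK)
    show "AE x in lborel. norm (indicator K x *\<^sub>R c x) \<le> norm (norm (indicator K x *\<^sub>R T 2 x) + indicator K x * (C / 2))"
    proof (rule AE_I2)
      fix x
      have "norm (c0 x) \<le> norm (T 2 x) + C / 2" if "x \<in> K"
        using c0(2)[OF that, of 2] norm_triangle_ineq3[of "T 2 x" "c0 x"] by simp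
      then show "norm (indicator K x *\<^sub>R c x) \<le> norm (norm (indicator K x *\<^sub>R T 2 x) + indicator K x * (C / 2))"
        by (auto simp: indicator_def c_def)
    qed
    show "(\<lambda>x. indicator K x *\<^sub>R c x) \<in> borel_measurable lborel"
    proof (rule borel_measurable_LIMSEQ_metric)
      show "(\<lambda>x. indicator K x *\<^sub>R T (real k + 2) x) \<in> borel_measurable lborel" for k
        using iT by (rule borel_measurable_integrable)
      show "(\<lambda>k. indicator K x *\<^sub>R T (real k + 2) x) \<longlonglongrightarrow> indicator K x *\<^sub>R c x" for x
        by (cases "x \<in> K") (auto simp: c_def intro: c0(1))
    qed
  qed
  \<comment> \<open>The leading 0 is the integral of \<open>G R\<close> over \<open>K\<close>. So
    the integral of \<open>c\<close> is a finite part of the zero function.\<close>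
  have "((\<lambda>R. 0 - ((\<Sum>q\<in>Q. (LINT x:K|lborel. L q x) * powr_primitive (d q + of_nat ?n) R) + (LINT x:K|lborel. c x))) \<longlongrightarrow> 0) at_top"
  proof (rule Lim_null_comparison[OF _ CR])
    show "\<forall>\<^sub>F R in at_top. norm (0 - ((\<Sum>q\<in>Q. (LINT x:K|lborel. L q x) * powr_primitive (d q + of_nat ?n) R) + (LINT x:K|lborel. c x)))
        \<le> (C * measure lborel K) / R"
      using eventually_gt_at_top[of 1]
    proof eventually_elim
      case (elim R)
      have "0 - ((\<Sum>q\<in>Q. (LINT x:K|lborel. L q x) * powr_primitive (d q + of_nat ?n) R) + (LINT x:K|lborel. c x))
        = (\<integral>x. indicator K x *\<^sub>R T R x - indicator K x *\<^sub>R c x \<partial>lborel)"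
        using iT[of R] ic by (simp add: intT P_def set_lebesgue_integral_def)
      also have "norm \<dots> \<le> (\<integral>x. indicator K x * (C / R) \<partial>lborel)"
      proof (rule Bochner_Integration.integral_norm_bound_integral)
        show "norm (indicator K x *\<^sub>R T R x - indicator K x *\<^sub>R c x) \<le> indicator K x * (C / R)" for x
          using c0(2)[of x R] elim by (auto simp: indicator_def c_def)
      qed (use iT ic iK in auto)
      also have "\<dots> = (C * measure lborel K) / R" using Kb by simp
      finally show ?case .
    qed
  qed
  then have "has_finite_part (\<lambda>R. 0) (LINT x:K|lborel. c x)"
    by (rule has_finite_part_powr_primitive[OF Q])
  then have int0: "(LINT x:K|lborel. c x) = 0"
    using has_finite_part_unique[OF _ has_finite_part_0] by blast
  have UK: "(\<lambda>x. indicator U x *\<^sub>R c x) = (\<lambda>x. indicator K x *\<^sub>R c x)"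
    using K(2) by (auto simp: fun_eq_iff indicator_def c_def)
  show ?thesis
  proof (intro exI[of _ c] conjI ballI)
    show "has_finite_part (\<lambda>R. LINT \<xi>:cball 0 R|lborel. dir_deriv (a, 0) \<sigma> (x, \<xi>)) (c x)" if "x \<in> U" for x
      using fp[OF that] unfolding G_def D_def .
    show "set_integrable lborel U c" using ic unfolding set_integrable_def UK .
    show "(LINT x:U|lborel. c x) = 0" using int0 unfolding set_lebesgue_integral_def UK .
  qed
qed

section \<open>Stokes' formula\<close>

lemma cot_coord_xi_continuous:
  "continuous_on S (\<lambda>\<omega> :: real ^ 'n::{finite,linorder}. cot_coord k (0, \<omega>))"
  by (cases "k < CARD('n)") (auto simp: cot_coord_def intro!: continuous_intros)

lemma card_omit:
  assumes "k < 2 * CARD('n)"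
  shows "card (omit_x k :: 'n::{finite,linorder} set) + card (omit_xi k :: 'n set) = 2 * CARD('n) - 1"
  using assms omit_image[where 'n = 'n] by blast

text \<open>The component inherits the compact \<open>x\<close>-support of \<open>\<sigma>\<close>,
  so the integral reduces to a continuous function on \<open>K\<close> times the sphere, where
  Fubini applies; the sign and the coordinate factor come from the cosphere density.\<close>

lemma cosphere_integral_omit:
  fixes \<sigma> :: "'n::{finite,linorder} cot \<Rightarrow> complex"
  assumes U: "open U" and chi: "cutoff_function U chi"
    and h: "is_hom_component U chi \<sigma> (1 - of_nat CARD('n)) h"
    and supp: "compact_x_support U \<sigma>" and k: "k < 2 * CARD('n)"
  shows "set_integrable lborel U (\<lambda>x. LINT \<omega>:sphere 0 1|sphere_measure. cot_coord k (0, \<omega>) *\<^sub>R h (x, \<omega>))" (is ?int)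
    and "cosphere_integral U (\<lambda>p vs. h p * of_real (dx_dxi (omit_x k) (omit_xi k) vs)) =
      (-1) ^ k * (LINT x:U|lborel. LINT \<omega>:sphere 0 1|sphere_measure. cot_coord k (0, \<omega>) *\<^sub>R h (x, \<omega>))" (is ?eq)
proof -
  let ?S = "sphere 0 1 :: (real ^ 'n::{finite,linorder}) set"
  obtain Q :: "(nat \<times> nat) set" and d s where ex: "symbol_expansion U \<sigma> Q d s" and
    h_eq: "h = (\<lambda>p. if p \<in> U \<times> (UNIV - {0}) then \<Sum>q | q \<in> Q \<and> d q = 1 - of_nat CARD('n). s q p else 0)"
    by (rule is_hom_component_expansion[OF U chi h])
  obtain K where K: "compact K" "K \<subseteq> U" and \<sigma>0: "\<And>x \<xi>. x \<in> U - K \<Longrightarrow> \<sigma> (x, \<xi>) = 0"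
    using supp unfolding compact_x_support_def by blast
  have h0: "h (x, \<xi>) = 0" if "x \<notin> K" for x \<xi>
    using homogeneous_part_eq_0[OF ex, of x \<xi>] \<sigma>0[of x] that by (auto simp: h_eq)
  define g where "g p = cot_coord k (0, snd p) *\<^sub>R h p" for p
  have cont: "continuous_on (K \<times> ?S) g"
  proof -
    have "continuous_on (K \<times> ?S) (\<lambda>p. \<Sum>q | q \<in> Q \<and> d q = 1 - of_nat CARD('n). s q p)"
    proof (intro continuous_on_sum)
      fix q assume "q \<in> {q. q \<in> Q \<and> d q = 1 - of_nat CARD('n)}"
      then have "continuous_on (U \<times> (UNIV - {0})) (s q)"
        using pos_homogeneous_continuous[OF symbol_expansionD(2)[OF ex]] by blast
      then show "continuous_on (K \<times> ?S) (s q)"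
        by (rule continuous_on_subset) (use K in auto)
    qed
    moreover have "(\<Sum>q | q \<in> Q \<and> d q = 1 - of_nat CARD('n). s q p) = h p" if "p \<in> K \<times> ?S" for p
    proof -
      have "p \<in> U \<times> (UNIV - {0})" using that K(2) by auto
      then show ?thesis by (simp add: h_eq)
    qed
    ultimately have "continuous_on (K \<times> ?S) h" by (rule continuous_on_eq)
    moreover have "continuous_on (K \<times> ?S) (\<lambda>p. cot_coord k (0, snd p))"
      by (rule continuous_on_compose2[OF cot_coord_xi_continuous[of UNIV]]) (auto intro!: continuous_intros)
    ultimately show ?thesis unfolding g_def by (intro continuous_intros)
  qed
  have fin: "emeasure sphere_measure ?S < \<infinity>"
    by (simp add: sphere_measure.emeasure_eq_measure)
  note pair = pair_integral_continuous_compact[OF lborel_sphere.pair_sigma_finite_axioms sets_sphere_measure fin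
      K(1) compact_sphere cont]
  let ?I = "\<lambda>x. LINT \<omega>:?S|sphere_measure. cot_coord k (0, \<omega>) *\<^sub>R h (x, \<omega>)"
  have I: "indicator U x *\<^sub>R ?I x = indicator K x *\<^sub>R (LINT \<omega>:?S|sphere_measure. g (x, \<omega>))" for x
  proof (cases "x \<in> K")
    case True
    then show ?thesis using K(2) by (auto simp: g_def)
  next
    case False
    then show ?thesis by (simp add: h0 set_lebesgue_integral_def)
  qed
  show ?int using pair(1) unfolding set_integrable_def I .
  have "indicator (U \<times> ?S) p *\<^sub>R cosphere_density (\<lambda>p vs. h p * of_real (dx_dxi (omit_x k) (omit_xi k) vs)) p
    = (-1) ^ k * (indicator (K \<times> ?S) p *\<^sub>R g p)" for p
  proof (cases "p \<in> U \<times> ?S")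
    case True
    then have "norm (snd p) = 1" by auto
    from cosphere_density_omit[OF this k, of h]
    have "cosphere_density (\<lambda>p vs. h p * of_real (dx_dxi (omit_x k) (omit_xi k) vs)) p = (-1) ^ k * g p"
      by (simp add: g_def scaleR_conv_of_real)
    moreover have "g p = 0" if "p \<notin> K \<times> ?S"
    proof -
      have "fst p \<notin> K" using that True by (cases p) auto
      then show ?thesis using h0[of "fst p" "snd p"] by (simp add: g_def)
    qed
    ultimately show ?thesis using True by (cases "p \<in> K \<times> ?S") auto
  next
    case False
    then have "p \<notin> K \<times> ?S" using K(2) by auto
    with False show ?thesis by simp
  qed
  then have "cosphere_integral U (\<lambda>p vs. h p * of_real (dx_dxi (omit_x k) (omit_xi k) vs))
      = (\<integral>p. (-1) ^ k * (indicator (K \<times> ?S) p *\<^sub>R g p) \<partial>(lborel \<Otimes>\<^sub>M sphere_measure))"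
    unfolding cosphere_integral_def set_lebesgue_integral_def by presburger
  also have "\<dots> = (-1) ^ k * (LINT p:K \<times> ?S|lborel \<Otimes>\<^sub>M sphere_measure. g p)"
    unfolding set_lebesgue_integral_def by (rule integral_mult_right_zero)
  also have "(LINT p:K \<times> ?S|lborel \<Otimes>\<^sub>M sphere_measure. g p) = (LINT x:U|lborel. ?I x)"
    unfolding pair(2) unfolding set_lebesgue_integral_def[of lborel] I ..
  finally show ?eq .
qed

text \<open>Joins the two kinds of coordinates. The same sign \<open>(-1) ^ k\<close> arises from
  the exterior derivative and from the cosphere density; for \<open>k < n\<close> both sides are
  0.\<close>

lemma coordinate_derivative_finite_part:
  fixes \<sigma> :: "'n::{finite,linorder} cot \<Rightarrow> complex"
  assumes U: "open U" and chi: "cutoff_function U chi"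
    and h: "is_hom_component U chi \<sigma> (1 - of_nat CARD('n)) h"
    and supp: "compact_x_support U \<sigma>" and k: "k < 2 * CARD('n)"
  shows "\<exists>c. (\<forall>x\<in>U. has_finite_part (\<lambda>R. LINT \<xi>:cball 0 R|lborel. dir_deriv (std_frame ! k) \<sigma> (x, \<xi>)) (c x)) \<and>
    set_integrable lborel U c \<and>
    (-1) ^ k * (LINT x:U|lborel. c x)
      = cosphere_integral U (\<lambda>p vs. h p * of_real (dx_dxi (omit_x k) (omit_xi k) vs))"
proof -
  obtain Q :: "(nat \<times> nat) set" and d s where ex: "symbol_expansion U \<sigma> Q d s" and
    h_eq: "h = (\<lambda>p. if p \<in> U \<times> (UNIV - {0}) then \<Sum>q | q \<in> Q \<and> d q = 1 - of_nat CARD('n). s q p else 0)"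
    by (rule is_hom_component_expansion[OF U chi h])
  obtain K where K: "compact K" "K \<subseteq> U" and \<sigma>0: "\<And>x \<xi>. x \<in> U - K \<Longrightarrow> \<sigma> (x, \<xi>) = 0"
    using supp unfolding compact_x_support_def by blast
  note cos = cosphere_integral_omit[OF U chi h supp k]
  show ?thesis
  proof (cases "k < CARD('n)")
    case True
    have "(axis (index_list ! k) 1 :: real ^ 'n::{finite,linorder}) \<in> Basis" by (simp add: axis_in_Basis_iff)
    from x_deriv_finite_part[OF U ex this K \<sigma>0] obtain c where
      c: "\<forall>x\<in>U. has_finite_part (\<lambda>R. LINT \<xi>:cball 0 R|lborel. dir_deriv (axis (index_list ! k) 1, 0) \<sigma> (x, \<xi>)) (c x)"
        "set_integrable lborel U c" "(LINT x:U|lborel. c x) = 0" by blast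
    have "cot_coord k (0, \<omega>) = 0" for \<omega> :: "real ^ 'n::{finite,linorder}" using True by (simp add: cot_coord_def)
    then have "cosphere_integral U (\<lambda>p vs. h p * of_real (dx_dxi (omit_x k) (omit_xi k) vs)) = 0"
      unfolding cos(2) by (simp add: set_lebesgue_integral_def)
    with c True show ?thesis by (intro exI[of _ c]) (simp add: std_frame_nth)
  next
    case False
    let ?e = "axis (index_list ! (k - CARD('n))) 1 :: real ^ 'n::{finite,linorder}"
    let ?c = "\<lambda>x. LINT \<omega>:sphere 0 1|sphere_measure. cot_coord k (0, \<omega>) *\<^sub>R h (x, \<omega>)"
    have e: "?e \<in> Basis" by (simp add: axis_in_Basis_iff)
    have "has_finite_part (\<lambda>R. LINT \<xi>:cball 0 R|lborel. dir_deriv (std_frame ! k) \<sigma> (x, \<xi>)) (?c x)" if x: "x \<in> U" for x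
    proof -
      have "indicator (sphere 0 1) \<omega> *\<^sub>R cot_coord k (0, \<omega>) *\<^sub>R h (x, \<omega>)
        = indicator (sphere 0 1) \<omega> *\<^sub>R (\<omega> \<bullet> ?e) *\<^sub>R (\<Sum>q | q \<in> Q \<and> d q = 1 - of_nat CARD('n). s q (x, \<omega>))" for \<omega> :: "real ^ 'n::{finite,linorder}"
      proof (cases "\<omega> \<in> sphere 0 1")
        case True
        then have "\<omega> \<noteq> 0" by auto
        then show ?thesis using x False by (simp add: h_eq cot_coord_def inner_axis)
      qed simp
      then have "?c x = (LINT \<omega>:sphere 0 1|sphere_measure. (\<omega> \<bullet> ?e) *\<^sub>R (\<Sum>q | q \<in> Q \<and> d q = 1 - of_nat CARD('n). s q (x, \<omega>)))"
        unfolding set_lebesgue_integral_def by presburger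
      with xi_deriv_finite_part[OF ex x e] False k show ?thesis by (simp add: std_frame_nth)
    qed
    with cos show ?thesis by (intro exI[of _ ?c]) simp
  qed
qed

text \<open>Stated for any components \<open>h k\<close> rather than for
  \<open>hom_component\<close>, so that it also applies with \<open>h k = 0\<close> when the order
  is not an integer. Finite parts are added fibrewise; integrability of each \<open>c k\<close> lets
  the sum leave the integral over \<open>U\<close>.\<close>

lemma cutoff_integral_exterior_derivative:
  fixes \<beta> :: "'n::{finite,linorder} coeffs"
  assumes U: "open U" and chi: "cutoff_function U chi"
    and h: "\<And>k. k < 2 * CARD('n) \<Longrightarrow>
      is_hom_component U chi (\<beta> (omit_x k) (omit_xi k)) (1 - of_nat CARD('n)) (h k)"
    and supp: "\<And>k. k < 2 * CARD('n) \<Longrightarrow> compact_x_support U (\<beta> (omit_x k) (omit_xi k))"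
  shows "cutoff_integral_form U (ext_deriv (form_of (2 * CARD('n) - 1) \<beta>)) =
    (\<Sum>k<2 * CARD('n). cosphere_integral U (\<lambda>p vs. h k p * of_real (dx_dxi (omit_x k) (omit_xi k) vs)))"
proof -
  define D where "D k = dir_deriv (std_frame ! k) (\<beta> (omit_x k) (omit_xi k))" for k
  have "\<exists>c. (\<forall>x\<in>U. has_finite_part (\<lambda>R. LINT \<xi>:cball 0 R|lborel. D k (x, \<xi>)) (c x)) \<and>
    set_integrable lborel U c \<and> (-1) ^ k * (LINT x:U|lborel. c x)
      = cosphere_integral U (\<lambda>p vs. h k p * of_real (dx_dxi (omit_x k) (omit_xi k) vs))"
    if "k < 2 * CARD('n)" for k
    unfolding D_def by (rule coordinate_derivative_finite_part[OF U chi h[OF that] supp[OF that] that])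
  then obtain c where c: "\<And>k x. k < 2 * CARD('n) \<Longrightarrow> x \<in> U \<Longrightarrow>
      has_finite_part (\<lambda>R. LINT \<xi>:cball 0 R|lborel. D k (x, \<xi>)) (c k x)"
    and int: "\<And>k. k < 2 * CARD('n) \<Longrightarrow> set_integrable lborel U (c k)"
    and cos: "\<And>k. k < 2 * CARD('n) \<Longrightarrow> (-1) ^ k * (LINT x:U|lborel. c k x)
      = cosphere_integral U (\<lambda>p vs. h k p * of_real (dx_dxi (omit_x k) (omit_xi k) vs))"
    by metis
  have iD: "set_integrable lborel (cball 0 R) (\<lambda>\<xi>. D k (x, \<xi>))" if k: "k < 2 * CARD('n)" and x: "x \<in> U" for k x R
  proof -
    obtain Q :: "(nat \<times> nat) set" and d s where ex: "symbol_expansion U (\<beta> (omit_x k) (omit_xi k)) Q d s"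
      by (rule is_hom_component_expansion[OF U chi h[OF k]])
    have "(std_frame :: 'n cot list) ! k \<in> Basis"
      using k by (cases "k < CARD('n)") (auto simp: std_frame_nth axis_in_Basis_iff intro!: x_dir_Basis xi_dir_Basis)
    then have "continuous_on (U \<times> UNIV) (D k)" unfolding D_def by (rule symbol_expansionD(4)[OF ex])
    then show ?thesis
      using continuous_on_slice[OF _ x] continuous_on_subset[OF _ subset_UNIV]
      by (intro set_integrable_continuous_compact compact_cball) blast
  qed
  have fibre: "cutoff_integral_fibre (\<lambda>p. \<Sum>k<2 * CARD('n). (-1) ^ k * D k p) x = (\<Sum>k<2 * CARD('n). (-1) ^ k * c k x)"
    if x: "x \<in> U" for x
  proof -
    have "(LINT \<xi>:cball 0 R|lborel. \<Sum>k<2 * CARD('n). (-1) ^ k * D k (x, \<xi>))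
        = (\<Sum>k<2 * CARD('n). (-1) ^ k * (LINT \<xi>:cball 0 R|lborel. D k (x, \<xi>)))" for R
    proof -
      have i: "integrable lborel (\<lambda>\<xi>. (-1) ^ k * (indicator (cball 0 R) \<xi> *\<^sub>R D k (x, \<xi>)))" if "k \<in> {..<2 * CARD('n)}" for k
        using iD[of k x R] that x unfolding set_integrable_def by (intro integrable_mult_right) simp
      have "(LINT \<xi>:cball 0 R|lborel. \<Sum>k<2 * CARD('n). (-1) ^ k * D k (x, \<xi>))
        = (\<integral>\<xi>. (\<Sum>k<2 * CARD('n). (-1) ^ k * (indicator (cball 0 R) \<xi> *\<^sub>R D k (x, \<xi>))) \<partial>lborel)"
        unfolding set_lebesgue_integral_def
        by (intro Bochner_Integration.integral_cong) (simp_all add: scaleR_sum_right)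
      also have "\<dots> = (\<Sum>k<2 * CARD('n). (-1) ^ k * (LINT \<xi>:cball 0 R|lborel. D k (x, \<xi>)))"
        unfolding set_lebesgue_integral_def
        by (simp only: Bochner_Integration.integral_sum[OF i] integral_mult_right_zero)
      finally show ?thesis .
    qed
    moreover have "has_finite_part (\<lambda>R. \<Sum>k<2 * CARD('n). (-1) ^ k * (LINT \<xi>:cball 0 R|lborel. D k (x, \<xi>)))
        (\<Sum>k<2 * CARD('n). (-1) ^ k * c k x)"
      by (intro has_finite_part_sum has_finite_part_cmult c x) simp
    ultimately show ?thesis
      unfolding cutoff_integral_fibre_def by (intro finite_part_eq) simp
  qed
  have "cutoff_integral_form U (ext_deriv (form_of (2 * CARD('n) - 1) \<beta>))
      = (LINT x:U|lborel. cutoff_integral_fibre (\<lambda>p. \<Sum>k<2 * CARD('n). (-1) ^ k * D k p) x)"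
    unfolding cutoff_integral_form_def cutoff_integral_def ext_deriv_std_frame D_def ..
  also have "\<dots> = (\<integral>x. (\<Sum>k<2 * CARD('n). (-1) ^ k * (indicator U x *\<^sub>R c k x)) \<partial>lborel)"
    unfolding set_lebesgue_integral_def
  proof (rule Bochner_Integration.integral_cong[OF refl])
    fix x
    show "indicator U x *\<^sub>R cutoff_integral_fibre (\<lambda>p. \<Sum>k<2 * CARD('n). (-1) ^ k * D k p) x
        = (\<Sum>k<2 * CARD('n). (-1) ^ k * (indicator U x *\<^sub>R c k x))"
      by (cases "x \<in> U") (simp_all add: fibre)
  qed
  also have "\<dots> = (\<Sum>k<2 * CARD('n). (-1) ^ k * (LINT x:U|lborel. c k x))"
  proof -
    have i: "integrable lborel (\<lambda>x. (-1) ^ k * (indicator U x *\<^sub>R c k x))" if "k \<in> {..<2 * CARD('n)}" for k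
      using int[of k] that unfolding set_integrable_def by (intro integrable_mult_right) simp
    show ?thesis
      unfolding set_lebesgue_integral_def
      by (simp only: Bochner_Integration.integral_sum[OF i] integral_mult_right_zero)
  qed
  also have "\<dots> = (\<Sum>k<2 * CARD('n). cosphere_integral U (\<lambda>p vs. h k p * of_real (dx_dxi (omit_x k) (omit_xi k) vs)))"
    by (intro sum.cong) (simp_all add: cos)
  finally show ?thesis .
qed

theorem theorem4:
  fixes U :: "(real ^ 'n::{finite,linorder}) set"
    and chi :: "'n cot \<Rightarrow> complex"
    and \<beta> :: "'n coeffs"
  assumes "open U"
    and "cutoff_function U chi"
    and "\<beta> \<in> Omega_CS_com U chi (2 * CARD('n) - 1)"
    and "\<And>I J. card I + card J = 2 * CARD('n) - 1 \<Longrightarrow> \<beta> I J \<in> CS U chi"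
  shows "cutoff_integral_form U (ext_deriv (form_of (2 * CARD('n) - 1) \<beta>)) =
           (\<Sum>(I, J) | card I + card J = 2 * CARD('n) - 1.
              cosphere_integral U
                (\<lambda>p vs. hom_component U chi (\<beta> I J) (1 - of_nat CARD('n)) p * of_real (dx_dxi I J vs)))
         \<and> (\<beta> \<in> Omega_CS_com_nonint U chi (2 * CARD('n) - 1) \<longrightarrow>
           cutoff_integral_form U (ext_deriv (form_of (2 * CARD('n) - 1) \<beta>)) = 0)"
proof (intro conjI impI)
  let ?\<sigma> = "\<lambda>k. \<beta> (omit_x k) (omit_xi k)"
  let ?e = "1 - of_nat CARD('n) :: complex"
  note U = assms(1) and chi = assms(2)
  have com: "compact_x_support U (?\<sigma> k)" "\<exists>h. is_hom_component U chi (?\<sigma> k) ?e h" if "k < 2 * CARD('n)" for k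
    using Omega_CS_com_is_hom_component[OF U assms(3) card_omit[OF that]] by blast+
  have hom: "is_hom_component U chi (?\<sigma> k) ?e (hom_component U chi (?\<sigma> k) ?e)" if "k < 2 * CARD('n)" for k
    using com(2)[OF that] hom_component_eq[OF U chi] by metis
  note eq = cutoff_integral_exterior_derivative[where \<beta> = \<beta> and h = "\<lambda>k. hom_component U chi (?\<sigma> k) ?e", OF U chi hom com(1)]
  show "cutoff_integral_form U (ext_deriv (form_of (2 * CARD('n) - 1) \<beta>)) =
      (\<Sum>(I, J) | card I + card J = 2 * CARD('n) - 1. cosphere_integral U
        (\<lambda>p vs. hom_component U chi (\<beta> I J) ?e p * of_real (dx_dxi I J vs)))"
    unfolding sum_omit by (rule eq)
  assume "\<beta> \<in> Omega_CS_com_nonint U chi (2 * CARD('n) - 1)"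
  then obtain m where m: "m \<notin> \<int>" "\<beta> \<in> Omega_CS_com_order U chi (2 * CARD('n) - 1) m"
    unfolding Omega_CS_com_nonint_def by blast
  have hom0: "is_hom_component U chi (?\<sigma> k) ?e (\<lambda>_. 0)" if k: "k < 2 * CARD('n)" for k
  proof -
    have "?\<sigma> k \<in> CS_com_order U chi (m - of_nat (card (omit_xi k :: 'n set)))"
      using m(2) card_omit[OF k] unfolding Omega_CS_com_order_def by blast
    then obtain s where s: "is_hom_component U chi (?\<sigma> k) ?e
      (\<lambda>p. if p \<in> U \<times> (UNIV - {0}) then \<Sum>i | m - of_nat (card (omit_xi k :: 'n set)) - of_nat i = ?e. s i p else 0)"
      by (rule CS_com_order_is_hom_component)
    have "m - of_nat (card (omit_xi k :: 'n set)) - of_nat i \<noteq> ?e" for i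
    proof
      assume "m - of_nat (card (omit_xi k :: 'n set)) - of_nat i = ?e"
      then have "m = ?e + of_nat i + of_nat (card (omit_xi k :: 'n set))" by (simp add: algebra_simps)
      also have "\<dots> \<in> \<int>" by simp
      finally show False using m(1) by simp
    qed
    then show ?thesis using s by (simp cong: if_cong)
  qed
  \<comment> \<open>The density of the zero form is still a \<open>THE\<close>-term, so its integral
    is computed through \<open>cosphere_integral_omit\<close>.\<close>
  have "cosphere_integral U (\<lambda>p vs. 0 * of_real (dx_dxi (omit_x k) (omit_xi k :: 'n set) vs)) = 0"
    if k: "k < 2 * CARD('n)" for k
    using cosphere_integral_omit(2)[OF U chi hom0[OF k] com(1)[OF k] k]
    by (simp add: set_lebesgue_integral_def)
  then show "cutoff_integral_form U (ext_deriv (form_of (2 * CARD('n) - 1) \<beta>)) = 0"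
    using cutoff_integral_exterior_derivative[where \<beta> = \<beta> and h = "\<lambda>k p. 0", OF U chi hom0 com(1)] by simp
qed

end
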